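(* Let $a<b$ be real numbers, $\phi\in\mathcal A_2(a,b)$, let $\Omega\subset\mathbb R^d$ be a bounded convex smooth domain and $\gamma_\Omega:=\chi_\Omega\mathscr L^d$. Let $c\in(a\mathscr L^d(\Omega),b\mathscr L^d(\Omega))$ and $$\mathcal M_{(a,b),c}(\Omega):=\{\mu\in\mathcal M(\overline\Omega):\ \mu=\rho\gamma_\Omega,\ a\le\rho\le b,\ \mu(\overline\Omega)=c\}.$$ If $(\mu_n)_{n\in\mathbb N}$ is a sequence in $\mathcal M_{(a,b),c}(\Omega)$ weakly* convergent to $\mu\in\mathcal M_{(a,b),c}(\Omega)$, then $$\lim_{n\to+\infty}\mathcal W_{\phi,\gamma_\Omega}(\mu_n,\mu)=0.$$
   Context: Notation. $\mathscr L^d$ is Lebesgue measure on $\mathbb R^d$; $\mathcal M_{\rm loc}(\mathbb R^d)$, $\mathcal M^+_{\rm loc}(\mathbb R^d)$, $\mathcal M_{\rm loc}(\mathbb R^d;\mathbb R^d)$ are the signed, non-negative, and $\mathbb R^d$-valued Radon measures on $\mathbb R^d$, with the weak* topology (duality with $C_c$). $\mathcal M(\overline\Omega)$ denotes the signed Radon measures on $\overline\Omega$, regarded as measures on $\mathbb R^d$ supported in $\overline\Omega$. Admissible densities: for $1<p<\infty$, $\mathcal A_p$ is the set of l.s.c. proper convex functions $\phi:\mathbb R\times\mathbb R^d\to[0,+\infty]$ such that (F1) for every $\rho$ with $(\{\rho\}\times\mathbb R^d)\cap\mathrm{dom}(\phi)\neq\emptyset$ one has $\phi(\rho,0)=0$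 and $\phi(\rho,\lambda w)=|\lambda|^p\phi(\rho,w)$ for all $\lambda\ne0$, $w\in\mathbb R^d$; (F2) there is $\rho_0\in\mathbb R$ with $\{\rho_0\}\times\mathbb R^d\subseteq\mathrm{dom}(\phi)$ and $\phi(\rho_0,w)>0$ for all $w\neq0$. Here $\mathrm{dom}(\phi)=\{\phi<+\infty\}$. For real $a<b$, $\mathcal A_p(a,b)$ is the set of $\phi\in\mathcal A_p$ with $\mathrm{int}(\mathrm{dom}(\phi))=(a,b)\times\mathbb R^d$. In this statement $p=2$. Action functional: the recession function of $\phi$ is $\phi^\infty(y):=\sup\{\phi(x+y)-\phi(x):x\in\mathrm{dom}(\phi)\}$, $y\in\mathbb R\times\mathbb R^d$. Given $\gamma\in\mathcal M^+_{\rm loc}(\mathbb R^d)$, $\mu\in\mathcal M_{\rm loc}(\mathbb R^d)$, $\nu\in\mathcal M_{\rm loc}(\mathbb R^d;\mathbb R^d)$ with supports contained in $\mathrm{supp}(\gamma)$, write the Lebesgue decompositions $\mu=\rho\gamma+\mu^\perp$, $\nu=w\gamma+\nu^\perp$, choose $\sigma\in\mathcal M^+_{\rm loc}(\mathbb R^d)$, singular to $\gamma$, with $\mu^\perp=\rho^\perp\sigma$, $\nu^\perp=w^\perp\sigma$, and set $\Phi(\mu,\nu|\gamma):=\int\phi(\rho,w)\,d\gamma+\int\phi^\infty(\rho^\perp,w^\perp)\,d\sigma$ (independent of $\sigma$). Continuity equation: $\mathcal{CE}(0,T)$ is the set of families $(\mu_t,\nu_t)_{t\in[0,T]}$ with $t\mapsto\mu_t\in\mathcal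 M_{\rm loc}(\mathbb R^d)$ weakly* continuous on $[0,T]$, $(\nu_t)$ a Borel family in $\mathcal M_{\rm loc}(\mathbb R^d;\mathbb R^d)$, $\int_0^T|\mu_t|(B(0,R))\,dt<\infty$ and $\int_0^T|\nu_t|(B(0,R))\,dt<\infty$ for all $R>0$, and $\partial_t\mu_t+\mathrm{div}\,\nu_t=0$ in the sense of distributions on $\mathbb R^d\times(0,T)$, i.e. $\int_0^T\int\partial_t\zeta\,d\mu_t\,dt+\int_0^T\int\nabla_x\zeta\cdot d\nu_t\,dt=0$ for all $\zeta\in C^1_c(\mathbb R^d\times(0,T))$. $\mathcal{CE}_{\phi,\gamma}(0,1;\mu^0\to\mu^1)$ is the set of $(\mu,\nu)\in\mathcal{CE}(0,1)$ with $\mu_{t=0}=\mu^0$, $\mu_{t=1}=\mu^1$, supports of $\mu_t,\nu_t$ in $\mathrm{supp}(\gamma)$ for a.e. $t$, and $\int_0^1\Phi(\mu_t,\nu_t|\gamma)\,dt<+\infty$. Distance: $\mathcal W_{\phi,\gamma}(\mu^0,\mu^1):=\inf\big\{\big(\int_0^1\Phi(\mu_t,\nu_t|\gamma)\,dt\big)^{1/p}:(\mu,\nu)\in\mathcal{CE}_{\phi,\gamma}(0,1;\mu^0\to\mu^1)\big\}$, equal to $+\infty$ if this set is empty. *)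

theory Defs
  imports "HOL-Analysis.Analysis"
begin

section \<open>Radon measures\<close>

text \<open>
  A signed or vector-valued Radon measure on \<open>'a\<close> is a set function that is countably additive on
  the bounded Borel sets. Since an unbounded set need not have a well-defined value, such sets (and
  non-Borel sets) are sent to \<open>0\<close>, so that two Radon measures are equal iff they are equal as
  functions. Non-negative Radon measures are locally finite Borel measures in the library's type
  \<open>'a measure\<close>.
\<close>

definition bounded_borel :: "'a::euclidean_space set set" where
  "bounded_borel = {A. A \<in> sets borel \<and> bounded A}"

definition M_loc :: "('a::euclidean_space set \<Rightarrow> 'b::euclidean_space) set" where
  "M_loc = {m. (\<forall>A. A \<notin> bounded_borel \<longrightarrow> m A = 0) \<and>
     (\<forall>A :: nat \<Rightarrow> 'a set. range A \<subseteq> sets borel \<and> disjoint_family A \<and> bounded (\<Union>n. A n)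
        \<longrightarrow> (\<lambda>n. m (A n)) sums m (\<Union>n. A n))}"

definition M_loc_pos :: "'a::euclidean_space measure set" where
  "M_loc_pos = {\<gamma>. sets \<gamma> = sets borel \<and> (\<forall>K. compact K \<longrightarrow> emeasure \<gamma> K < \<infinity>)}"

definition total_variation :: "('a::euclidean_space set \<Rightarrow> 'b::euclidean_space) \<Rightarrow> 'a set \<Rightarrow> ennreal"
  where
  "total_variation m B =
     (SUP P \<in> {P. finite P \<and> disjoint P \<and> P \<subseteq> bounded_borel \<and> \<Union>P \<subseteq> B}.
        \<Sum>A\<in>P. ennreal (norm (m A)))"

definition msupp :: "'a::euclidean_space measure \<Rightarrow> 'a set" where
  "msupp \<gamma> = {x. \<forall>U. open U \<and> x \<in> U \<longrightarrow> emeasure \<gamma> U > 0}"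

definition vsupp :: "('a::euclidean_space set \<Rightarrow> 'b::euclidean_space) \<Rightarrow> 'a set" where
  "vsupp m = {x. \<forall>U. open U \<and> x \<in> U \<longrightarrow> total_variation m U > 0}"

text \<open>Integration against signed measures uses the Jordan decomposition; the positive part below is
  the positive variation (\<open>ennreal\<close> truncates the negative values of \<open>m\<close>).\<close>

definition jordan_pos :: "('a::euclidean_space set \<Rightarrow> real) \<Rightarrow> 'a measure" where
  "jordan_pos m = measure_of UNIV (sets borel)
     (\<lambda>B. SUP A \<in> {A. A \<in> bounded_borel \<and> A \<subseteq> B}. ennreal (m A))"

definition jordan_neg :: "('a::euclidean_space set \<Rightarrow> real) \<Rightarrow> 'a measure" where
  "jordan_neg m = jordan_pos (\<lambda>A. - m A)"

definition sint :: "('a::euclidean_space set \<Rightarrow> real) \<Rightarrow> ('a \<Rightarrow> real) \<Rightarrow> real" where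
  "sint m f = (LINT x|jordan_pos m. f x) - (LINT x|jordan_neg m. f x)"

text \<open>The scalar integral of \<open>g \<cdot> d\<nu>\<close> for vector-valued \<open>g\<close> and \<open>\<nu>\<close>.\<close>

definition vint :: "('a::euclidean_space set \<Rightarrow> 'b::euclidean_space) \<Rightarrow> ('a \<Rightarrow> 'b) \<Rightarrow> real" where
  "vint \<nu> g = (\<Sum>i\<in>Basis. sint (\<lambda>A. \<nu> A \<bullet> i) (\<lambda>x. g x \<bullet> i))"

definition C_c :: "('a::euclidean_space \<Rightarrow> real) set" where
  "C_c = {f. continuous_on UNIV f \<and> compact (closure {x. f x \<noteq> 0})}"

definition weak_star_conv ::
  "(nat \<Rightarrow> 'a::euclidean_space set \<Rightarrow> real) \<Rightarrow> ('a set \<Rightarrow> real) \<Rightarrow> bool" where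
  "weak_star_conv \<mu>s \<mu> \<longleftrightarrow> (\<forall>f\<in>C_c. (\<lambda>n. sint (\<mu>s n) f) \<longlonglongrightarrow> sint \<mu> f)"

definition weak_star_cont_on ::
  "real set \<Rightarrow> (real \<Rightarrow> 'a::euclidean_space set \<Rightarrow> real) \<Rightarrow> bool" where
  "weak_star_cont_on I \<mu> \<longleftrightarrow> (\<forall>f\<in>C_c. continuous_on I (\<lambda>t. sint (\<mu> t) f))"

definition locally_integrable ::
  "'a::euclidean_space measure \<Rightarrow> ('a \<Rightarrow> 'b::euclidean_space) \<Rightarrow> bool" where
  "locally_integrable \<gamma> f \<longleftrightarrow>
     f \<in> borel_measurable borel \<and> (\<forall>K. compact K \<longrightarrow> set_integrable \<gamma> K f)"

text \<open>The Radon measure \<open>f\<gamma>\<close>, for locally \<open>\<gamma>\<close>-integrable \<open>f\<close>.\<close>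

definition dens_measure ::
  "('a::euclidean_space \<Rightarrow> 'b::euclidean_space) \<Rightarrow> 'a measure \<Rightarrow> 'a set \<Rightarrow> 'b" where
  "dens_measure f \<gamma> A = (if A \<in> bounded_borel then (LINT x:A|\<gamma>. f x) else 0)"

definition mutually_singular :: "'a::euclidean_space measure \<Rightarrow> 'a measure \<Rightarrow> bool" where
  "mutually_singular \<sigma> \<gamma> \<longleftrightarrow> (\<exists>N\<in>sets borel. emeasure \<gamma> N = 0 \<and> emeasure \<sigma> (- N) = 0)"


section \<open>Admissible densities\<close>

definition edom :: "('x \<Rightarrow> ennreal) \<Rightarrow> 'x set" where
  "edom \<phi> = {x. \<phi> x < \<infinity>}"

definition lsc :: "('x::topological_space \<Rightarrow> ennreal) \<Rightarrow> bool" where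
  "lsc \<phi> \<longleftrightarrow> (\<forall>x. \<phi> x \<le> Liminf (at x) \<phi>)"

definition econvex :: "('x::real_vector \<Rightarrow> ennreal) \<Rightarrow> bool" where
  "econvex \<phi> \<longleftrightarrow> (\<forall>x y. \<forall>t\<in>{0..1::real}.
     \<phi> ((1 - t) *\<^sub>R x + t *\<^sub>R y) \<le> ennreal (1 - t) * \<phi> x + ennreal t * \<phi> y)"

definition admissible :: "real \<Rightarrow> (real \<times> 'a::euclidean_space \<Rightarrow> ennreal) set" where
  "admissible p = {\<phi>. lsc \<phi> \<and> edom \<phi> \<noteq> {} \<and> econvex \<phi> \<and>
     (\<forall>\<rho>. ({\<rho>} \<times> UNIV) \<inter> edom \<phi> \<noteq> {} \<longrightarrow>
        \<phi> (\<rho>, 0) = 0 \<and>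
        (\<forall>r w. r \<noteq> 0 \<longrightarrow> \<phi> (\<rho>, r *\<^sub>R w) = ennreal (\<bar>r\<bar> powr p) * \<phi> (\<rho>, w))) \<and>
     (\<exists>\<rho>\<^sub>0. {\<rho>\<^sub>0} \<times> UNIV \<subseteq> edom \<phi> \<and> (\<forall>w. w \<noteq> 0 \<longrightarrow> \<phi> (\<rho>\<^sub>0, w) > 0))}"

definition admissible_on ::
  "real \<Rightarrow> real \<Rightarrow> real \<Rightarrow> (real \<times> 'a::euclidean_space \<Rightarrow> ennreal) set" where
  "admissible_on p a b = {\<phi> \<in> admissible p. interior (edom \<phi>) = {a<..<b} \<times> UNIV}"


section \<open>Action functional\<close>

text \<open>The supremum is taken in \<open>ereal\<close> because subtraction on \<open>ennreal\<close> truncates.\<close>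

definition recession :: "('x::real_vector \<Rightarrow> ennreal) \<Rightarrow> 'x \<Rightarrow> ereal" where
  "recession \<phi> y = (SUP x\<in>edom \<phi>. enn2ereal (\<phi> (x + y)) - enn2ereal (\<phi> x))"

definition lebesgue_decomposition ::
  "('a::euclidean_space set \<Rightarrow> real) \<Rightarrow> ('a set \<Rightarrow> 'a) \<Rightarrow> 'a measure \<Rightarrow>
   ('a \<Rightarrow> real) \<Rightarrow> ('a \<Rightarrow> 'a) \<Rightarrow> 'a measure \<Rightarrow> ('a \<Rightarrow> real) \<Rightarrow> ('a \<Rightarrow> 'a) \<Rightarrow> bool" where
  "lebesgue_decomposition \<mu> \<nu> \<gamma> \<rho> w \<sigma> \<rho>s ws \<longleftrightarrow>
     \<sigma> \<in> M_loc_pos \<and> mutually_singular \<sigma> \<gamma> \<and>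
     locally_integrable \<gamma> \<rho> \<and> locally_integrable \<gamma> w \<and>
     locally_integrable \<sigma> \<rho>s \<and> locally_integrable \<sigma> ws \<and>
     \<mu> = (\<lambda>A. dens_measure \<rho> \<gamma> A + dens_measure \<rho>s \<sigma> A) \<and>
     \<nu> = (\<lambda>A. dens_measure w \<gamma> A + dens_measure ws \<sigma> A)"

text \<open>The value does not depend on the chosen decomposition, hence the definite description. The
  recession function of a non-negative convex function is non-negative, so \<open>e2ennreal\<close> loses
  nothing for admissible \<open>\<phi>\<close>.\<close>

definition action ::
  "(real \<times> 'a::euclidean_space \<Rightarrow> ennreal) \<Rightarrow> 'a measure \<Rightarrow>
   ('a set \<Rightarrow> real) \<Rightarrow> ('a set \<Rightarrow> 'a) \<Rightarrow> ennreal" where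
  "action \<phi> \<gamma> \<mu> \<nu> = (THE E. \<exists>\<rho> w \<sigma> \<rho>s ws. lebesgue_decomposition \<mu> \<nu> \<gamma> \<rho> w \<sigma> \<rho>s ws \<and>
     E = (\<integral>\<^sup>+x. \<phi> (\<rho> x, w x) \<partial>\<gamma>) + (\<integral>\<^sup>+x. e2ennreal (recession \<phi> (\<rho>s x, ws x)) \<partial>\<sigma>))"


section \<open>Continuity equation\<close>

primrec Ck_on ::
  "nat \<Rightarrow> 'x::real_normed_vector set \<Rightarrow> ('x \<Rightarrow> 'y::real_normed_vector) \<Rightarrow> bool" where
  "Ck_on 0 S f \<longleftrightarrow> continuous_on S f"
| "Ck_on (Suc k) S f \<longleftrightarrow> (\<forall>x\<in>S. f differentiable (at x)) \<and>
     (\<forall>h. Ck_on k S (\<lambda>x. frechet_derivative f (at x) h))"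

definition C1_c :: "('x::euclidean_space) set \<Rightarrow> ('x \<Rightarrow> real) set" where
  "C1_c S = {f. Ck_on 1 UNIV f \<and> compact (closure {x. f x \<noteq> 0}) \<and> closure {x. f x \<noteq> 0} \<subseteq> S}"

definition time_deriv :: "('a::euclidean_space \<times> real \<Rightarrow> real) \<Rightarrow> 'a \<times> real \<Rightarrow> real" where
  "time_deriv \<zeta> z = frechet_derivative \<zeta> (at z) (0, 1)"

definition space_grad :: "('a::euclidean_space \<times> real \<Rightarrow> real) \<Rightarrow> 'a \<times> real \<Rightarrow> 'a" where
  "space_grad \<zeta> z = (\<Sum>i\<in>Basis. frechet_derivative \<zeta> (at z) (i, 0) *\<^sub>R i)"

definition borel_family ::
  "real set \<Rightarrow> (real \<Rightarrow> 'a::euclidean_space set \<Rightarrow> 'b::euclidean_space) \<Rightarrow> bool" where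
  "borel_family I \<nu> \<longleftrightarrow>
     (\<forall>A\<in>bounded_borel. (\<lambda>t. \<nu> t A) \<in> borel_measurable (restrict_space borel I))"

definition CE ::
  "real \<Rightarrow> ((real \<Rightarrow> 'a::euclidean_space set \<Rightarrow> real) \<times> (real \<Rightarrow> 'a set \<Rightarrow> 'a)) set" where
  "CE T = {(\<mu>, \<nu>).
     (\<forall>t\<in>{0..T}. \<mu> t \<in> M_loc \<and> \<nu> t \<in> M_loc) \<and>
     weak_star_cont_on {0..T} \<mu> \<and>
     borel_family {0..T} \<nu> \<and>
     (\<forall>R>0. (\<integral>\<^sup>+t\<in>{0..T}. total_variation (\<mu> t) (ball 0 R) \<partial>lborel) < \<infinity>) \<and>
     (\<forall>R>0. (\<integral>\<^sup>+t\<in>{0..T}. total_variation (\<nu> t) (ball 0 R) \<partial>lborel) < \<infinity>) \<and>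
     (\<forall>\<zeta> \<in> C1_c (UNIV \<times> {0<..<T}).
        (LINT t:{0..T}|lborel. sint (\<mu> t) (\<lambda>x. time_deriv \<zeta> (x, t))) +
        (LINT t:{0..T}|lborel. vint (\<nu> t) (\<lambda>x. space_grad \<zeta> (x, t))) = 0)}"

definition CE_adm ::
  "(real \<times> 'a::euclidean_space \<Rightarrow> ennreal) \<Rightarrow> 'a measure \<Rightarrow> ('a set \<Rightarrow> real) \<Rightarrow> ('a set \<Rightarrow> real) \<Rightarrow>
   ((real \<Rightarrow> 'a set \<Rightarrow> real) \<times> (real \<Rightarrow> 'a set \<Rightarrow> 'a)) set" where
  "CE_adm \<phi> \<gamma> \<mu>0 \<mu>1 = {(\<mu>, \<nu>). (\<mu>, \<nu>) \<in> CE 1 \<and> \<mu> 0 = \<mu>0 \<and> \<mu> 1 = \<mu>1 \<and>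
     (AE t in lborel. t \<in> {0..1} \<longrightarrow> vsupp (\<mu> t) \<subseteq> msupp \<gamma> \<and> vsupp (\<nu> t) \<subseteq> msupp \<gamma>) \<and>
     (\<integral>\<^sup>+t\<in>{0..1}. action \<phi> \<gamma> (\<mu> t) (\<nu> t) \<partial>lborel) < \<infinity>}"

text \<open>The time integral is finite on \<^const>\<open>CE_adm\<close>, so \<^const>\<open>enn2real\<close> is faithful here; the
  infimum of the empty set is \<open>\<infinity>\<close>.\<close>

definition W_dist ::
  "real \<Rightarrow> (real \<times> 'a::euclidean_space \<Rightarrow> ennreal) \<Rightarrow> 'a measure \<Rightarrow>
   ('a set \<Rightarrow> real) \<Rightarrow> ('a set \<Rightarrow> real) \<Rightarrow> ennreal" where
  "W_dist p \<phi> \<gamma> \<mu>0 \<mu>1 = (INF (\<mu>, \<nu>) \<in> CE_adm \<phi> \<gamma> \<mu>0 \<mu>1.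
     ennreal (enn2real (\<integral>\<^sup>+t\<in>{0..1}. action \<phi> \<gamma> (\<mu> t) (\<nu> t) \<partial>lborel) powr (1 / p)))"


section \<open>Domains and bounded densities\<close>

definition smooth_on ::
  "'x::real_normed_vector set \<Rightarrow> ('x \<Rightarrow> 'y::real_normed_vector) \<Rightarrow> bool" where
  "smooth_on S f \<longleftrightarrow> (\<forall>k. Ck_on k S f)"

text \<open>Near each boundary point, \<open>\<Omega>\<close> lies on one side of the graph of a smooth function over the
  hyperplane orthogonal to some unit vector \<open>e\<close>. Only the values of \<open>g\<close> on that hyperplane matter.\<close>

definition smooth_boundary :: "'a::euclidean_space set \<Rightarrow> bool" where
  "smooth_boundary \<Omega> \<longleftrightarrow> (\<forall>x\<in>frontier \<Omega>. \<exists>r>0. \<exists>e. \<exists>g :: 'a \<Rightarrow> real.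
     norm e = 1 \<and> smooth_on UNIV g \<and>
     \<Omega> \<inter> ball x r = {y \<in> ball x r. y \<bullet> e > g (y - (y \<bullet> e) *\<^sub>R e)})"

definition smooth_domain :: "'a::euclidean_space set \<Rightarrow> bool" where
  "smooth_domain \<Omega> \<longleftrightarrow> open \<Omega> \<and> connected \<Omega> \<and> \<Omega> \<noteq> {} \<and> smooth_boundary \<Omega>"

definition gamma_dom :: "'a::euclidean_space set \<Rightarrow> 'a measure" where
  "gamma_dom \<Omega> = density lborel (indicator \<Omega>)"

definition M_closure :: "'a::euclidean_space set \<Rightarrow> ('a set \<Rightarrow> real) set" where
  "M_closure \<Omega> = {\<mu> \<in> M_loc. vsupp \<mu> \<subseteq> closure \<Omega>}"

definition M_abc ::
  "real \<Rightarrow> real \<Rightarrow> real \<Rightarrow> 'a::euclidean_space set \<Rightarrow> ('a set \<Rightarrow> real) set" where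
  "M_abc a b c \<Omega> = {\<mu> \<in> M_closure \<Omega>.
     (\<exists>\<rho>. locally_integrable (gamma_dom \<Omega>) \<rho> \<and> \<mu> = dens_measure \<rho> (gamma_dom \<Omega>) \<and>
        (AE x in gamma_dom \<Omega>. a \<le> \<rho> x \<and> \<rho> x \<le> b)) \<and>
     \<mu> (closure \<Omega>) = c}"

end

theory Submission
  imports Defs
begin

text \<open>
  Two densities \<open>\<rho>\<^sub>0, \<rho>\<^sub>1\<close> with the same mass are joined by \<open>(1 - s)((1 - \<theta>) \<rho>\<^sub>0 + \<theta> \<rho>\<^sub>1) + s m\<close>,
  where \<open>m = c / |\<Omega>|\<close> and \<open>s\<close> is a small bump vanishing at the two ends of the time interval.
  Convexity gives \<open>\<phi>((1 - s) q + s m, w) \<le> \<phi>(m, w) / s \<le> C |w|\<^sup>2 / s\<close>. The momentum is a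
  combination of the Bogovskii fields \<open>u\<^sub>i\<close> of \<open>\<rho>\<^sub>i - m\<close>; as \<open>\<Omega>\<close> is convex, these are explicit,
  bounded and supported in \<open>\<Omega>\<close>. If \<open>s\<close> has size \<open>\<epsilon>\<close>, the action is of order
  \<open>\<epsilon> + \<parallel>u\<^sub>1 - u\<^sub>0\<parallel>\<^sup>2 / \<epsilon>\<close>, with the norm of \<open>L\<^sup>2\<close>. The field at a point is the integral of the
  density against an integrable kernel, so weak* convergence of the densities yields pointwise,
  hence \<open>L\<^sup>2\<close>, convergence of the fields, after which \<open>\<epsilon>\<close> can be sent to \<open>0\<close>.
\<close>

section \<open>Measures with an integrable density\<close>

text \<open>The obstacle is that \<open>\<phi> (r, w)\<close> may blow up as \<open>r\<close>
  approaches \<open>a\<close> or \<open>b\<close>, values that the given densities may take on large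
  sets, so a straight interpolation can have infinite action. The hypothesis on \<open>c\<close>
  says precisely \<open>a < m < b\<close>; on the slice of density \<open>m\<close>, convexity and
  homogeneity give quadratic growth in \<open>w\<close>, and no other slice needs a growth bound.
  The momentum must not cross the boundary of \<Omega>. This is expressed by extending it by zero
  and testing against functions on the whole space, which is why the field is built from segments
  that stay inside \<Omega>. The price is a kernel with a sharp cutoff and a factor
  \<open>1 / s^d\<close>, where d is the dimension. The cutoff set is open, so weak* convergence
  still passes to the limit, and its volume shrinks with \<open>s\<close> fast enough to absorb the
  factor. The resulting bounds depend only on \<Omega> and \<open>b - a\<close>, hence are uniform
  along the sequence. With \<delta> the distance of the two fields in the mean square, the bound
  \<epsilon> + \<delta>^2 / \<epsilon> is balanced by \<epsilon> of the size of \<delta>.\<close>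

lemma bounded_borel_iff: "A \<in> bounded_borel \<longleftrightarrow> A \<in> sets borel \<and> bounded A"
  by (simp add: bounded_borel_def)

section \<open>Jordan decomposition of a density and integration against it\<close>

lemma ennreal_integral_le_nn_integral:
  fixes f :: "'a \<Rightarrow> real"
  assumes "integrable M f"
  shows "ennreal (integral\<^sup>L M f) \<le> (\<integral>\<^sup>+x. ennreal (f x) \<partial>M)"
proof -
  have "(\<integral>\<^sup>+x. ennreal (f x) \<partial>M) < top"
    using assms by (simp add: real_integrable_def less_top)
  moreover have "integral\<^sup>L M f \<le> enn2real (\<integral>\<^sup>+x. ennreal (f x) \<partial>M)"
    by (simp add: real_lebesgue_integral_def[OF assms])
  ultimately show ?thesis
    by (metis ennreal_enn2real ennreal_leI)
qed

text \<open>For a measure with density \<open>f\<close> the Hahn set is explicit: the supremum is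
  approached by cutting \<open>B\<close> down to \<open>f > 0\<close>, and further to balls, since
  the competing sets must be bounded. Note that \<open>density \<gamma> f\<close> truncates the
  negative values of \<open>f\<close>, so the right-hand side is the positive part.\<close>

lemma SUP_bounded_borel_integral:
  fixes f :: "'a::euclidean_space \<Rightarrow> real"
  assumes sets_\<gamma>[measurable_cong]: "sets \<gamma> = sets borel" and f: "integrable \<gamma> f" and B: "B \<in> sets borel"
  shows "(SUP A \<in> {A. A \<in> bounded_borel \<and> A \<subseteq> B}. ennreal (LINT x:A|\<gamma>. f x))
    = emeasure (density \<gamma> f) B" (is "?L = ?R")
proof (rule antisym)
  have [measurable]: "f \<in> borel_measurable borel"
    using borel_measurable_integrable[OF f] by (simp add: measurable_cong_sets[OF sets_\<gamma> refl])
  let ?D = "density \<gamma> f"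
  have em: "emeasure ?D A = (\<integral>\<^sup>+x. ennreal (f x) * indicator A x \<partial>\<gamma>)" if "A \<in> sets borel" for A
    using that f by (intro emeasure_density) (auto simp: sets_\<gamma>)
  show "?L \<le> ?R"
  proof (rule SUP_least)
    fix A assume A: "A \<in> {A. A \<in> bounded_borel \<and> A \<subseteq> B}"
    then have A': "A \<in> sets borel" "A \<subseteq> B" by (auto simp: bounded_borel_iff)
    have int: "integrable \<gamma> (\<lambda>x. indicator A x *\<^sub>R f x)"
      using A' f by (intro integrable_mult_indicator) (auto simp: sets_\<gamma>)
    have "ennreal (LINT x:A|\<gamma>. f x) \<le> (\<integral>\<^sup>+x. ennreal (indicator A x *\<^sub>R f x) \<partial>\<gamma>)"
      unfolding set_lebesgue_integral_def by (rule ennreal_integral_le_nn_integral[OF int])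
    also have "\<dots> = emeasure ?D A"
      by (subst em[OF A'(1)], intro nn_integral_cong) (auto simp: indicator_def)
    also have "\<dots> \<le> ?R"
      using A' B by (intro emeasure_mono) (auto simp: sets_\<gamma>)
    finally show "ennreal (LINT x:A|\<gamma>. f x) \<le> ?R" .
  qed
  define P where "P k = B \<inter> {x. f x > 0} \<inter> ball 0 (real k)" for k :: nat
  have P: "P k \<in> sets borel" for k
    using B unfolding P_def by measurable
  have "(\<Union>k. P k) = B \<inter> {x. f x > 0}"
    by (auto simp: P_def) (meson reals_Archimedean2)
  moreover have "incseq P"
    by (auto simp: incseq_def P_def)
  ultimately have "(SUP k. emeasure ?D (P k)) = emeasure ?D (B \<inter> {x. f x > 0})"
    using SUP_emeasure_incseq[of P ?D] P by (simp add: sets_\<gamma> image_subset_iff)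
  also have "\<dots> = ?R"
  proof -
    have "B \<inter> {x. f x > 0} \<in> sets borel" using B by measurable
    then show ?thesis
      by (subst (1 2) em) (auto simp: B indicator_def ennreal_neg intro!: nn_integral_cong)
  qed
  finally have "?R = (SUP k. emeasure ?D (P k))" ..
  also have "\<dots> \<le> ?L"
  proof (rule SUP_least)
    fix k
    have int: "integrable \<gamma> (\<lambda>x. indicator (P k) x *\<^sub>R f x)"
      using P f by (intro integrable_mult_indicator) (auto simp: sets_\<gamma>)
    have "emeasure ?D (P k) = (\<integral>\<^sup>+x. ennreal (indicator (P k) x *\<^sub>R f x) \<partial>\<gamma>)"
      by (subst em[OF P], intro nn_integral_cong) (auto simp: indicator_def)
    also have "\<dots> = ennreal (LINT x:P k|\<gamma>. f x)"
      unfolding set_lebesgue_integral_def using int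
      by (intro nn_integral_eq_integral) (auto simp: P_def indicator_def)
    finally show "emeasure ?D (P k) \<le> ?L"
      using P by (auto intro!: SUP_upper2[of "P k"] simp: bounded_borel_iff P_def bounded_Int)
  qed
  finally show "?R \<le> ?L" .
qed

text \<open>\<open>measure_of\<close> keeps a set function only if it is a measure. Recognising the
  supremum as the \<open>emeasure\<close> of an existing measure settles this and computes the
  positive variation at once.\<close>

lemma jordan_pos_dens_measure:
  fixes f :: "'a::euclidean_space \<Rightarrow> real"
  assumes "sets \<gamma> = sets borel" and "integrable \<gamma> f"
  shows "jordan_pos (dens_measure f \<gamma>) = density \<gamma> f"
proof -
  have "jordan_pos (dens_measure f \<gamma>) = measure_of UNIV (sets borel) (emeasure (density \<gamma> f))"
    unfolding jordan_pos_def
  proof (rule measure_of_eq)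
    fix B :: "'a set" assume "B \<in> sigma_sets UNIV (sets borel)"
    then have B: "B \<in> sets borel"
      by (metis sets.sigma_sets_eq space_borel)
    show "(SUP A \<in> {A. A \<in> bounded_borel \<and> A \<subseteq> B}. ennreal (dens_measure f \<gamma> A))
        = emeasure (density \<gamma> f) B"
      unfolding SUP_bounded_borel_integral[OF assms B, symmetric]
      by (intro SUP_cong) (auto simp: dens_measure_def)
  qed auto
  also have "\<dots> = density \<gamma> f"
    using measure_of_of_measure[of "density \<gamma> f"] sets_eq_imp_space_eq[OF assms(1)] assms(1)
    by simp
  finally show ?thesis .
qed

lemma jordan_neg_dens_measure:
  fixes f :: "'a::euclidean_space \<Rightarrow> real"
  assumes "sets \<gamma> = sets borel" and "integrable \<gamma> f"
  shows "jordan_neg (dens_measure f \<gamma>) = density \<gamma> (\<lambda>x. - f x)"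
proof -
  have "(\<lambda>A. - dens_measure f \<gamma> A) = dens_measure (\<lambda>x. - f x) \<gamma>"
    by (auto simp: dens_measure_def set_lebesgue_integral_def fun_eq_iff)
  then show ?thesis
    using assms by (simp add: jordan_neg_def jordan_pos_dens_measure)
qed

lemma integral_density_pos_part:
  fixes f g :: "'a \<Rightarrow> real"
  assumes [measurable]: "f \<in> borel_measurable M" "g \<in> borel_measurable M"
  shows "(LINT x|density M f. g x) = (LINT x|M. max 0 (f x) * g x)"
proof -
  have "density M (\<lambda>x. ennreal (f x)) = density M (\<lambda>x. ennreal (max 0 (f x)))"
    by (intro density_cong) (auto simp: max_def ennreal_neg)
  then show ?thesis
    by (simp add: integral_density)
qed

text \<open>The two Jordan parts have densities \<open>max 0 (f x)\<close> and
  \<open>max 0 (- f x)\<close>; their products with \<open>g\<close> are dominated by the product of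
  \<open>f\<close> and \<open>g\<close>, so the difference of the integrals recombines without
  cancellation of infinities.\<close>

lemma sint_dens_measure:
  fixes f g :: "'a::euclidean_space \<Rightarrow> real"
  assumes sets_\<gamma>[measurable_cong]: "sets \<gamma> = sets borel"
    and f: "integrable \<gamma> f" and g: "g \<in> borel_measurable borel"
    and fg: "integrable \<gamma> (\<lambda>x. f x * g x)"
  shows "sint (dens_measure f \<gamma>) g = (LINT x|\<gamma>. f x * g x)"
proof -
  have [measurable]: "f \<in> borel_measurable \<gamma>" using f by auto
  have [measurable]: "g \<in> borel_measurable \<gamma>"
    using g by (simp add: measurable_cong_sets[OF sets_\<gamma> refl])
  have "integrable \<gamma> (\<lambda>x. max 0 (f x) * g x)" "integrable \<gamma> (\<lambda>x. max 0 (- f x) * g x)"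
    by (rule Bochner_Integration.integrable_bound[OF fg]; auto simp: abs_mult intro!: mult_right_mono)+
  then have "(LINT x|\<gamma>. max 0 (f x) * g x) - (LINT x|\<gamma>. max 0 (- f x) * g x)
      = (LINT x|\<gamma>. max 0 (f x) * g x - max 0 (- f x) * g x)"
    by simp
  also have "\<dots> = (LINT x|\<gamma>. f x * g x)"
    by (intro Bochner_Integration.integral_cong) (auto simp: max_def)
  finally show ?thesis
    by (simp add: sint_def jordan_pos_dens_measure[OF sets_\<gamma> f] jordan_neg_dens_measure[OF sets_\<gamma> f]
        integral_density_pos_part)
qed

lemma dens_measure_inner:
  fixes f :: "'a::euclidean_space \<Rightarrow> 'b::euclidean_space"
  assumes "sets \<gamma> = sets borel" and "integrable \<gamma> f"
  shows "(\<lambda>A. dens_measure f \<gamma> A \<bullet> i) = dens_measure (\<lambda>x. f x \<bullet> i) \<gamma>"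
proof
  fix A
  have "(LINT x:A|\<gamma>. f x) \<bullet> i = (LINT x:A|\<gamma>. f x \<bullet> i)" if "A \<in> sets borel"
  proof -
    have "integrable \<gamma> (\<lambda>x. indicator A x *\<^sub>R f x)"
      using that assms by (intro integrable_mult_indicator) auto
    then show ?thesis
      unfolding set_lebesgue_integral_def
      by (subst integral_inner_left[symmetric]) auto
  qed
  then show "dens_measure f \<gamma> A \<bullet> i = dens_measure (\<lambda>x. f x \<bullet> i) \<gamma> A"
    by (auto simp: dens_measure_def bounded_borel_iff)
qed

lemma vint_dens_measure:
  fixes f g :: "'a::euclidean_space \<Rightarrow> 'a"
  assumes sets_\<gamma>: "sets \<gamma> = sets borel"
    and f: "integrable \<gamma> f" and g: "g \<in> borel_measurable borel" and B: "\<And>x. norm (g x) \<le> B"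
  shows "vint (dens_measure f \<gamma>) g = (LINT x|\<gamma>. f x \<bullet> g x)"
proof -
  have gm: "g \<in> borel_measurable \<gamma>"
    using g by (simp add: measurable_cong_sets[OF sets_\<gamma> refl])
  have int: "integrable \<gamma> (\<lambda>x. (f x \<bullet> i) * (g x \<bullet> i))" if "i \<in> Basis" for i
  proof (rule Bochner_Integration.integrable_bound)
    show "integrable \<gamma> (\<lambda>x. B *\<^sub>R f x)" using f by simp
    show "(\<lambda>x. (f x \<bullet> i) * (g x \<bullet> i)) \<in> borel_measurable \<gamma>"
      using gm f by measurable
    have "\<bar>f x \<bullet> i\<bar> * \<bar>g x \<bullet> i\<bar> \<le> norm (f x) * B" for x
      using Basis_le_norm[OF that] B by (intro mult_mono) (auto intro: order_trans)
    moreover have "0 \<le> B" using B norm_ge_zero order_trans by blast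
    ultimately show "AE x in \<gamma>. norm ((f x \<bullet> i) * (g x \<bullet> i)) \<le> norm (B *\<^sub>R f x)"
      by (auto simp: abs_mult mult.commute)
  qed
  have "vint (dens_measure f \<gamma>) g = (\<Sum>i\<in>Basis. LINT x|\<gamma>. (f x \<bullet> i) * (g x \<bullet> i))"
    unfolding vint_def dens_measure_inner[OF sets_\<gamma> f]
    using f g int by (intro sum.cong refl sint_dens_measure[OF sets_\<gamma>]) auto
  also have "\<dots> = (LINT x|\<gamma>. f x \<bullet> g x)"
    using int by (subst Bochner_Integration.integral_sum[symmetric]) (auto simp: euclidean_inner[symmetric])
  finally show ?thesis .
qed

section \<open>Densities as Radon measures: additivity, total variation, support\<close>

text \<open>Continuity of the integral along the increasing finite unions. Since the whole union is
  bounded, every piece lies in \<open>bounded_borel\<close> and the default value 0 never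
  interferes.\<close>

lemma dens_measure_in_M_loc:
  fixes f :: "'a::euclidean_space \<Rightarrow> 'b::euclidean_space"
  assumes sets_\<gamma>: "sets \<gamma> = sets borel" and f: "integrable \<gamma> f"
  shows "dens_measure f \<gamma> \<in> M_loc"
proof -
  have "(\<lambda>n. dens_measure f \<gamma> (A n)) sums dens_measure f \<gamma> (\<Union>n. A n)"
    if A: "range A \<subseteq> sets borel" "disjoint_family A" "bounded (\<Union>n. A n)" for A :: "nat \<Rightarrow> 'a set"
  proof -
    have si: "set_integrable \<gamma> X f" if "X \<in> sets borel" for X
      unfolding set_integrable_def using that f by (intro integrable_mult_indicator) (auto simp: sets_\<gamma>)
    have An: "A n \<in> sets borel" for n using A by auto
    have bd: "bounded (A n)" for n using A(3) by (rule bounded_subset) auto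
    have *: "(\<Sum>i<n. dens_measure f \<gamma> (A i)) = (LINT x:(\<Union>i<n. A i)|\<gamma>. f x)" for n
      using An bd A si
      by (subst set_integral_finite_Union)
        (auto simp: dens_measure_def bounded_borel_iff disjoint_family_on_def sets_\<gamma>)
    have "(\<lambda>n. LINT x:(\<Union>i<n. A i)|\<gamma>. f x) \<longlonglongrightarrow> (LINT x:(\<Union>n. \<Union>i<n. A i)|\<gamma>. f x)"
      using An si by (intro set_integral_cont_up) (fastforce simp: sets_\<gamma> incseq_def)+
    moreover have "(\<Union>n. \<Union>i<n. A i) = (\<Union>n. A n)" by auto
    ultimately show ?thesis
      using An A by (simp add: sums_def * ) (simp add: dens_measure_def bounded_borel_iff sets.countable_UN)
  qed
  then show ?thesis
    by (auto simp: M_loc_def dens_measure_def)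
qed

text \<open>The members of a competing family are disjoint, so at each point at most one copy of the
  norm of \<open>f\<close> is counted. This upper bound is all that the finiteness conditions of
  \<open>CE\<close> and the support conditions call for.\<close>

lemma total_variation_dens_measure_le:
  fixes f :: "'a::euclidean_space \<Rightarrow> 'b::euclidean_space"
  assumes sets_\<gamma>: "sets \<gamma> = sets borel" and f: "integrable \<gamma> f" and B: "B \<in> sets borel"
  shows "total_variation (dens_measure f \<gamma>) B \<le> (\<integral>\<^sup>+x\<in>B. norm (f x) \<partial>\<gamma>)"
  unfolding total_variation_def
proof (rule SUP_least)
  fix P assume "P \<in> {P. finite P \<and> disjoint P \<and> P \<subseteq> bounded_borel \<and> \<Union> P \<subseteq> B}"
  then have P: "finite P" "disjoint P" "P \<subseteq> bounded_borel" "\<Union> P \<subseteq> B" by auto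
  have le: "ennreal (norm (dens_measure f \<gamma> A)) \<le> (\<integral>\<^sup>+x\<in>A. norm (f x) \<partial>\<gamma>)" if "A \<in> P" for A
  proof -
    have A: "A \<in> sets borel" "A \<in> bounded_borel" using P that by (auto simp: bounded_borel_iff)
    have "ennreal (norm (LINT x|\<gamma>. indicator A x *\<^sub>R f x)) \<le> (\<integral>\<^sup>+x. norm (indicator A x *\<^sub>R f x) \<partial>\<gamma>)"
      using A f by (intro integral_norm_bound_ennreal integrable_mult_indicator) (auto simp: sets_\<gamma>)
    also have "\<dots> = (\<integral>\<^sup>+x\<in>A. norm (f x) \<partial>\<gamma>)"
      by (intro nn_integral_cong) (auto simp: indicator_def)
    finally show ?thesis using A by (simp add: dens_measure_def set_lebesgue_integral_def)
  qed
  have m: "(\<lambda>x. ennreal (norm (f x)) * indicator A x) \<in> borel_measurable \<gamma>" if "A \<in> sets borel" for A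
    using f that sets_\<gamma> by (intro borel_measurable_times_ennreal borel_measurable_indicator) auto
  have "(\<Sum>A\<in>P. ennreal (norm (dens_measure f \<gamma> A))) \<le> (\<Sum>A\<in>P. \<integral>\<^sup>+x\<in>A. norm (f x) \<partial>\<gamma>)"
    by (intro sum_mono le)
  also have "\<dots> = (\<integral>\<^sup>+x. (\<Sum>A\<in>P. ennreal (norm (f x)) * indicator A x) \<partial>\<gamma>)"
    using P(3) by (subst nn_integral_sum) (auto simp: bounded_borel_iff intro!: m)
  also have "\<dots> \<le> (\<integral>\<^sup>+x\<in>B. norm (f x) \<partial>\<gamma>)"
  proof (intro nn_integral_mono)
    fix x
    show "(\<Sum>A\<in>P. ennreal (norm (f x)) * indicator A x) \<le> ennreal (norm (f x)) * indicator B x"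
    proof (cases "\<exists>A\<in>P. x \<in> A")
      case True
      then obtain A where A: "A \<in> P" "x \<in> A" by auto
      have "(\<Sum>A\<in>P. ennreal (norm (f x)) * indicator A x)
          = (\<Sum>C\<in>P. if C = A then ennreal (norm (f x)) else 0)"
        using A P(2) by (intro sum.cong refl) (auto simp: indicator_def disjoint_def)
      also have "\<dots> = ennreal (norm (f x))" using P A by simp
      finally show ?thesis using A P by (auto simp: indicator_def)
    next
      case False
      then have "(\<Sum>A\<in>P. ennreal (norm (f x)) * indicator A x) = 0"
        by (intro sum.neutral) (auto simp: indicator_def)
      then show ?thesis by simp
    qed
  qed
  finally show "(\<Sum>A\<in>P. ennreal (norm (dens_measure f \<gamma> A))) \<le> (\<integral>\<^sup>+x\<in>B. norm (f x) \<partial>\<gamma>)" .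
qed

text \<open>A point outside \<open>msupp \<gamma>\<close> has a \<gamma>-null open neighbourhood, on
  which the total variation vanishes.\<close>

lemma vsupp_dens_measure_subset:
  fixes f :: "'a::euclidean_space \<Rightarrow> 'b::euclidean_space"
  assumes sets_\<gamma>: "sets \<gamma> = sets borel" and f: "integrable \<gamma> f"
  shows "vsupp (dens_measure f \<gamma>) \<subseteq> msupp \<gamma>"
proof
  fix x assume x: "x \<in> vsupp (dens_measure f \<gamma>)"
  have "emeasure \<gamma> U > 0" if U: "open U" "x \<in> U" for U
  proof (rule ccontr)
    assume "\<not> ?thesis"
    then have "U \<in> null_sets \<gamma>" using U by (auto simp: null_sets_def sets_\<gamma>)
    then have "(\<integral>\<^sup>+x\<in>U. norm (f x) \<partial>\<gamma>) = 0"
      by (rule nn_integral_null_set)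
    then have "total_variation (dens_measure f \<gamma>) U \<le> 0"
      using total_variation_dens_measure_le[OF sets_\<gamma> f, of U] U by auto
    then show False using x U by (auto simp: vsupp_def)
  qed
  then show "x \<in> msupp \<gamma>" by (auto simp: msupp_def)
qed

section \<open>Uniqueness of the Lebesgue decomposition and the action of a density\<close>

lemma M_loc_pos_sigma_finite:
  assumes "\<sigma> \<in> M_loc_pos"
  shows "sigma_finite_measure \<sigma>"
proof
  have "sets \<sigma> = sets borel" "\<And>n::nat. emeasure \<sigma> (cball 0 (real n)) \<noteq> \<infinity>"
    using assms by (auto simp: M_loc_pos_def less_top[symmetric])
  moreover have "(\<Union>n::nat. cball 0 (real n)) = (UNIV :: 'a set)"
    by (auto simp: real_arch_simple)
  ultimately show "\<exists>A. countable A \<and> A \<subseteq> sets \<sigma> \<and> \<Union> A = space \<sigma> \<and> (\<forall>a\<in>A. emeasure \<sigma> a \<noteq> \<infinity>)"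
    by (intro exI[of _ "range (\<lambda>n::nat. cball 0 (real n))"])
      (auto simp: sets_eq_imp_space_eq[of \<sigma> borel])
qed

text \<open>The density is only locally integrable, so it is first cut off to balls of integer
  radius, where it is integrable; the countably many exceptional null sets are then
  collected.\<close>

lemma dens_measure_eq_0_imp_AE:
  fixes f :: "'a::euclidean_space \<Rightarrow> 'b::euclidean_space"
  assumes \<gamma>: "\<gamma> \<in> M_loc_pos" and f: "locally_integrable \<gamma> f"
    and 0: "\<And>A. A \<in> bounded_borel \<Longrightarrow> (LINT x:A|\<gamma>. f x) = 0"
  shows "AE x in \<gamma>. f x = 0"
proof -
  interpret sigma_finite_measure \<gamma> by (rule M_loc_pos_sigma_finite[OF \<gamma>])
  have sets_\<gamma>: "sets \<gamma> = sets borel" using \<gamma> by (auto simp: M_loc_pos_def)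
  have "AE x in \<gamma>. indicat_real (cball 0 (real n)) x *\<^sub>R f x = 0" for n :: nat
  proof (rule density_zero)
    show "integrable \<gamma> (\<lambda>x. indicat_real (cball 0 (real n)) x *\<^sub>R f x)"
      using f by (auto simp: locally_integrable_def set_integrable_def)
    fix A assume "A \<in> sets \<gamma>"
    then have "A \<inter> cball 0 (real n) \<in> bounded_borel"
      by (auto simp: bounded_borel_iff sets_\<gamma>)
    from 0[OF this]
    show "(LINT x:A|\<gamma>. indicat_real (cball 0 (real n)) x *\<^sub>R f x) = 0"
      by (simp add: set_lebesgue_integral_def indicator_inter_arith)
  qed
  then have "AE x in \<gamma>. \<forall>n::nat. indicat_real (cball 0 (real n)) x *\<^sub>R f x = 0"
    unfolding AE_all_countable by blast
  then show ?thesis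
  proof eventually_elim
    case (elim x)
    obtain n :: nat where "norm x \<le> real n" using real_arch_simple by blast
    with elim[rule_format, of n] show ?case by (auto simp: indicator_def)
  qed
qed

text \<open>Let \<open>N\<close> be \<gamma>-null and carry \<sigma>. Testing the identity on
  \<open>A - N\<close> removes the singular term and identifies \<open>f\<close> with
  \<open>f'\<close>; testing it on \<open>A \<inter> N\<close> removes both \<gamma>-terms and
  forces \<open>g\<close> to vanish. Applied to density and momentum, this justifies the definite
  description in \<open>action\<close>.\<close>

lemma singular_decomposition_unique:
  fixes f f' g :: "'a::euclidean_space \<Rightarrow> 'b::euclidean_space"
  assumes \<gamma>: "\<gamma> \<in> M_loc_pos" and \<sigma>: "\<sigma> \<in> M_loc_pos" and sing: "mutually_singular \<sigma> \<gamma>"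
    and f: "locally_integrable \<gamma> f" and f': "locally_integrable \<gamma> f'" and g: "locally_integrable \<sigma> g"
    and eq: "dens_measure f' \<gamma> = (\<lambda>A. dens_measure f \<gamma> A + dens_measure g \<sigma> A)"
  shows "AE x in \<gamma>. f x = f' x" and "AE x in \<sigma>. g x = 0"
proof -
  obtain N where N: "N \<in> sets borel" "emeasure \<gamma> N = 0" "emeasure \<sigma> (- N) = 0"
    using sing by (auto simp: mutually_singular_def)
  have sets: "sets \<gamma> = sets borel" "sets \<sigma> = sets borel" using \<gamma> \<sigma> by (auto simp: M_loc_pos_def)
  have AE: "AE x in \<gamma>. x \<notin> N" "AE x in \<sigma>. x \<in> N"
    using N by (intro AE_not_in AE_I[of _ _ "- N"]; auto simp: sets null_sets_def)+
  have meas: "f \<in> borel_measurable borel" "f' \<in> borel_measurable borel" "g \<in> borel_measurable borel"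
    using f f' g by (auto simp: locally_integrable_def)
  note meas' = meas(1,2)[unfolded measurable_cong_sets[OF sets(1)[symmetric] refl]]
    meas(3)[unfolded measurable_cong_sets[OF sets(2)[symmetric] refl]]
  have int: "set_integrable M A h"
    if h: "locally_integrable M h" "sets M = sets borel" and A: "A \<in> bounded_borel"
    for M and h :: "'a \<Rightarrow> 'b" and A
  proof -
    from A have "A \<subseteq> closure A" "compact (closure A)" "A \<in> sets borel"
      by (auto simp: closure_subset bounded_borel_iff compact_closure)
    moreover from this have "set_integrable M (closure A) h"
      using h(1) unfolding locally_integrable_def by blast
    ultimately show ?thesis
      using h(2) set_integrable_subset by metis
  qed
  have cong: "(LINT x:A|M. h x) = (LINT x:C|M. h x)"
    if "AE x in M. x \<in> A \<longleftrightarrow> x \<in> C" "A \<in> sets M" "C \<in> sets M" "h \<in> borel_measurable M"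
    for M A C and h :: "'a \<Rightarrow> 'b"
    unfolding set_lebesgue_integral_def using that
    by (intro integral_cong_AE borel_measurable_scaleR borel_measurable_indicator) (auto simp: indicator_def)
  have 1: "(LINT x:A|\<gamma>. f' x) = (LINT x:A|\<gamma>. f x) + (LINT x:A|\<sigma>. g x)" if "A \<in> bounded_borel" for A
    using fun_cong[OF eq, of A] that by (simp add: dens_measure_def)
  have null: "(LINT x:A|M. h x) = 0" if "AE x in M. x \<notin> A" for M A and h :: "'a \<Rightarrow> 'b"
  proof -
    have "AE x in M. indicat_real A x *\<^sub>R h x = 0" using that by eventually_elim auto
    then show ?thesis unfolding set_lebesgue_integral_def by (rule integral_eq_zero_AE)
  qed
  have *: "A - N \<in> bounded_borel" "A \<inter> N \<in> bounded_borel" "A \<in> sets borel" if "A \<in> bounded_borel" for A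
    using that N by (auto simp: bounded_borel_iff intro: bounded_subset)
  have "AE x in \<gamma>. f' x - f x = 0"
  proof (rule dens_measure_eq_0_imp_AE[OF \<gamma>])
    show "locally_integrable \<gamma> (\<lambda>x. f' x - f x)"
      using f f' by (auto simp: locally_integrable_def intro!: set_integral_diff)
    fix A :: "'a set" assume A: "A \<in> bounded_borel"
    have "(LINT x:A|\<gamma>. f' x - f x) = (LINT x:A|\<gamma>. f' x) - (LINT x:A|\<gamma>. f x)"
      using f f' A by (intro set_integral_diff int sets)
    also have "\<dots> = (LINT x:A - N|\<gamma>. f' x) - (LINT x:A - N|\<gamma>. f x)"
      using AE(1) *[OF A] N meas'
      by (intro arg_cong2[of _ _ _ _ "(-)"] cong) (auto simp: sets)
    also have "\<dots> = (LINT x:A - N|\<sigma>. g x)"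
      using 1[OF *(1)[OF A]] by simp
    also have "\<dots> = 0" using AE(2) by (intro null) auto
    finally show "(LINT x:A|\<gamma>. f' x - f x) = 0" .
  qed
  then show "AE x in \<gamma>. f x = f' x" by eventually_elim auto
  show "AE x in \<sigma>. g x = 0"
  proof (rule dens_measure_eq_0_imp_AE[OF \<sigma> g])
    fix A :: "'a set" assume A: "A \<in> bounded_borel"
    have "(LINT x:A|\<sigma>. g x) = (LINT x:A \<inter> N|\<sigma>. g x)"
      using AE(2) *[OF A] N meas' by (intro cong) (auto simp: sets)
    also have "\<dots> = (LINT x:A \<inter> N|\<gamma>. f' x) - (LINT x:A \<inter> N|\<gamma>. f x)"
      using 1[OF *(2)[OF A]] by simp
    also have "\<dots> = 0"
      using AE(1) by (subst (1 2) null) auto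
    finally show "(LINT x:A|\<sigma>. g x) = 0" .
  qed
qed

text \<open>On the effective domain the values are finite, so every difference is an honest 0 and
  not the \<open>ereal\<close> convention for infinity minus infinity. It makes a vanishing singular
  part contribute nothing to the action.\<close>

lemma recession_0:
  assumes "edom \<phi> \<noteq> {}"
  shows "recession \<phi> 0 = 0"
proof -
  have "enn2ereal (\<phi> x) - enn2ereal (\<phi> x) = 0" if "x \<in> edom \<phi>" for x
    using that by (cases "\<phi> x") (auto simp: edom_def enn2ereal_ennreal zero_ereal_def)
  then show ?thesis
    using assms by (simp add: recession_def)
qed

text \<open>An absolutely continuous pair decomposes with zero singular part, and by uniqueness
  every other decomposition has the same densities up to null sets and singular densities that
  vanish almost everywhere. Hence the definite description is resolved to the first integral
  alone.\<close>

lemma action_dens_measure: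
  fixes \<phi> :: "real \<times> 'a::euclidean_space \<Rightarrow> ennreal"
  assumes \<gamma>: "\<gamma> \<in> M_loc_pos" and \<rho>: "locally_integrable \<gamma> \<rho>" and w: "locally_integrable \<gamma> w"
    and ne: "edom \<phi> \<noteq> {}"
  shows "action \<phi> \<gamma> (dens_measure \<rho> \<gamma>) (dens_measure w \<gamma>) = (\<integral>\<^sup>+x. \<phi> (\<rho> x, w x) \<partial>\<gamma>)"
  unfolding action_def
proof (rule the_equality, goal_cases)
  case 1
  \<comment> \<open>The zero measure is singular to every measure and serves as carrier of the
    vanishing singular parts.\<close>
  let ?\<sigma> = "null_measure borel :: 'a measure"
  have "lebesgue_decomposition (dens_measure \<rho> \<gamma>) (dens_measure w \<gamma>) \<gamma> \<rho> w ?\<sigma> (\<lambda>_. 0) (\<lambda>_. 0)"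
    unfolding lebesgue_decomposition_def using \<rho> w
    by (auto simp: M_loc_pos_def mutually_singular_def locally_integrable_def dens_measure_def
        set_integrable_def set_lebesgue_integral_def fun_eq_iff)
  moreover have "(\<integral>\<^sup>+x. e2ennreal (recession \<phi> (0, 0)) \<partial>?\<sigma>) = 0"
    using recession_0[OF ne] by (simp add: zero_prod_def)
  ultimately show ?case
    by (intro exI[of _ \<rho>] exI[of _ w] exI[of _ ?\<sigma>] exI[of _ "\<lambda>_. 0"]) auto
next
  case (2 E)
  then obtain \<rho>' w' \<sigma> \<rho>s ws where
    d: "lebesgue_decomposition (dens_measure \<rho> \<gamma>) (dens_measure w \<gamma>) \<gamma> \<rho>' w' \<sigma> \<rho>s ws" and
    E: "E = (\<integral>\<^sup>+x. \<phi> (\<rho>' x, w' x) \<partial>\<gamma>) + (\<integral>\<^sup>+x. e2ennreal (recession \<phi> (\<rho>s x, ws x)) \<partial>\<sigma>)"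
    by blast
  have d': "\<sigma> \<in> M_loc_pos" "mutually_singular \<sigma> \<gamma>" "locally_integrable \<gamma> \<rho>'" "locally_integrable \<gamma> w'"
    "locally_integrable \<sigma> \<rho>s" "locally_integrable \<sigma> ws"
    "dens_measure \<rho> \<gamma> = (\<lambda>A. dens_measure \<rho>' \<gamma> A + dens_measure \<rho>s \<sigma> A)"
    "dens_measure w \<gamma> = (\<lambda>A. dens_measure w' \<gamma> A + dens_measure ws \<sigma> A)"
    using d unfolding lebesgue_decomposition_def by blast+
  note u1 = singular_decomposition_unique[OF \<gamma> d'(1,2,3) \<rho> d'(5,7)]
  note u2 = singular_decomposition_unique[OF \<gamma> d'(1,2,4) w d'(6,8)]
  have "(\<integral>\<^sup>+x. \<phi> (\<rho>' x, w' x) \<partial>\<gamma>) = (\<integral>\<^sup>+x. \<phi> (\<rho> x, w x) \<partial>\<gamma>)"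
  proof (intro nn_integral_cong_AE)
    show "AE x in \<gamma>. \<phi> (\<rho>' x, w' x) = \<phi> (\<rho> x, w x)"
      using u1(1) u2(1) by eventually_elim simp
  qed
  moreover have "(\<integral>\<^sup>+x. e2ennreal (recession \<phi> (\<rho>s x, ws x)) \<partial>\<sigma>) = (\<integral>\<^sup>+x. 0 \<partial>\<sigma>)"
  proof (intro nn_integral_cong_AE)
    show "AE x in \<sigma>. e2ennreal (recession \<phi> (\<rho>s x, ws x)) = 0"
      using u1(2) u2(2) by eventually_elim (use recession_0[OF ne] in \<open>simp add: zero_prod_def e2ennreal_neg\<close>)
  qed
  ultimately show ?case using E by simp
qed

section \<open>Bounds on admissible densities\<close>

text \<open>A finite convex function on a finite-dimensional space is continuous, hence bounded on
  the unit sphere, and homogeneity of degree 2 spreads the bound to all \<open>w\<close>. The point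
  \<open>w = 0\<close> is treated apart because homogeneity is given for nonzero factors
  only.\<close>

lemma quadratic_slice_bound:
  fixes \<phi> :: "real \<times> 'a::euclidean_space \<Rightarrow> ennreal"
  assumes conv: "econvex \<phi>" and fin: "\<And>w. \<phi> (r, w) < \<infinity>"
    and zero: "\<phi> (r, 0) = 0"
    and hom: "\<And>l w. l \<noteq> 0 \<Longrightarrow> \<phi> (r, l *\<^sub>R w) = ennreal (\<bar>l\<bar> powr 2) * \<phi> (r, w)"
  obtains C where "C \<ge> 0" "\<And>w. \<phi> (r, w) \<le> ennreal (C * (norm w)\<^sup>2)"
proof -
  define \<psi> where "\<psi> w = enn2real (\<phi> (r, w))" for w
  have \<phi>_eq: "\<phi> (r, w) = ennreal (\<psi> w)" and nn: "\<psi> w \<ge> 0" for w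
    using fin[of w] by (auto simp: \<psi>_def)
  have "convex_on UNIV \<psi>"
  proof (rule convex_onI)
    fix t :: real and x y :: 'a assume t: "0 < t" "t < 1"
    have "(1 - t) *\<^sub>R (r, x) + t *\<^sub>R (r, y) = (r, (1 - t) *\<^sub>R x + t *\<^sub>R y)"
      by (simp add: algebra_simps)
    with t conv have "\<phi> (r, (1 - t) *\<^sub>R x + t *\<^sub>R y) \<le> ennreal (1 - t) * \<phi> (r, x) + ennreal t * \<phi> (r, y)"
      unfolding econvex_def by (metis atLeastAtMost_iff less_imp_le)
    also have "\<dots> = ennreal ((1 - t) * \<psi> x + t * \<psi> y)"
      using t nn by (simp add: \<phi>_eq ennreal_mult[symmetric] ennreal_plus[symmetric] del: ennreal_plus)
    finally show "\<psi> ((1 - t) *\<^sub>R x + t *\<^sub>R y) \<le> (1 - t) * \<psi> x + t * \<psi> y"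
      using t nn by (simp add: \<phi>_eq del: ennreal_plus)
  qed auto
  then have "continuous_on UNIV \<psi>" by (intro convex_on_continuous) auto
  then have "continuous_on (sphere 0 1) \<psi>" by (rule continuous_on_subset) auto
  then have "bounded (\<psi> ` sphere 0 1)"
    by (intro compact_imp_bounded compact_continuous_image) auto
  then obtain C where C: "\<And>w. norm w = 1 \<Longrightarrow> \<psi> w \<le> C"
    unfolding bounded_iff by (force dest: abs_le_D1)
  have "\<phi> (r, w) \<le> ennreal (max 0 C * (norm w)\<^sup>2)" for w
  proof (cases "w = 0")
    case True
    then show ?thesis using zero by simp
  next
    case False
    have "\<phi> (r, w) = \<phi> (r, norm w *\<^sub>R (w /\<^sub>R norm w))" using False by simp
    also have "\<dots> = ennreal ((norm w)\<^sup>2 * \<psi> (w /\<^sub>R norm w))"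
      using False nn by (subst hom) (auto simp: \<phi>_eq ennreal_mult)
    also have "\<dots> \<le> ennreal (max 0 C * (norm w)\<^sup>2)"
    proof -
      have "\<psi> (w /\<^sub>R norm w) \<le> max 0 C" using C[of "w /\<^sub>R norm w"] False by simp
      then show ?thesis by (intro ennreal_leI) (metis mult.commute mult_right_mono zero_le_power2)
    qed
    finally show ?thesis .
  qed
  then show ?thesis by (intro that[of "max 0 C"]) auto
qed

lemma admissible_on_D:
  assumes \<phi>: "\<phi> \<in> admissible_on 2 a b"
  shows "econvex \<phi>" and "lsc \<phi>" and "edom \<phi> \<noteq> {}"
    and "\<And>r w. a < r \<Longrightarrow> r < b \<Longrightarrow> \<phi> (r, w) < \<infinity>"
    and "\<And>r. a < r \<Longrightarrow> r < b \<Longrightarrow> \<phi> (r, 0) = 0"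
    and "\<And>r l w. a < r \<Longrightarrow> r < b \<Longrightarrow> l \<noteq> 0 \<Longrightarrow> \<phi> (r, l *\<^sub>R w) = ennreal (\<bar>l\<bar> powr 2) * \<phi> (r, w)"
proof -
  have F1: "\<phi> (r, 0) = 0 \<and> (\<forall>l w. l \<noteq> 0 \<longrightarrow> \<phi> (r, l *\<^sub>R w) = ennreal (\<bar>l\<bar> powr 2) * \<phi> (r, w))"
    if "({r} \<times> UNIV) \<inter> edom \<phi> \<noteq> {}" for r
    using \<phi> that by (simp add: admissible_on_def admissible_def)
  have sub: "{a<..<b} \<times> UNIV \<subseteq> edom \<phi>"
    using \<phi> interior_subset[of "edom \<phi>"] by (simp add: admissible_on_def)
  then have ne: "({r} \<times> UNIV) \<inter> edom \<phi> \<noteq> {}" if "a < r" "r < b" for r using that by fastforce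
  show "econvex \<phi>" "lsc \<phi>" "edom \<phi> \<noteq> {}" using \<phi> by (auto simp: admissible_on_def admissible_def)
  show "\<phi> (r, w) < \<infinity>" if "a < r" "r < b" for r w using subsetD[OF sub, of "(r, w)"] that by (simp add: edom_def)
  show "\<phi> (r, 0) = 0" if "a < r" "r < b" for r using F1[OF ne[OF that]] by auto
  show "\<phi> (r, l *\<^sub>R w) = ennreal (\<bar>l\<bar> powr 2) * \<phi> (r, w)" if "a < r" "r < b" "l \<noteq> 0" for r l w
    using F1[OF ne[OF that(1,2)]] that by auto
qed

text \<open>At the endpoints, where (F1) need not apply, the value at rest is forced by lower
  semicontinuity.\<close>

lemma admissible_on_rest_zero:
  assumes \<phi>: "\<phi> \<in> admissible_on 2 a b" and "a < b" and r: "a \<le> r" "r \<le> b"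
  shows "\<phi> (r, 0) = 0"
proof (rule ccontr)
  assume "\<phi> (r, 0) \<noteq> 0"
  then have "0 < \<phi> (r, 0)" by (simp add: zero_less_iff_neq_zero)
  then have "eventually (\<lambda>x. 0 < \<phi> x) (at (r, 0))"
    using admissible_on_D(2)[OF \<phi>] by (auto simp: lsc_def le_Liminf_iff)
  then obtain e where e: "e > 0" "\<And>x. x \<noteq> (r, 0) \<Longrightarrow> dist x (r, 0) < e \<Longrightarrow> 0 < \<phi> x"
    by (auto simp: eventually_at)
  \<comment> \<open>A point of the open interval close to \<open>r\<close>, reached by moving left
    if \<open>r = b\<close> and right otherwise. It has to differ from \<open>r\<close> because the
    \<open>Liminf\<close> is taken over a punctured neighbourhood.\<close>
  obtain q where q: "a < q" "q < b" "q \<noteq> r" "\<bar>q - r\<bar> < e"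
  proof (cases "r = b")
    case True
    then show ?thesis using that[of "max ((a + b) / 2) (b - e / 2)"] \<open>a < b\<close> e
      by (auto simp: max_def abs_if field_simps)
  next
    case False
    then show ?thesis using that[of "r + min ((b - r) / 2) (e / 2)"] r e
      by (auto simp: min_def abs_if field_simps)
  qed
  have "dist (q, 0) (r, 0) < e" using q by (simp add: dist_Pair_Pair dist_real_def)
  then have "0 < \<phi> (q, 0)" using e(2)[of "(q, 0)"] q by auto
  then show False using admissible_on_D(5)[OF \<phi> q(1,2)] by simp
qed

text \<open>Joint convexity along the segment from \<open>(q, 0)\<close> to \<open>(r, w / s)\<close>: the action degenerates at
  most like the inverse distance to the endpoints.\<close>

lemma admissible_on_interpolation_bound:
  fixes \<phi> :: "real \<times> 'a::euclidean_space \<Rightarrow> ennreal"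
  assumes \<phi>: "\<phi> \<in> admissible_on 2 a b" and r: "a < r" "r < b"
  obtains C where "C \<ge> 0"
    "\<And>q s w. a \<le> q \<Longrightarrow> q \<le> b \<Longrightarrow> 0 < s \<Longrightarrow> s \<le> 1 \<Longrightarrow>
      \<phi> ((1 - s) * q + s * r, w) \<le> ennreal (C * (norm w)\<^sup>2 / s)"
proof -
  note D = admissible_on_D[OF \<phi>]
  obtain C where C: "C \<ge> 0" "\<And>w. \<phi> (r, w) \<le> ennreal (C * (norm w)\<^sup>2)"
    using quadratic_slice_bound[OF D(1), of r] D(4,5,6)[OF r] by metis
  have "\<phi> ((1 - s) * q + s * r, w) \<le> ennreal (C * (norm w)\<^sup>2 / s)"
    if q: "a \<le> q" "q \<le> b" and s: "0 < s" "s \<le> 1" for q s w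
  proof -
    \<comment> \<open>The whole momentum is charged to the safe density \<open>r\<close>: it has
      weight \<open>s\<close> there, so it must be enlarged to \<open>w / s\<close>, and the degree
      2 leaves one factor \<open>1 / s\<close>.\<close>
    have eq: "((1 - s) * q + s * r, w) = (1 - s) *\<^sub>R (q, 0) + s *\<^sub>R (r, w /\<^sub>R s)"
      using s by simp
    have "\<phi> ((1 - s) * q + s * r, w) \<le> ennreal (1 - s) * \<phi> (q, 0) + ennreal s * \<phi> (r, w /\<^sub>R s)"
      unfolding eq using D(1) s unfolding econvex_def by (metis atLeastAtMost_iff less_imp_le)
    also have "\<dots> = ennreal s * \<phi> (r, w /\<^sub>R s)"
      using admissible_on_rest_zero[OF \<phi> _ q] r by simp
    also have "\<dots> \<le> ennreal s * ennreal (C * (norm (w /\<^sub>R s))\<^sup>2)"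
      by (intro mult_left_mono C) auto
    also have "\<dots> = ennreal (C * (norm w)\<^sup>2 / s)"
      using s C by (simp add: ennreal_mult[symmetric] power2_eq_square field_simps)
    finally show ?thesis .
  qed
  with C(1) show ?thesis by (rule that)
qed

section \<open>Integration and test functions\<close>

text \<open>\<open>S\<close> is merely bounded and may fail to be measurable, so its closure plays
  the role of the set of finite measure.\<close>

lemma integrable_lborel_bounded_support:
  fixes f :: "'a::euclidean_space \<Rightarrow> 'b::{banach, second_countable_topology}"
  assumes "f \<in> borel_measurable borel" and "\<And>x. norm (f x) \<le> B"
    and "bounded S" and "\<And>x. x \<notin> S \<Longrightarrow> f x = 0"
  shows "integrable lborel f"
proof (rule integrableI_bounded_set[where A = "closure S" and B = B])
  show "emeasure lborel (closure S) < \<infinity>"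
    using assms(3) by (intro emeasure_bounded_finite) auto
  show "AE x in lborel. x \<in> closure S \<longrightarrow> norm (f x) \<le> B" using assms(2) by auto
  show "AE x in lborel. x \<notin> closure S \<longrightarrow> f x = 0" using assms(4) closure_subset by blast
qed (use assms in auto)

lemma lborel_iterated_integral_bounded_support:
  fixes f :: "'a::euclidean_space \<Rightarrow> 'b::euclidean_space \<Rightarrow> real"
  assumes "(\<lambda>(x, y). f x y) \<in> borel_measurable borel" and "\<And>x y. \<bar>f x y\<bar> \<le> B"
    and "bounded S" "bounded T" and "\<And>x y. x \<notin> S \<or> y \<notin> T \<Longrightarrow> f x y = 0"
  shows "integrable lborel (\<lambda>(x, y). f x y)"
    and "(\<integral>x. (\<integral>y. f x y \<partial>lborel) \<partial>lborel) = (\<integral>p. (case p of (x, y) \<Rightarrow> f x y) \<partial>lborel)"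
    and "(\<integral>y. (\<integral>x. f x y \<partial>lborel) \<partial>lborel) = (\<integral>p. (case p of (x, y) \<Rightarrow> f x y) \<partial>lborel)"
proof -
  show *: "integrable lborel (\<lambda>(x, y). f x y)"
    using assms
    by (intro integrable_lborel_bounded_support[where B = B and S = "S \<times> T"]) (auto intro: bounded_Times)
  then show "(\<integral>x. (\<integral>y. f x y \<partial>lborel) \<partial>lborel) = (\<integral>p. (case p of (x, y) \<Rightarrow> f x y) \<partial>lborel)"
    "(\<integral>y. (\<integral>x. f x y \<partial>lborel) \<partial>lborel) = (\<integral>p. (case p of (x, y) \<Rightarrow> f x y) \<partial>lborel)"
    using lborel_pair.integral_fst[of f] lborel_pair.integral_snd[of f] by (simp_all add: lborel_prod)
qed

lemma Fubini_lborel_bounded_support: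
  fixes f :: "'a::euclidean_space \<Rightarrow> 'b::euclidean_space \<Rightarrow> real"
  assumes "(\<lambda>(x, y). f x y) \<in> borel_measurable borel" and "\<And>x y. \<bar>f x y\<bar> \<le> B"
    and "bounded S" "bounded T" and "\<And>x y. x \<notin> S \<or> y \<notin> T \<Longrightarrow> f x y = 0"
  shows "(\<integral>x. (\<integral>y. f x y \<partial>lborel) \<partial>lborel) = (\<integral>y. (\<integral>x. f x y \<partial>lborel) \<partial>lborel)"
  using lborel_iterated_integral_bounded_support(2,3)[OF assms] by simp

text \<open>Used with \<open>c = s\<close> to undo the rescaling in the transport kernel, and with
  the negative ratio \<open>- ((1 - s) / s)\<close> to estimate a volume; hence the absolute value
  in the Jacobian.\<close>

lemma lborel_integral_affine:
  fixes f :: "'a::euclidean_space \<Rightarrow> 'b::{banach, second_countable_topology}"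
  assumes [measurable]: "f \<in> borel_measurable borel" and c: "c \<noteq> 0"
  shows "(\<integral>x. f x \<partial>lborel) = \<bar>c\<bar> ^ DIM('a) *\<^sub>R (\<integral>x. f (t + c *\<^sub>R x) \<partial>lborel)"
proof -
  have "(\<integral>x. f x \<partial>lborel)
      = (\<integral>x. f x \<partial>density (distr lborel borel (\<lambda>x. t + c *\<^sub>R x)) (\<lambda>_. ennreal (\<bar>c\<bar> ^ DIM('a))))"
    using lborel_affine[OF c, of t] by (simp add: ennreal_power)
  also have "\<dots> = \<bar>c\<bar> ^ DIM('a) *\<^sub>R (\<integral>x. f (t + c *\<^sub>R x) \<partial>lborel)"
    by (subst integral_density) (auto simp: integral_distr)
  finally show ?thesis .
qed

text \<open>Monotonicity of the nonnegative integral holds for arbitrary \<open>F\<close>, so total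
  variations and actions can be bounded in time without discussing their measurability. The bound is
  asked for in the open interval because the estimate of the action divides by a weight that
  vanishes at both ends.\<close>

lemma nn_integral_unit_interval_le:
  fixes F :: "real \<Rightarrow> ennreal"
  assumes "\<And>t. 0 < t \<Longrightarrow> t < 1 \<Longrightarrow> F t \<le> ennreal N"
  shows "(\<integral>\<^sup>+t\<in>{0..1}. F t \<partial>lborel) \<le> ennreal N"
proof -
  have "(\<integral>\<^sup>+t\<in>{0..1}. F t \<partial>lborel) \<le> (\<integral>\<^sup>+t. ennreal N * indicator {0..1::real} t \<partial>lborel)"
  proof (rule nn_integral_mono_AE)
    show "AE t in lborel. F t * indicator {0..1} t \<le> ennreal N * indicator {0..1::real} t"
      using AE_lborel_singleton[of 0] AE_lborel_singleton[of 1]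
      by eventually_elim (use assms in \<open>auto simp: indicator_def\<close>)
  qed
  also have "\<dots> = ennreal N" by (simp add: nn_integral_cmult_indicator)
  finally show ?thesis .
qed

text \<open>The fundamental theorem of calculus along the segment from \<open>y\<close> to
  \<open>z\<close>, applied to the negative of \<zeta> so that the factor is \<open>y - z\<close>,
  as in the transport kernel. The open interval matches the definition of
  \<open>flux\<close>.\<close>

lemma segment_integral:
  fixes \<zeta> :: "'a::euclidean_space \<Rightarrow> real" and g :: "'a \<Rightarrow> 'a"
  assumes der: "\<And>x. (\<zeta> has_derivative (\<lambda>h. g x \<bullet> h)) (at x)" and g: "continuous_on UNIV g"
  shows "(\<integral>s. indicator {0<..<1} s * (g ((1 - s) *\<^sub>R y + s *\<^sub>R z) \<bullet> (y - z)) \<partial>lborel) = \<zeta> y - \<zeta> z"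
proof -
  let ?p = "\<lambda>s::real. (1 - s) *\<^sub>R y + s *\<^sub>R z"
  have "((\<lambda>s. - \<zeta> (?p s)) has_vector_derivative g (?p s) \<bullet> (y - z)) (at s within {0..1})" for s
  proof -
    have "(?p has_derivative (\<lambda>t. t *\<^sub>R (z - y))) (at s within {0..1})"
      by (auto intro!: derivative_eq_intros simp: algebra_simps)
    from has_derivative_compose[OF this der]
    have "((\<lambda>s. \<zeta> (?p s)) has_derivative (\<lambda>t. g (?p s) \<bullet> (t *\<^sub>R (z - y)))) (at s within {0..1})" .
    from has_derivative_minus[OF this] show ?thesis
      unfolding has_vector_derivative_def by (simp add: inner_diff_right algebra_simps)
  qed
  moreover have "continuous_on {0..1} (\<lambda>s. g (?p s) \<bullet> (y - z))"
    by (intro continuous_intros continuous_on_compose2[OF g]) auto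
  ultimately have "(\<integral>s. indicator {0..1} s *\<^sub>R (g (?p s) \<bullet> (y - z)) \<partial>lborel) = - \<zeta> (?p 1) - - \<zeta> (?p 0)"
    by (intro integral_FTC_atLeastAtMost) auto
  moreover have "(\<integral>s. indicator {0<..<1} s * (g (?p s) \<bullet> (y - z)) \<partial>lborel)
      = (\<integral>s. indicator {0..1} s *\<^sub>R (g (?p s) \<bullet> (y - z)) \<partial>lborel)"
  proof (rule integral_cong_AE)
    have [measurable]: "(\<lambda>s. g (?p s) \<bullet> (y - z)) \<in> borel_measurable borel"
      by (intro borel_measurable_continuous_onI continuous_intros continuous_on_compose2[OF g]) auto
    show "(\<lambda>s. indicator {0<..<1} s * (g (?p s) \<bullet> (y - z))) \<in> borel_measurable lborel"
      "(\<lambda>s. indicator {0..1} s *\<^sub>R (g (?p s) \<bullet> (y - z))) \<in> borel_measurable lborel" by measurable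
    show "AE s in lborel. indicator {0<..<1} s * (g (?p s) \<bullet> (y - z)) = indicator {0..1} s *\<^sub>R (g (?p s) \<bullet> (y - z))"
      using AE_lborel_singleton[of 0] AE_lborel_singleton[of 1]
      by eventually_elim (auto simp: indicator_def)
  qed
  ultimately show ?thesis by simp
qed

section \<open>Cutoffs and weak* convergence tested on open sets\<close>

text \<open>The truncated distance to the complement of \<open>V\<close> is continuous and vanishes
  off \<open>V\<close>; for open \<open>V\<close> it increases to the indicator of \<open>V\<close>
  as \<open>c\<close> tends to infinity.\<close>

lemma C_c_cutoff:
  fixes h :: "'a::euclidean_space \<Rightarrow> real"
  assumes "bounded V" and "continuous_on UNIV h"
  shows "(\<lambda>y. min 1 (c * infdist y (- V)) * h y) \<in> C_c"
proof -
  have "closure {x. min 1 (c * infdist x (- V)) * h x \<noteq> 0} \<subseteq> closure V"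
  proof (intro closure_mono subsetI CollectI)
    show "x \<in> V" if "x \<in> {x. min 1 (c * infdist x (- V)) * h x \<noteq> 0}" for x
      using that infdist_zero[of x "- V"] by (cases "x \<in> V") auto
  qed
  then have "compact (closure {x. min 1 (c * infdist x (- V)) * h x \<noteq> 0})"
    using bounded_subset[OF bounded_closure[OF assms(1)]] by (simp add: compact_eq_bounded_closed)
  moreover have "continuous_on UNIV (\<lambda>y. min 1 (c * infdist y (- V)) * h y)"
    using assms by (intro continuous_intros)
  ultimately show ?thesis by (simp add: C_c_def)
qed

text \<open>Indicators of open sets are monotone limits of \<open>C_c\<close> functions, which extends the test
  functions of weak* convergence to the discontinuous kernels below.\<close>

lemma weak_star_test_open:
  fixes f :: "nat \<Rightarrow> 'a::euclidean_space \<Rightarrow> real"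
  assumes [measurable]: "\<And>n. f n \<in> borel_measurable borel" "g \<in> borel_measurable borel"
    and bd: "\<And>n x. \<bar>f n x\<bar> \<le> M" "\<And>x. \<bar>g x\<bar> \<le> M"
    and \<Omega>: "bounded \<Omega>" "open \<Omega>"
    and conv: "\<And>k. k \<in> C_c \<Longrightarrow> (\<lambda>n. \<integral>x. indicator \<Omega> x * f n x * k x \<partial>lborel)
        \<longlonglongrightarrow> (\<integral>x. indicator \<Omega> x * g x * k x \<partial>lborel)"
    and V: "V \<subseteq> \<Omega>" "open V" and h: "continuous_on UNIV h"
  shows "(\<lambda>n. \<integral>x. indicator V x * h x * f n x \<partial>lborel) \<longlonglongrightarrow> (\<integral>x. indicator V x * h x * g x \<partial>lborel)"
proof -
  have bV: "bounded V" using V \<Omega> bounded_subset by blast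
  have [measurable]: "V \<in> sets borel" "\<Omega> \<in> sets borel" using V \<Omega> by auto
  have [measurable]: "h \<in> borel_measurable borel" using h by (rule borel_measurable_continuous_onI)
  have "M \<ge> 0" using bd(2)[of undefined] by linarith
  have "bounded (h ` closure V)"
    using bV h by (intro compact_imp_bounded compact_continuous_image) (auto intro: continuous_on_subset)
  then obtain H where H: "\<And>x. x \<in> closure V \<Longrightarrow> \<bar>h x\<bar> \<le> H" by (auto simp: bounded_iff)
  define H' where "H' = max H 0"
  have H': "\<And>x. x \<in> V \<Longrightarrow> \<bar>h x\<bar> \<le> H'" "H' \<ge> 0"
    using H closure_subset by (force simp: H'_def)+
  define m where "m j y = min 1 (real j * infdist y (- V))" for j y
  have [measurable]: "m j \<in> borel_measurable borel" for j
    unfolding m_def by (intro borel_measurable_continuous_onI continuous_intros)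
  have m01: "0 \<le> m j y" "m j y \<le> 1" "y \<notin> V \<Longrightarrow> m j y = 0" for j y
    by (auto simp: m_def infdist_nonneg infdist_zero)
  have m_lim: "(\<lambda>j. m j y) \<longlonglongrightarrow> indicator V y" for y
  proof (cases "y \<in> V")
    case True
    \<comment> \<open>\<open>infdist\<close> to the empty set is 0 by convention, so the distance is
      positive only once the complement is known to be nonempty.\<close>
    have "- V \<noteq> {}" using bV not_bounded_UNIV by (metis Compl_UNIV_eq double_complement)
    then have pos: "infdist y (- V) > 0"
      using True V by (intro infdist_pos_not_in_closed) auto
    then obtain N :: nat where N: "1 < real N * infdist y (- V)"
      using reals_Archimedean3 by blast
    have "m j y = 1" if "j \<ge> N" for j
    proof -
      have "real N * infdist y (- V) \<le> real j * infdist y (- V)"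
        using that pos by (intro mult_right_mono) auto
      then show ?thesis using N by (simp add: m_def)
    qed
    then show ?thesis
      using True by (intro tendsto_eventually) (auto simp: eventually_sequentially)
  qed (use m01 in auto)
  \<comment> \<open>The weighted volume lost by replacing the indicator with \<open>m j\<close>. It
    controls the error by \<open>M * e j\<close> for every function bounded by \<open>M\<close>,
    hence uniformly in \<open>n\<close>, so that \<open>j\<close> can be fixed before
    \<open>n\<close> is sent to infinity.\<close>
  define e where "e j = (\<integral>x. (indicator V x - m j x) * \<bar>h x\<bar> \<partial>lborel)" for j
  have dv: "\<bar>(indicator V x - m j x) * \<bar>h x\<bar>\<bar> \<le> indicator V x * H'" for j x
  proof (cases "x \<in> V")
    case True
    then have "(1 - m j x) * \<bar>h x\<bar> \<le> 1 * H'"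
      using m01(1,2)[of j x] H' by (intro mult_mono) auto
    then show ?thesis using True m01(1,2)[of j x] by (simp add: abs_mult)
  qed (use m01 in auto)
  have eint: "integrable lborel (\<lambda>x. (indicator V x - m j x) * \<bar>h x\<bar>)" for j
  proof (rule integrable_lborel_bounded_support[where B = H' and S = V])
    show "norm ((indicator V x - m j x) * \<bar>h x\<bar>) \<le> H'" for x
      using dv[of x j] H'(2) by (cases "x \<in> V") auto
  qed (use bV m01 in auto)
  have "e \<longlonglongrightarrow> (\<integral>x. 0 \<partial>(lborel :: 'a measure))"
    unfolding e_def
  proof (rule integral_dominated_convergence[where w = "\<lambda>x. indicator V x * H'"])
    show "integrable lborel (\<lambda>x. indicator V x * H')"
      using H' bV by (intro integrable_lborel_bounded_support[where B = H' and S = V]) (auto simp: indicator_def)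
    show "AE x in lborel. norm ((indicator V x - m j x) * \<bar>h x\<bar>) \<le> indicator V x * H'" for j
      using dv by simp
    have "(\<lambda>j. (indicator V x - m j x) * \<bar>h x\<bar>) \<longlonglongrightarrow> (indicator V x - indicator V x) * \<bar>h x\<bar>" for x
      by (intro tendsto_intros m_lim)
    then show "AE x in lborel. (\<lambda>j. (indicator V x - m j x) * \<bar>h x\<bar>) \<longlonglongrightarrow> 0" by simp
  qed auto
  then have e0: "e \<longlonglongrightarrow> 0" by simp
  have approx: "\<bar>(\<integral>x. indicator V x * h x * u x \<partial>lborel) - (\<integral>x. indicator \<Omega> x * u x * (m j x * h x) \<partial>lborel)\<bar>
      \<le> M * e j" if [measurable]: "u \<in> borel_measurable borel" and u: "\<And>x. \<bar>u x\<bar> \<le> M" for u j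
  proof -
    have 1: "integrable lborel (\<lambda>x. indicator V x * h x * u x)"
    proof (rule integrable_lborel_bounded_support[where B = "H' * M" and S = V])
      show "norm (indicator V x * h x * u x) \<le> H' * M" for x
        using H' u[of x] \<open>M \<ge> 0\<close> by (cases "x \<in> V") (auto simp: abs_mult intro!: mult_mono)
    qed (use bV in auto)
    have mh: "\<bar>m j x * h x\<bar> \<le> H'" for x
    proof (cases "x \<in> V")
      case True
      then have "m j x * \<bar>h x\<bar> \<le> 1 * H'"
        using m01(1,2)[of j x] H' by (intro mult_mono) auto
      then show ?thesis using m01(1,2)[of j x] by (simp add: abs_mult)
    qed (use m01 H' in auto)
    have 2: "integrable lborel (\<lambda>x. indicator \<Omega> x * u x * (m j x * h x))"
    proof (rule integrable_lborel_bounded_support[where B = "M * H'" and S = \<Omega>])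
      have "\<bar>u x * (m j x * h x)\<bar> \<le> M * H'" for x
        unfolding abs_mult[of "u x"] using u[of x] mh[of x] \<open>M \<ge> 0\<close> by (intro mult_mono) auto
      then show "norm (indicator \<Omega> x * u x * (m j x * h x)) \<le> M * H'" for x
        using \<open>M \<ge> 0\<close> H' by (auto simp: indicator_def)
    qed (use \<Omega> in auto)
    have "\<bar>(\<integral>x. indicator V x * h x * u x \<partial>lborel) - (\<integral>x. indicator \<Omega> x * u x * (m j x * h x) \<partial>lborel)\<bar>
        = \<bar>\<integral>x. indicator V x * h x * u x - indicator \<Omega> x * u x * (m j x * h x) \<partial>lborel\<bar>"
      using 1 2 by simp
    also have "\<dots> \<le> (\<integral>x. \<bar>indicator V x * h x * u x - indicator \<Omega> x * u x * (m j x * h x)\<bar> \<partial>lborel)"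
      by (rule integral_abs_bound)
    also have "\<dots> \<le> (\<integral>x. M * ((indicator V x - m j x) * \<bar>h x\<bar>) \<partial>lborel)"
    proof (rule integral_mono)
      fix x
      have "indicator V x * h x * u x - indicator \<Omega> x * u x * (m j x * h x) = u x * ((indicator V x - m j x) * h x)"
        using V m01(3)[of x j] by (auto simp: indicator_def algebra_simps)
      then have "\<bar>indicator V x * h x * u x - indicator \<Omega> x * u x * (m j x * h x)\<bar>
          = \<bar>u x\<bar> * (\<bar>indicator V x - m j x\<bar> * \<bar>h x\<bar>)"
        by (simp add: abs_mult)
      also have "\<bar>indicator V x - m j x\<bar> = indicator V x - m j x"
        using m01(1,2)[of j x] m01(3)[of x j] by (auto simp: indicator_def)
      also have "\<bar>u x\<bar> * ((indicator V x - m j x) * \<bar>h x\<bar>) \<le> M * ((indicator V x - m j x) * \<bar>h x\<bar>)"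
        using u[of x] m01(1,2)[of j x] m01(3)[of x j] by (intro mult_right_mono mult_nonneg_nonneg) (auto simp: indicator_def)
      finally show "\<bar>indicator V x * h x * u x - indicator \<Omega> x * u x * (m j x * h x)\<bar>
        \<le> M * ((indicator V x - m j x) * \<bar>h x\<bar>)" .
    qed (use 1 2 eint in auto)
    also have "\<dots> = M * e j" by (simp add: e_def)
    finally show ?thesis .
  qed
  show ?thesis
  proof (rule LIMSEQ_I)
    fix r :: real assume "r > 0"
    have "(\<lambda>j. M * e j) \<longlonglongrightarrow> M * 0" by (intro tendsto_intros e0)
    then have "eventually (\<lambda>j. M * e j < r / 3) sequentially"
      using \<open>r > 0\<close> by (intro order_tendstoD(2)) auto
    then obtain j where j: "M * e j < r / 3" by (auto simp: eventually_sequentially)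
    have "(\<lambda>y. m j y * h y) \<in> C_c" unfolding m_def by (rule C_c_cutoff[OF bV h])
    from LIMSEQ_D[OF conv[OF this], of "r / 3"] \<open>r > 0\<close>
    obtain N where N: "\<And>n. n \<ge> N \<Longrightarrow> norm ((\<integral>x. indicator \<Omega> x * f n x * (m j x * h x) \<partial>lborel)
        - (\<integral>x. indicator \<Omega> x * g x * (m j x * h x) \<partial>lborel)) < r / 3" by auto
    have "norm ((\<integral>x. indicator V x * h x * f n x \<partial>lborel) - (\<integral>x. indicator V x * h x * g x \<partial>lborel)) < r"
      if "n \<ge> N" for n
      using N[OF that] j approx[OF assms(1) bd(1), of n j] approx[OF assms(2) bd(2), of j]
      unfolding real_norm_def by linarith
    then show "\<exists>N. \<forall>n\<ge>N. norm ((\<integral>x. indicator V x * h x * f n x \<partial>lborel)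
        - (\<integral>x. indicator V x * h x * g x \<partial>lborel)) < r" by blast
  qed
qed

section \<open>Bounds and partial derivatives of test functions\<close>

lemma compactly_supported_bounded:
  fixes f :: "'a::euclidean_space \<Rightarrow> real"
  assumes "continuous_on UNIV f" and "compact K" and "\<And>x. x \<notin> K \<Longrightarrow> f x = 0"
  obtains B where "B \<ge> 0" "\<And>x. \<bar>f x\<bar> \<le> B"
proof -
  have "bounded (f ` K)"
    using assms(1,2) by (intro compact_imp_bounded compact_continuous_image) (auto intro: continuous_on_subset)
  then obtain B where "\<And>x. x \<in> K \<Longrightarrow> \<bar>f x\<bar> \<le> B" by (auto simp: bounded_iff)
  then have "\<bar>f x\<bar> \<le> \<bar>B\<bar>" for x
    using assms(3)[of x] by (cases "x \<in> K") force+
  then show ?thesis by (intro that[of "\<bar>B\<bar>"]) auto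
qed

lemma C_c_bounded:
  assumes "k \<in> C_c"
  obtains B where "B \<ge> 0" "\<And>x. \<bar>k x\<bar> \<le> B"
proof (rule compactly_supported_bounded)
  show "continuous_on UNIV k" "compact (closure {x. k x \<noteq> 0})" using assms by (auto simp: C_c_def)
  show "k x = 0" if "x \<notin> closure {x. k x \<noteq> 0}" for x
    using that closure_subset[of "{x. k x \<noteq> 0}"] by auto
qed (use that in auto)

lemma C1_c_D:
  assumes "\<zeta> \<in> C1_c S"
  shows "(\<zeta> has_derivative frechet_derivative \<zeta> (at z)) (at z)"
    and "continuous_on UNIV (\<lambda>z. frechet_derivative \<zeta> (at z) h)"
    and "continuous_on UNIV \<zeta>"
    and "compact (closure {z. \<zeta> z \<noteq> 0})"
    and "z \<notin> S \<Longrightarrow> \<zeta> z = 0"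
proof -
  have d: "\<zeta> differentiable at z" for z using assms by (auto simp: C1_c_def)
  then show "(\<zeta> has_derivative frechet_derivative \<zeta> (at z)) (at z)"
    by (simp add: frechet_derivative_works)
  show "continuous_on UNIV (\<lambda>z. frechet_derivative \<zeta> (at z) h)" using assms by (auto simp: C1_c_def)
  show "continuous_on UNIV \<zeta>"
    using d by (intro continuous_at_imp_continuous_on) (auto intro: differentiable_imp_continuous_within)
  show "compact (closure {z. \<zeta> z \<noteq> 0})" using assms by (auto simp: C1_c_def)
  show "\<zeta> z = 0" if "z \<notin> S"
    using assms that closure_subset[of "{z. \<zeta> z \<noteq> 0}"] by (auto simp: C1_c_def)
qed

lemma C1_c_bounded:
  assumes "\<zeta> \<in> C1_c S"
  obtains B where "B \<ge> 0" "\<And>z. \<bar>\<zeta> z\<bar> \<le> B"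
  using C_c_bounded[of \<zeta>] C1_c_D(3,4)[OF assms] by (auto simp: C_c_def)

text \<open>Off the closed support the function is zero in a neighbourhood, so its derivative
  vanishes there and inherits the compact support.\<close>

lemma C1_c_derivative_bounded:
  assumes \<zeta>: "\<zeta> \<in> C1_c S"
  obtains B where "B \<ge> 0" "\<And>z. \<bar>frechet_derivative \<zeta> (at z) h\<bar> \<le> B"
proof (rule compactly_supported_bounded)
  let ?K = "closure {z. \<zeta> z \<noteq> 0}"
  show "continuous_on UNIV (\<lambda>z. frechet_derivative \<zeta> (at z) h)" "compact ?K"
    using C1_c_D[OF \<zeta>] by auto
  show "frechet_derivative \<zeta> (at z) h = 0" if z: "z \<notin> ?K" for z
  proof -
    have "(\<zeta> has_derivative (\<lambda>_. 0)) (at z)"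
    proof (rule has_derivative_transform_within_open)
      show "((\<lambda>_. 0) has_derivative (\<lambda>_. 0)) (at z)" by simp
      show "open (- ?K)" "z \<in> - ?K" using z by auto
      show "0 = \<zeta> x" if "x \<in> - ?K" for x
        using that closure_subset[of "{z. \<zeta> z \<noteq> 0}"] by auto
    qed
    from frechet_derivative_at[OF this] show ?thesis by (metis (mono_tags))
  qed
qed (use that in auto)

lemma space_grad_bounded:
  assumes \<zeta>: "\<zeta> \<in> C1_c S"
  obtains B where "B \<ge> 0" "\<And>z. norm (space_grad \<zeta> z) \<le> B"
proof -
  have "\<exists>B. \<forall>z. \<bar>frechet_derivative \<zeta> (at z) (i, 0)\<bar> \<le> B" for i
    using C1_c_derivative_bounded[OF \<zeta>] by metis
  then obtain B where B: "\<And>i z. \<bar>frechet_derivative \<zeta> (at z) (i, 0)\<bar> \<le> B i" by metis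
  have *: "norm (space_grad \<zeta> z) \<le> (\<Sum>i\<in>Basis. B i)" for z
    unfolding space_grad_def using B by (intro sum_norm_le) auto
  then show ?thesis using that norm_ge_zero order_trans by blast
qed

lemma continuous_space_grad:
  assumes "\<zeta> \<in> C1_c S"
  shows "continuous_on UNIV (space_grad \<zeta>)"
  unfolding space_grad_def by (intro continuous_intros C1_c_D[OF assms])

lemma has_derivative_space_grad:
  assumes \<zeta>: "\<zeta> \<in> C1_c S"
  shows "((\<lambda>x. \<zeta> (x, t)) has_derivative (\<lambda>h. space_grad \<zeta> (x, t) \<bullet> h)) (at x)"
proof -
  let ?D = "frechet_derivative \<zeta> (at (x, t))"
  have "((\<lambda>x. (x, t)) has_derivative (\<lambda>h. (h, 0))) (at x)"
    by (auto intro!: derivative_eq_intros)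
  from has_derivative_compose[OF this C1_c_D(1)[OF \<zeta>]]
  have "((\<lambda>x. \<zeta> (x, t)) has_derivative (\<lambda>h. ?D (h, 0))) (at x)" .
  moreover have "?D (h, 0) = space_grad \<zeta> (x, t) \<bullet> h" for h
  proof -
    have lin: "linear ?D"
      using C1_c_D(1)[OF \<zeta>] has_derivative_linear by blast
    have "(h, 0) = (\<Sum>i\<in>Basis. (h \<bullet> i) *\<^sub>R (i, 0 :: real))"
      by (subst euclidean_representation[of h, symmetric]) (simp add: prod_eq_iff fst_sum snd_sum)
    then have "?D (h, 0) = (\<Sum>i\<in>Basis. (h \<bullet> i) *\<^sub>R ?D (i, 0))"
      by (simp add: linear_sum[OF lin] linear_cmul[OF lin] del: scaleR_Pair)
    then show ?thesis
      by (simp add: space_grad_def inner_sum_left inner_sum_right inner_commute mult.commute)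
  qed
  ultimately show ?thesis by simp
qed

lemma has_derivative_time_deriv:
  assumes \<zeta>: "\<zeta> \<in> C1_c S"
  shows "((\<lambda>t. \<zeta> (x, t)) has_real_derivative time_deriv \<zeta> (x, t)) (at t)"
proof -
  let ?D = "frechet_derivative \<zeta> (at (x, t))"
  have "((\<lambda>t. (x, t)) has_derivative (\<lambda>h. (0, h))) (at t)"
    by (auto intro!: derivative_eq_intros)
  from has_derivative_compose[OF this C1_c_D(1)[OF \<zeta>]]
  have "((\<lambda>t. \<zeta> (x, t)) has_derivative (\<lambda>h. ?D (0, h))) (at t)" .
  moreover have "?D (0, h) = time_deriv \<zeta> (x, t) * h" for h
  proof -
    have lin: "linear ?D"
      using C1_c_D(1)[OF \<zeta>] has_derivative_linear by blast
    have "?D (0, h) = ?D (h *\<^sub>R (0, 1))" by simp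
    also have "\<dots> = h *\<^sub>R ?D (0, 1)" by (rule linear_cmul[OF lin])
    finally show ?thesis by (simp add: time_deriv_def)
  qed
  ultimately show ?thesis by (simp add: has_field_derivative_def)
qed

section \<open>The Bogovskii field of a convex domain\<close>

locale bounded_convex_domain =
  fixes \<Omega> :: "'a::euclidean_space set"
  assumes bounded: "bounded \<Omega>" and convex: "convex \<Omega>" and "open": "open \<Omega>" and nonempty: "\<Omega> \<noteq> {}"
begin

lemma sets_\<Omega>[measurable]: "\<Omega> \<in> sets borel"
  using "open" by simp

lemma emeasure_finite: "emeasure lborel \<Omega> < \<infinity>"
  using bounded by (rule emeasure_bounded_finite)

definition vol :: real where "vol = measure lborel \<Omega>"

lemma vol_pos: "vol > 0"
proof -
  have "negligible \<Omega> \<longleftrightarrow> emeasure lborel \<Omega> = 0"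
    by (simp add: negligible_iff_null_sets null_sets_completion_iff) (simp add: null_sets_def)
  then have "emeasure lborel \<Omega> \<noteq> 0"
    using "open" nonempty open_not_negligible by blast
  then show ?thesis
    unfolding vol_def using emeasure_finite
    by (simp add: measure_def enn2real_positive_iff zero_less_iff_neq_zero)
qed

lemma norm_diff_le_diameter: "y \<in> \<Omega> \<Longrightarrow> z \<in> \<Omega> \<Longrightarrow> norm (y - z) \<le> diameter \<Omega>"
  using diameter_bounded_bound[OF bounded, of y z] by (simp add: dist_norm)

lemma diameter_nonneg: "0 \<le> diameter \<Omega>"
  using bounded diameter_ge_0 by blast

text \<open>Each \<open>y \<in> \<Omega>\<close> sends the mass \<open>f y\<close> along the segments to points \<open>z\<close> uniformly distributed
  in \<open>\<Omega>\<close>; \<open>transport f s x\<close> is the density at \<open>x = (1 - s) y + s z\<close> of the momentum after the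
  fraction \<open>s\<close> of the way, and \<open>flux f\<close> the average over \<open>s\<close> (the Bogovskii field with uniform
  weight). It vanishes outside \<open>\<Omega>\<close> because \<open>\<Omega>\<close> is convex.\<close>

definition transport_kernel :: "('a \<Rightarrow> real) \<Rightarrow> real \<Rightarrow> 'a \<Rightarrow> 'a \<Rightarrow> 'a" where
  "transport_kernel f s x y =
     (indicator \<Omega> y * indicator \<Omega> (y + (x - y) /\<^sub>R s) * f y / s ^ DIM('a)) *\<^sub>R ((y - x) /\<^sub>R s)"

definition transport :: "('a \<Rightarrow> real) \<Rightarrow> real \<Rightarrow> 'a \<Rightarrow> 'a" where
  "transport f s x = (\<integral>y. transport_kernel f s x y \<partial>lborel)"

definition flux :: "('a \<Rightarrow> real) \<Rightarrow> 'a \<Rightarrow> 'a" where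
  "flux f x = (\<integral>s. indicator {0<..<1} s *\<^sub>R transport f s x \<partial>lborel) /\<^sub>R vol"

section \<open>Joint measurability of the kernel and of its averages\<close>

lemma measurable_transport_kernel:
  assumes [measurable]: "f \<in> borel_measurable borel"
  shows "(\<lambda>(s, x, y). transport_kernel f s x y) \<in> borel_measurable borel"
proof -
  have [measurable]: "(indicator \<Omega> :: 'a \<Rightarrow> real) \<in> borel_measurable borel" by simp
  show ?thesis
    unfolding transport_kernel_def borel_prod[symmetric] by measurable
qed

lemma measurable_transport:
  assumes "f \<in> borel_measurable borel"
  shows "(\<lambda>(s, x). transport f s x) \<in> borel_measurable borel"
proof -
  have "(\<lambda>((s, x), y). transport_kernel f s x y)
      = (\<lambda>(s, x, y). transport_kernel f s x y) \<circ> (\<lambda>p. (fst (fst p), snd (fst p), snd p))" by auto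
  moreover have "\<dots> \<in> borel_measurable ((borel \<Otimes>\<^sub>M borel) \<Otimes>\<^sub>M lborel)"
    by (intro measurable_comp[OF _ measurable_transport_kernel[OF assms]],
        unfold borel_prod[symmetric]) measurable
  ultimately show ?thesis
    unfolding transport_def borel_prod[symmetric] split_beta'
    by (intro lborel.borel_measurable_lebesgue_integral) (simp add: split_beta')
qed

lemma transport_kernel_measurable_section:
  assumes "f \<in> borel_measurable borel"
  shows "transport_kernel f s x \<in> borel_measurable borel"
    and "(\<lambda>x. transport_kernel f s x y) \<in> borel_measurable borel"
    and "(\<lambda>(x, y). transport_kernel f s x y) \<in> borel_measurable borel"
proof -
  note m = measurable_transport_kernel[OF assms]
  have "(\<lambda>y. (s, x, y)) \<in> borel_measurable borel" "(\<lambda>x. (s, x, y)) \<in> borel_measurable borel"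
    "(\<lambda>(x, y). (s, x, y)) \<in> borel_measurable (borel :: ('a \<times> 'a) measure)"
    by (auto simp: split_beta' intro!: borel_measurable_continuous_onI continuous_intros)
  from this[THEN measurable_comp, OF m] show "transport_kernel f s x \<in> borel_measurable borel"
    "(\<lambda>x. transport_kernel f s x y) \<in> borel_measurable borel"
    "(\<lambda>(x, y). transport_kernel f s x y) \<in> borel_measurable borel"
    by (simp_all add: comp_def split_beta')
qed

lemma transport_measurable_section:
  assumes "f \<in> borel_measurable borel"
  shows "(\<lambda>s. transport f s x) \<in> borel_measurable borel"
proof -
  have "(\<lambda>s. (s, x)) \<in> borel_measurable borel"
    by (auto intro!: borel_measurable_continuous_onI continuous_intros)
  from measurable_comp[OF this measurable_transport[OF assms]] show ?thesis
    by (simp add: comp_def)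
qed

lemma measurable_flux:
  assumes "f \<in> borel_measurable borel"
  shows "flux f \<in> borel_measurable borel"
proof -
  have [measurable]: "(\<lambda>(s, x). transport f s x) \<in> borel_measurable (borel \<Otimes>\<^sub>M borel)"
    using measurable_transport[OF assms] by (simp add: borel_prod)
  have "(\<lambda>(x, s). indicator {0<..<1} s *\<^sub>R transport f s x) \<in> borel_measurable (borel \<Otimes>\<^sub>M lborel)"
    by measurable
  then show ?thesis
    unfolding flux_def by (intro borel_measurable_scaleR lborel.borel_measurable_lebesgue_integral) auto
qed

section \<open>Uniform bounds and support of the field\<close>

text \<open>For fixed \<open>x\<close> and \<open>s\<close>, the starting points \<open>y\<close>
  whose segment through \<open>x\<close> at the fraction \<open>s\<close> also ends in \<Omega>.
  Isolating this set shows the kernel, as a function of \<open>y\<close>, to be the indicator of an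
  open set times a continuous factor times \<open>f\<close>.\<close>

definition overlap :: "real \<Rightarrow> 'a \<Rightarrow> 'a set" where
  "overlap s x = {y \<in> \<Omega>. y + (x - y) /\<^sub>R s \<in> \<Omega>}"

lemma open_overlap: "open (overlap s x)"
proof -
  have "overlap s x = \<Omega> \<inter> (\<lambda>y. y + (x - y) /\<^sub>R s) -` \<Omega>" by (auto simp: overlap_def)
  moreover have "open ((\<lambda>y. y + (x - y) /\<^sub>R s) -` \<Omega>)"
    by (intro open_vimage "open" continuous_intros)
  ultimately show ?thesis using "open" by auto
qed

lemma transport_kernel_eq:
  "transport_kernel f s x y = (indicator (overlap s x) y * f y / s ^ DIM('a)) *\<^sub>R ((y - x) /\<^sub>R s)"
  by (auto simp: transport_kernel_def overlap_def indicator_def)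

text \<open>The vector \<open>(y - x) / s\<close> is \<open>y - z\<close> for the end point
  \<open>z\<close> of the segment, hence no longer than the diameter of \<Omega>, however small
  \<open>s\<close> is.\<close>

lemma norm_transport_kernel_le:
  assumes "\<bar>f y\<bar> \<le> M" and "s > 0"
  shows "norm (transport_kernel f s x y) \<le> M * diameter \<Omega> / s ^ DIM('a) * indicator (overlap s x) y"
proof (cases "y \<in> overlap s x")
  case True
  then have "norm (y - (y + (x - y) /\<^sub>R s)) \<le> diameter \<Omega>"
    by (intro norm_diff_le_diameter) (auto simp: overlap_def)
  moreover have "y - (y + (x - y) /\<^sub>R s) = (y - x) /\<^sub>R s"
    by (simp add: algebra_simps)
  ultimately have "\<bar>f y\<bar> * norm ((y - x) /\<^sub>R s) \<le> M * diameter \<Omega>"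
    using assms by (intro mult_mono) (auto intro: order_trans)
  then have "\<bar>f y\<bar> * norm ((y - x) /\<^sub>R s) / s ^ DIM('a) \<le> M * diameter \<Omega> / s ^ DIM('a)"
    using assms by (intro divide_right_mono) auto
  then show ?thesis
    using True assms by (simp add: transport_kernel_eq abs_mult)
qed (simp add: transport_kernel_eq)

lemma overlap_subset: "overlap s x \<subseteq> \<Omega>"
  by (auto simp: overlap_def)

text \<open>This absorbs the factor \<open>1 / s^d\<close> of the kernel. For \<open>s < 1/2\<close>
  the set lies in the preimage of \<Omega> under the map from \<open>y\<close> to the end point
  \<open>z\<close>, which is affine of ratio \<open>(1 - s) / s\<close> in absolute value; its
  volume is therefore at most \<open>(s / (1 - s))^d * vol\<close>. For \<open>s \<ge> 1/2\<close>
  the volume of \<Omega> itself is enough. Both cases give the constant \<open>2^d\<close>.\<close>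

lemma measure_overlap_le:
  assumes "0 < s" "s < 1"
  shows "measure lborel (overlap s x) / s ^ DIM('a) \<le> 2 ^ DIM('a) * vol"
proof (cases "s \<ge> 1 / 2")
  case True
  have "measure lborel (overlap s x) \<le> vol"
    unfolding vol_def using emeasure_finite open_overlap overlap_subset sets_\<Omega>
    by (intro measure_mono_fmeasurable) (auto simp: fmeasurable_def)
  moreover have "1 / s ^ DIM('a) \<le> 2 ^ DIM('a)"
  proof -
    have "(1 / s) ^ DIM('a) \<le> 2 ^ DIM('a)"
      using True assms by (intro power_mono) (auto simp: field_simps)
    then show ?thesis by (simp add: power_one_over divide_inverse power_inverse)
  qed
  ultimately have "(1 / s ^ DIM('a)) * measure lborel (overlap s x) \<le> 2 ^ DIM('a) * vol"
    using assms by (intro mult_mono) auto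
  then show ?thesis by simp
next
  case False
  \<comment> \<open>The linear coefficient of \<open>y\<close> in the end point
    \<open>z = y + (x - y) / s\<close>.\<close>
  define c where "c = - ((1 - s) / s)"
  have c: "c \<noteq> 0" "\<bar>c\<bar> = (1 - s) / s" using assms by (auto simp: c_def)
  have eq: "x /\<^sub>R s + c *\<^sub>R y = y + (x - y) /\<^sub>R s" for y
  proof -
    have "(1 - s) / s = 1 / s - 1" using assms by (simp add: field_simps)
    then show ?thesis by (simp add: c_def scaleR_left_diff_distrib scaleR_right_diff_distrib inverse_eq_divide)
  qed
  define P where "P = (\<lambda>y. x /\<^sub>R s + c *\<^sub>R y) -` \<Omega>"
  have P: "P \<in> sets borel"
    unfolding P_def by (intro borel_open open_vimage "open" continuous_intros)
  have "vol = (\<integral>x. indicator \<Omega> x \<partial>lborel)" by (simp add: vol_def)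
  also have "\<dots> = \<bar>c\<bar> ^ DIM('a) *\<^sub>R (\<integral>y. indicator \<Omega> (x /\<^sub>R s + c *\<^sub>R y) \<partial>lborel)"
    using c by (intro lborel_integral_affine) auto
  also have "(\<lambda>y. indicat_real \<Omega> (x /\<^sub>R s + c *\<^sub>R y)) = indicator P"
    by (auto simp: P_def indicator_def)
  finally have vol: "vol = \<bar>c\<bar> ^ DIM('a) * measure lborel P" by simp
  have "bounded P"
  proof -
    have "P \<subseteq> (\<lambda>z. (z - x /\<^sub>R s) /\<^sub>R c) ` \<Omega>"
    proof
      fix y assume "y \<in> P"
      then show "y \<in> (\<lambda>z. (z - x /\<^sub>R s) /\<^sub>R c) ` \<Omega>"
        using c by (intro image_eqI[of _ _ "x /\<^sub>R s + c *\<^sub>R y"]) (auto simp: P_def)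
    qed
    moreover have "bounded ((\<lambda>z. (z - x /\<^sub>R s) /\<^sub>R c) ` \<Omega>)"
    proof -
      have "bounded ((\<lambda>z. z /\<^sub>R c) ` ((\<lambda>z. z - x /\<^sub>R s) ` \<Omega>))"
        using bounded by (intro bounded_scaling bounded_translation_minus)
      then show ?thesis by (simp add: image_comp comp_def)
    qed
    ultimately show ?thesis by (rule bounded_subset[rotated])
  qed
  then have "P \<in> fmeasurable lborel"
    using P emeasure_bounded_finite by (auto simp: fmeasurable_def)
  then have "measure lborel (overlap s x) \<le> measure lborel P"
    using open_overlap by (intro measure_mono_fmeasurable) (auto simp: P_def overlap_def eq)
  then have "measure lborel (overlap s x) / s ^ DIM('a) \<le> measure lborel P / s ^ DIM('a)"
    using assms by (intro divide_right_mono) auto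
  also have "\<dots> = vol / (1 - s) ^ DIM('a)"
    using assms by (simp add: vol c power_divide)
  also have "\<dots> = (1 / (1 - s)) ^ DIM('a) * vol"
    by (simp add: power_divide)
  also have "\<dots> \<le> 2 ^ DIM('a) * vol"
    using False assms vol_pos by (intro mult_right_mono power_mono) (auto simp: field_simps)
  finally show ?thesis .
qed

lemma integrable_indicator_overlap: "integrable lborel (indicat_real (overlap s x))"
  using open_overlap bounded overlap_subset[of s x]
  by (intro integrable_lborel_bounded_support[where B = 1 and S = \<Omega>]) (auto simp: indicator_def)

lemma integrable_transport_kernel:
  assumes "f \<in> borel_measurable borel" and "\<And>y. \<bar>f y\<bar> \<le> M" and "s > 0"
  shows "integrable lborel (transport_kernel f s x)"
proof (rule Bochner_Integration.integrable_bound)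
  show "integrable lborel (\<lambda>y. M * diameter \<Omega> / s ^ DIM('a) * indicator (overlap s x) y)"
    by (intro integrable_mult_right integrable_indicator_overlap)
  show "transport_kernel f s x \<in> borel_measurable lborel"
    using transport_kernel_measurable_section(1)[OF assms(1)] by simp
  show "AE y in lborel. norm (transport_kernel f s x y)
      \<le> norm (M * diameter \<Omega> / s ^ DIM('a) * indicator (overlap s x) y)"
    unfolding real_norm_def using assms
    by (intro AE_I2 order_trans[OF norm_transport_kernel_le abs_ge_self])
qed

text \<open>The product of the bound \<open>M\<close> on the density, the longest path length and
  the normalised volume estimate for the overlap; it bounds \<open>transport\<close> for every
  \<open>s\<close> in the open unit interval.\<close>

definition flux_bound :: "real \<Rightarrow> real" where
  "flux_bound M = 2 ^ DIM('a) * M * diameter \<Omega> * vol"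

lemma flux_bound_nonneg:
  assumes "\<And>y. \<bar>f y\<bar> \<le> M"
  shows "flux_bound M \<ge> 0"
  using assms[of undefined] diameter_nonneg vol_pos by (simp add: flux_bound_def)

lemma norm_transport_le:
  assumes "f \<in> borel_measurable borel" and M: "\<And>y. \<bar>f y\<bar> \<le> M" and s: "0 < s" "s < 1"
  shows "norm (transport f s x) \<le> flux_bound M"
proof -
  have "M \<ge> 0" using M[of undefined] by linarith
  have "norm (transport f s x) \<le> (\<integral>y. norm (transport_kernel f s x y) \<partial>lborel)"
    unfolding transport_def by (rule integral_norm_bound)
  also have "\<dots> \<le> (\<integral>y. M * diameter \<Omega> / s ^ DIM('a) * indicator (overlap s x) y \<partial>lborel)"
    using integrable_transport_kernel[OF assms(1) M s(1)] M s
    by (intro integral_mono integrable_norm integrable_mult_right integrable_indicator_overlap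
        norm_transport_kernel_le) auto
  also have "\<dots> = M * diameter \<Omega> * (measure lborel (overlap s x) / s ^ DIM('a))"
    by simp
  also have "\<dots> \<le> M * diameter \<Omega> * (2 ^ DIM('a) * vol)"
    using \<open>M \<ge> 0\<close> diameter_nonneg by (intro mult_left_mono measure_overlap_le s) auto
  finally show ?thesis by (simp add: flux_bound_def mult_ac)
qed

text \<open>A common \<open>y\<close> would exhibit \<open>x\<close> as the convex combination
  \<open>(1 - s) y + s z\<close> of two points of \<Omega>. This is where convexity keeps the
  momentum inside.\<close>

lemma overlap_outside:
  assumes "x \<notin> \<Omega>" "0 < s" "s < 1"
  shows "overlap s x = {}"
proof (rule ccontr)
  assume "overlap s x \<noteq> {}"
  then obtain y where y: "y \<in> \<Omega>" "y + (x - y) /\<^sub>R s \<in> \<Omega>" by (auto simp: overlap_def)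
  then have "(1 - s) *\<^sub>R y + s *\<^sub>R (y + (x - y) /\<^sub>R s) \<in> \<Omega>"
    using assms by (intro convexD_alt[OF convex]) auto
  moreover have "(1 - s) *\<^sub>R y + s *\<^sub>R (y + (x - y) /\<^sub>R s) = x"
    using assms by (simp add: algebra_simps)
  ultimately show False using assms by simp
qed

lemma transport_outside:
  assumes "x \<notin> \<Omega>" "0 < s" "s < 1"
  shows "transport f s x = 0"
  using overlap_outside[OF assms] by (simp add: transport_def transport_kernel_eq)

lemma integrable_transport:
  assumes "f \<in> borel_measurable borel" and M: "\<And>y. \<bar>f y\<bar> \<le> M"
  shows "integrable lborel (\<lambda>s. indicator {0<..<1} s *\<^sub>R transport f s x)"
proof (rule integrable_lborel_bounded_support[where B = "flux_bound M" and S = "{0<..<1}"])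
  have "flux_bound M \<ge> 0" using M by (rule flux_bound_nonneg)
  then show "norm (indicator {0<..<1} s *\<^sub>R transport f s x) \<le> flux_bound M" for s
    using norm_transport_le[OF assms, of s x] by (auto simp: indicator_def)
  show "(\<lambda>s. indicator {0<..<1} s *\<^sub>R transport f s x) \<in> borel_measurable borel"
    using transport_measurable_section[OF assms(1)] by measurable
qed auto

lemma norm_flux_le:
  assumes "f \<in> borel_measurable borel" and M: "\<And>y. \<bar>f y\<bar> \<le> M"
  shows "norm (flux f x) \<le> flux_bound M / vol"
proof -
  have "norm (\<integral>s. indicator {0<..<1} s *\<^sub>R transport f s x \<partial>lborel)
      \<le> (\<integral>s. norm (indicator {0<..<1} s *\<^sub>R transport f s x) \<partial>lborel)"
    by (rule integral_norm_bound)
  also have "\<dots> \<le> (\<integral>s. flux_bound M * indicator {0<..<1::real} s \<partial>lborel)"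
  proof (rule integral_mono)
    show "norm (indicator {0<..<1} s *\<^sub>R transport f s x) \<le> flux_bound M * indicator {0<..<1} s" for s
      using norm_transport_le[OF assms, of s x] by (auto simp: indicator_def)
  qed (auto intro!: integrable_norm[OF integrable_transport[OF assms]] simp del: norm_scaleR)
  also have "\<dots> = flux_bound M" by simp
  finally show ?thesis
    using vol_pos by (simp add: flux_def divide_simps mult.commute)
qed

lemma flux_outside: "x \<notin> \<Omega> \<Longrightarrow> flux f x = 0"
proof -
  assume "x \<notin> \<Omega>"
  then have "indicator {0<..<1} s *\<^sub>R transport f s x = 0" for s
    using transport_outside[of x s f] by (auto simp: indicator_def)
  then show ?thesis by (simp only: flux_def Bochner_Integration.integral_zero scaleR_zero_right)
qed

section \<open>Continuity of the field under weak* convergence\<close>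

text \<open>For fixed \<open>s\<close> and \<open>x\<close> each component of
  \<open>transport\<close> integrates the density against a continuous function on the open set
  \<open>overlap s x\<close>, to which weak* convergence extends. The bound
  \<open>flux_bound M\<close> is uniform in \<open>s\<close> and \<open>n\<close>, so dominated
  convergence handles the average over \<open>s\<close>.\<close>

lemma flux_tendsto:
  assumes f: "\<And>n. f n \<in> borel_measurable borel" and g: "g \<in> borel_measurable borel"
    and bd: "\<And>n x. \<bar>f n x\<bar> \<le> M" "\<And>x. \<bar>g x\<bar> \<le> M"
    and conv: "\<And>k. k \<in> C_c \<Longrightarrow> (\<lambda>n. \<integral>x. indicator \<Omega> x * f n x * k x \<partial>lborel)
        \<longlonglongrightarrow> (\<integral>x. indicator \<Omega> x * g x * k x \<partial>lborel)"
  shows "(\<lambda>n. flux (f n) x) \<longlonglongrightarrow> flux g x"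
proof -
  have tr: "(\<lambda>n. transport (f n) s x) \<longlonglongrightarrow> transport g s x" if s: "0 < s" "s < 1" for s
  proof (rule tendsto_componentwise_iff[THEN iffD2], intro ballI)
    fix i :: 'a assume "i \<in> Basis"
    define h where "h y = ((y - x) /\<^sub>R s) \<bullet> i / s ^ DIM('a)" for y
    have h: "continuous_on UNIV h"
      unfolding h_def divide_inverse by (intro continuous_intros)
    have eq: "transport u s x \<bullet> i = (\<integral>y. indicator (overlap s x) y * h y * u y \<partial>lborel)"
      if "u \<in> borel_measurable borel" "\<And>y. \<bar>u y\<bar> \<le> M" for u
    proof -
      have "transport u s x \<bullet> i = (\<integral>y. transport_kernel u s x y \<bullet> i \<partial>lborel)"
        using integrable_transport_kernel[OF that s(1)] by (simp add: transport_def)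
      also have "\<dots> = (\<integral>y. indicator (overlap s x) y * h y * u y \<partial>lborel)"
        by (intro Bochner_Integration.integral_cong) (auto simp: transport_kernel_eq h_def)
      finally show ?thesis .
    qed
    show "(\<lambda>n. transport (f n) s x \<bullet> i) \<longlonglongrightarrow> transport g s x \<bullet> i"
      unfolding eq[OF f bd(1)] eq[OF g bd(2)]
      by (rule weak_star_test_open[OF f g bd bounded "open" conv overlap_subset open_overlap h])
  qed
  have "(\<lambda>n. \<integral>s. indicator {0<..<1} s *\<^sub>R transport (f n) s x \<partial>lborel)
      \<longlonglongrightarrow> (\<integral>s. indicator {0<..<1} s *\<^sub>R transport g s x \<partial>lborel)"
  proof (rule integral_dominated_convergence[where w = "\<lambda>s. flux_bound M * indicator {0<..<1::real} s"])
    show "(\<lambda>s. indicator {0<..<1} s *\<^sub>R transport g s x) \<in> borel_measurable lborel"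
      using integrable_transport[OF g bd(2)] by (rule borel_measurable_integrable)
    show "(\<lambda>s. indicator {0<..<1} s *\<^sub>R transport (f n) s x) \<in> borel_measurable lborel" for n
      using integrable_transport[OF f bd(1)] by (rule borel_measurable_integrable)
    show "integrable lborel (\<lambda>s. flux_bound M * indicator {0<..<1::real} s)" by simp
    show "AE s in lborel. (\<lambda>n. indicator {0<..<1} s *\<^sub>R transport (f n) s x)
        \<longlonglongrightarrow> indicator {0<..<1} s *\<^sub>R transport g s x"
      using tr by (auto simp: indicator_def)
    show "AE s in lborel. norm (indicator {0<..<1} s *\<^sub>R transport (f n) s x)
        \<le> flux_bound M * indicator {0<..<1} s" for n
      using norm_transport_le[OF f bd(1)] by (auto simp: indicator_def)
  qed
  then show ?thesis
    unfolding flux_def by (intro tendsto_intros)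
qed

section \<open>Divergence of the field\<close>

text \<open>After exchanging the integrals, the substitution \<open>x = (1 - s) y + s z\<close> at
  fixed \<open>y\<close> trades the position on the segment for its end point; its Jacobian
  \<open>s^d\<close> cancels the normalisation of the kernel.\<close>

lemma integral_transport:
  fixes g :: "'a \<Rightarrow> 'a"
  assumes f: "f \<in> borel_measurable borel" and M: "\<And>y. \<bar>f y\<bar> \<le> M"
    and g: "continuous_on UNIV g" and B: "\<And>x. norm (g x) \<le> B" and s: "0 < s" "s < 1"
  shows "(\<integral>x. g x \<bullet> transport f s x \<partial>lborel) =
    (\<integral>y. (\<integral>z. indicator \<Omega> y * indicator \<Omega> z * f y * (g ((1 - s) *\<^sub>R y + s *\<^sub>R z) \<bullet> (y - z)) \<partial>lborel) \<partial>lborel)"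
proof -
  have "M \<ge> 0" using M[of undefined] by linarith
  have "B \<ge> 0" using B norm_ge_zero order_trans by blast
  have [measurable]: "g \<in> borel_measurable borel" using g by (rule borel_measurable_continuous_onI)
  let ?k = "transport_kernel f s"
  define b where "b = B * (M * diameter \<Omega> / s ^ DIM('a))"
  have b0: "M * diameter \<Omega> / s ^ DIM('a) \<ge> 0" using \<open>M \<ge> 0\<close> diameter_nonneg s by simp
  have kb: "norm (?k x y) \<le> M * diameter \<Omega> / s ^ DIM('a)" for x y
    using norm_transport_kernel_le[where f = f and y = y, OF M s(1), of x] b0
    by (cases "y \<in> overlap s x") auto
  have gk: "\<bar>g x \<bullet> ?k x y\<bar> \<le> b" for x y
    unfolding b_def using B[of x] kb[of x y] \<open>B \<ge> 0\<close>
    by (intro order_trans[OF Cauchy_Schwarz_ineq2] mult_mono) auto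
  have k0: "?k x y = 0" if "x \<notin> \<Omega> \<or> y \<notin> \<Omega>" for x y
    using that overlap_outside[OF _ s, of x] overlap_subset[of s x]
    by (auto simp: transport_kernel_eq indicator_def)
  have "(\<integral>x. g x \<bullet> transport f s x \<partial>lborel) = (\<integral>x. (\<integral>y. g x \<bullet> ?k x y \<partial>lborel) \<partial>lborel)"
    unfolding transport_def
    using integrable_transport_kernel[OF f M s(1)] by (intro Bochner_Integration.integral_cong) auto
  also have "\<dots> = (\<integral>y. (\<integral>x. g x \<bullet> ?k x y \<partial>lborel) \<partial>lborel)"
  proof (rule Fubini_lborel_bounded_support[where B = b and S = \<Omega> and T = \<Omega>])
    have [measurable]: "(\<lambda>(x, y). ?k x y) \<in> borel_measurable (borel \<Otimes>\<^sub>M borel)"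
      using transport_kernel_measurable_section(3)[OF f] by (simp add: borel_prod)
    show "(\<lambda>(x, y). g x \<bullet> ?k x y) \<in> borel_measurable borel"
      unfolding borel_prod[symmetric] by measurable
  qed (use gk bounded k0 in auto)
  also have "\<dots> = (\<integral>y. (\<integral>z. indicator \<Omega> y * indicator \<Omega> z * f y * (g ((1 - s) *\<^sub>R y + s *\<^sub>R z) \<bullet> (y - z)) \<partial>lborel) \<partial>lborel)"
  proof (rule Bochner_Integration.integral_cong[OF refl])
    fix y
    have "(\<integral>x. g x \<bullet> ?k x y \<partial>lborel)
        = \<bar>s\<bar> ^ DIM('a) *\<^sub>R (\<integral>z. g ((1 - s) *\<^sub>R y + s *\<^sub>R z) \<bullet> ?k ((1 - s) *\<^sub>R y + s *\<^sub>R z) y \<partial>lborel)"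
    proof (rule lborel_integral_affine)
      have [measurable]: "(\<lambda>x. ?k x y) \<in> borel_measurable borel"
        by (rule transport_kernel_measurable_section(2)[OF f])
      show "(\<lambda>x. g x \<bullet> ?k x y) \<in> borel_measurable borel" by measurable
    qed (use s in auto)
    also have "\<dots> = (\<integral>z. s ^ DIM('a) * (g ((1 - s) *\<^sub>R y + s *\<^sub>R z) \<bullet> ?k ((1 - s) *\<^sub>R y + s *\<^sub>R z) y) \<partial>lborel)"
      using s by simp
    also have "\<dots> = (\<integral>z. indicator \<Omega> y * indicator \<Omega> z * f y * (g ((1 - s) *\<^sub>R y + s *\<^sub>R z) \<bullet> (y - z)) \<partial>lborel)"
    proof (rule Bochner_Integration.integral_cong[OF refl])
      fix z
      have 1: "y + ((1 - s) *\<^sub>R y + s *\<^sub>R z - y) /\<^sub>R s = z"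
        using s by (simp add: algebra_simps)
      have 2: "(y - ((1 - s) *\<^sub>R y + s *\<^sub>R z)) /\<^sub>R s = y - z"
        using s by (simp add: algebra_simps)
      show "s ^ DIM('a) * (g ((1 - s) *\<^sub>R y + s *\<^sub>R z) \<bullet> ?k ((1 - s) *\<^sub>R y + s *\<^sub>R z) y)
        = indicator \<Omega> y * indicator \<Omega> z * f y * (g ((1 - s) *\<^sub>R y + s *\<^sub>R z) \<bullet> (y - z))"
        unfolding transport_kernel_def 1 2 using s by simp
    qed
    finally show "(\<integral>x. g x \<bullet> ?k x y \<partial>lborel) =
      (\<integral>z. indicator \<Omega> y * indicator \<Omega> z * f y * (g ((1 - s) *\<^sub>R y + s *\<^sub>R z) \<bullet> (y - z)) \<partial>lborel)" .
  qed
  finally show ?thesis .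
qed

text \<open>Integrating the gradient along each segment telescopes to
  \<open>\<zeta> y - \<zeta> z\<close>. Averaged over \<open>z\<close>, the first term yields
  \<open>f\<close> times \<zeta>, while the second is the integral of \<open>f\<close> times a
  constant and vanishes by the mean condition. Thus minus the divergence of \<open>flux f\<close>
  equals \<open>f\<close> on \<Omega> and 0 elsewhere, in the whole space: \<zeta> is unrestricted
  at the boundary, which encodes the no-flux condition.\<close>

theorem flux_weak_divergence:
  fixes \<zeta> :: "'a \<Rightarrow> real" and g :: "'a \<Rightarrow> 'a"
  assumes f: "f \<in> borel_measurable borel" and M: "\<And>y. \<bar>f y\<bar> \<le> M"
    and mean: "(\<integral>x. indicator \<Omega> x * f x \<partial>lborel) = 0"
    and der: "\<And>x. (\<zeta> has_derivative (\<lambda>h. g x \<bullet> h)) (at x)"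
    and g: "continuous_on UNIV g" and B: "\<And>x. norm (g x) \<le> B"
  shows "(\<integral>x. g x \<bullet> flux f x \<partial>lborel) = (\<integral>x. indicator \<Omega> x * f x * \<zeta> x \<partial>lborel)"
proof -
  note [measurable] = f
  have M0: "M \<ge> 0" using M[of undefined] by linarith
  have B0: "B \<ge> 0" using B norm_ge_zero order_trans by blast
  have gm[measurable]: "g \<in> borel_measurable borel" using g by (rule borel_measurable_continuous_onI)
  let ?I = "indicator {0<..<1::real} :: real \<Rightarrow> real"
  \<comment> \<open>The integrand over \<open>(s, y, z)\<close> after the substitution. The chain
    below exchanges integrals until the one over \<open>s\<close> is innermost, where the segment
    formula evaluates it.\<close>
  define R where "R s y z = indicator \<Omega> y * indicator \<Omega> z * f y * (g ((1 - s) *\<^sub>R y + s *\<^sub>R z) \<bullet> (y - z))"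
    for s :: real and y z
  define r where "r = M * (B * diameter \<Omega>)"
  have r0: "r \<ge> 0" using M0 B0 diameter_nonneg by (simp add: r_def)
  have Rb: "\<bar>R s y z\<bar> \<le> r * indicator \<Omega> z" for s y z
  proof (cases "y \<in> \<Omega> \<and> z \<in> \<Omega>")
    case True
    have "\<bar>g ((1 - s) *\<^sub>R y + s *\<^sub>R z) \<bullet> (y - z)\<bar> \<le> B * diameter \<Omega>"
      using B norm_diff_le_diameter True B0 by (intro order_trans[OF Cauchy_Schwarz_ineq2] mult_mono) auto
    then have "\<bar>f y\<bar> * \<bar>g ((1 - s) *\<^sub>R y + s *\<^sub>R z) \<bullet> (y - z)\<bar> \<le> r"
      unfolding r_def using M M0 by (intro mult_mono) auto
    then show ?thesis using True by (simp add: R_def abs_mult)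
  qed (use r0 in \<open>auto simp: R_def\<close>)
  have Rb': "\<bar>R s y z\<bar> \<le> r" for s y z using Rb[of s y z] r0 by (cases "z \<in> \<Omega>") auto
  have I\<Omega>: "integrable lborel (indicat_real \<Omega>)"
    using emeasure_finite by simp
  have R0: "R s y z = 0" if "y \<notin> \<Omega> \<or> z \<notin> \<Omega>" for s y z using that by (auto simp: R_def)
  have Rm3: "(\<lambda>p. R (fst (fst p)) (snd (fst p)) (snd p)) \<in> borel_measurable ((borel \<Otimes>\<^sub>M borel) \<Otimes>\<^sub>M borel)"
    unfolding R_def by measurable
  have Rm2: "(\<lambda>(s, z). R s y z) \<in> borel_measurable (borel \<Otimes>\<^sub>M borel)" for y
    unfolding R_def by measurable
  have Rm1: "(\<lambda>z. R s y z) \<in> borel_measurable borel" for s y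
    unfolding R_def by measurable
  have IRb: "\<bar>\<integral>z. R s y z \<partial>lborel\<bar> \<le> r * vol" for s y
  proof -
    have "integrable lborel (\<lambda>z. R s y z)"
      using Rm1 Rb' R0 bounded by (intro integrable_lborel_bounded_support[where B = r and S = \<Omega>]) auto
    then have "(\<integral>z. \<bar>R s y z\<bar> \<partial>lborel) \<le> (\<integral>z. r * indicator \<Omega> z \<partial>lborel)"
      using Rb I\<Omega> by (intro integral_mono) auto
    then have "(\<integral>z. \<bar>R s y z\<bar> \<partial>lborel) \<le> r * vol" by (simp add: vol_def)
    then show ?thesis using integral_abs_bound[of lborel "R s y"] by linarith
  qed
  have I01: "0 \<le> ?I s" "?I s \<le> 1" for s by (auto simp: indicator_def)
  have fb0: "flux_bound M \<ge> 0" using M by (rule flux_bound_nonneg)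

  have "(\<integral>x. g x \<bullet> flux f x \<partial>lborel) = (\<integral>x. (\<integral>s. ?I s * (g x \<bullet> transport f s x) \<partial>lborel) / vol \<partial>lborel)"
  proof (rule Bochner_Integration.integral_cong[OF refl])
    fix x
    have "g x \<bullet> (\<integral>s. ?I s *\<^sub>R transport f s x \<partial>lborel) = (\<integral>s. g x \<bullet> (?I s *\<^sub>R transport f s x) \<partial>lborel)"
      using integrable_transport[OF f M] by (intro integral_inner_right[symmetric])
    then show "g x \<bullet> flux f x = (\<integral>s. ?I s * (g x \<bullet> transport f s x) \<partial>lborel) / vol"
      by (simp add: flux_def divide_inverse mult.commute)
  qed
  also have "\<dots> = (\<integral>x. (\<integral>s. ?I s * (g x \<bullet> transport f s x) \<partial>lborel) \<partial>lborel) / vol"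
    by simp
  also have "(\<integral>x. (\<integral>s. ?I s * (g x \<bullet> transport f s x) \<partial>lborel) \<partial>lborel)
      = (\<integral>s. (\<integral>x. ?I s * (g x \<bullet> transport f s x) \<partial>lborel) \<partial>lborel)"
  proof (rule Fubini_lborel_bounded_support[where B = "B * flux_bound M" and S = \<Omega> and T = "{0<..<1}"])
    have [measurable]: "(\<lambda>(s, x). transport f s x) \<in> borel_measurable (borel \<Otimes>\<^sub>M borel)"
      using measurable_transport[OF f] by (simp add: borel_prod)
    show "(\<lambda>(x, s). ?I s * (g x \<bullet> transport f s x)) \<in> borel_measurable borel"
      unfolding borel_prod[symmetric] by measurable
    fix x s
    show "\<bar>?I s * (g x \<bullet> transport f s x)\<bar> \<le> B * flux_bound M"
    proof (cases "0 < s \<and> s < 1")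
      case True
      then have "\<bar>g x \<bullet> transport f s x\<bar> \<le> B * flux_bound M"
        using B B0 norm_transport_le[OF f M]
        by (intro order_trans[OF Cauchy_Schwarz_ineq2] mult_mono) auto
      then show ?thesis using True by simp
    qed (use B0 fb0 in auto)
    show "?I s * (g x \<bullet> transport f s x) = 0" if "x \<notin> \<Omega> \<or> s \<notin> {0<..<1}"
      using that transport_outside[of x s f] by (auto simp: indicator_def)
  qed (use bounded in auto)
  also have "\<dots> = (\<integral>s. (\<integral>y. ?I s * (\<integral>z. R s y z \<partial>lborel) \<partial>lborel) \<partial>lborel)"
  proof (rule Bochner_Integration.integral_cong[OF refl])
    fix s
    show "(\<integral>x. ?I s * (g x \<bullet> transport f s x) \<partial>lborel) = (\<integral>y. ?I s * (\<integral>z. R s y z \<partial>lborel) \<partial>lborel)"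
      using integral_transport[OF f M g B, of s] by (cases "0 < s \<and> s < 1") (auto simp: R_def)
  qed
  also have "\<dots> = (\<integral>y. (\<integral>s. ?I s * (\<integral>z. R s y z \<partial>lborel) \<partial>lborel) \<partial>lborel)"
  proof (rule Fubini_lborel_bounded_support[where B = "r * vol" and S = "{0<..<1}" and T = \<Omega>])
    have "(\<lambda>p. \<integral>z. R (fst p) (snd p) z \<partial>lborel) \<in> borel_measurable (borel \<Otimes>\<^sub>M borel)"
      using Rm3 by (intro lborel.borel_measurable_lebesgue_integral) (simp add: split_beta')
    then have [measurable]: "(\<lambda>(s, y). \<integral>z. R s y z \<partial>lborel) \<in> borel_measurable (borel \<Otimes>\<^sub>M borel)"
      by (simp add: split_beta')
    show "(\<lambda>(s, y). ?I s * (\<integral>z. R s y z \<partial>lborel)) \<in> borel_measurable borel"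
      unfolding borel_prod[symmetric] by measurable
    show "\<bar>?I s * (\<integral>z. R s y z \<partial>lborel)\<bar> \<le> r * vol" for s y
      using IRb[of s y] r0 vol_pos by (cases "0 < s \<and> s < 1") auto
    show "?I s * (\<integral>z. R s y z \<partial>lborel) = 0" if "s \<notin> {0<..<1} \<or> y \<notin> \<Omega>" for s y
    proof (cases "y \<in> \<Omega>")
      case False
      then have "R s y = (\<lambda>_. 0)" using R0 by auto
      then show ?thesis by simp
    qed (use that in auto)
  qed (use bounded in auto)
  also have "\<dots> = (\<integral>y. (\<integral>z. (\<integral>s. ?I s * R s y z \<partial>lborel) \<partial>lborel) \<partial>lborel)"
  proof (rule Bochner_Integration.integral_cong[OF refl])
    fix y
    have "(\<integral>s. ?I s * (\<integral>z. R s y z \<partial>lborel) \<partial>lborel) = (\<integral>s. (\<integral>z. ?I s * R s y z \<partial>lborel) \<partial>lborel)"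
      by simp
    also have "\<dots> = (\<integral>z. (\<integral>s. ?I s * R s y z \<partial>lborel) \<partial>lborel)"
    proof (rule Fubini_lborel_bounded_support[where B = r and S = "{0<..<1}" and T = \<Omega>])
      note [measurable] = Rm2
      show "(\<lambda>(s, z). ?I s * R s y z) \<in> borel_measurable borel"
        unfolding borel_prod[symmetric] by measurable
      show "\<bar>?I s * R s y z\<bar> \<le> r" for s z
        using Rb'[of s y z] r0 by (cases "0 < s \<and> s < 1") auto
    qed (use bounded R0 in auto)
    finally show "(\<integral>s. ?I s * (\<integral>z. R s y z \<partial>lborel) \<partial>lborel) = (\<integral>z. (\<integral>s. ?I s * R s y z \<partial>lborel) \<partial>lborel)" .
  qed
  also have "\<dots> = (\<integral>y. (\<integral>z. indicator \<Omega> y * f y * (indicator \<Omega> z * (\<zeta> y - \<zeta> z)) \<partial>lborel) \<partial>lborel)"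
  proof (intro Bochner_Integration.integral_cong refl)
    fix y z
    have "(\<integral>s. ?I s * R s y z \<partial>lborel) = (\<integral>s. (indicator \<Omega> y * indicator \<Omega> z * f y) *
        (?I s * (g ((1 - s) *\<^sub>R y + s *\<^sub>R z) \<bullet> (y - z))) \<partial>lborel)"
      by (intro Bochner_Integration.integral_cong) (auto simp: R_def)
    also have "\<dots> = indicator \<Omega> y * indicator \<Omega> z * f y * (\<zeta> y - \<zeta> z)"
      using segment_integral[OF der g, of y z] by simp
    finally show "(\<integral>s. ?I s * R s y z \<partial>lborel) = indicator \<Omega> y * f y * (indicator \<Omega> z * (\<zeta> y - \<zeta> z))"
      by simp
  qed
  also have "\<dots> = vol * (\<integral>x. indicator \<Omega> x * f x * \<zeta> x \<partial>lborel)"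
  proof -
    have \<zeta>c: "continuous_on UNIV \<zeta>"
      using der by (meson continuous_at_imp_continuous_on has_derivative_continuous)
    then have [measurable]: "\<zeta> \<in> borel_measurable borel" by (rule borel_measurable_continuous_onI)
    \<comment> \<open>Only the gradient of \<zeta> is bounded by assumption; for \<zeta> itself the
      values on \<Omega> are enough, and these are controlled on the compact closure.\<close>
    have "bounded (\<zeta> ` closure \<Omega>)"
      using bounded \<zeta>c by (intro compact_imp_bounded compact_continuous_image) (auto intro: continuous_on_subset)
    then obtain Z where "\<And>x. x \<in> closure \<Omega> \<Longrightarrow> \<bar>\<zeta> x\<bar> \<le> Z" by (auto simp: bounded_iff)
    then have Z: "\<And>x. x \<in> \<Omega> \<Longrightarrow> \<bar>\<zeta> x\<bar> \<le> \<bar>Z\<bar>" using closure_subset by fastforce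
    have i\<zeta>: "integrable lborel (\<lambda>z. indicator \<Omega> z * \<zeta> z)"
    proof (rule integrable_lborel_bounded_support[where B = "\<bar>Z\<bar>" and S = \<Omega>])
      show "norm (indicator \<Omega> z * \<zeta> z) \<le> \<bar>Z\<bar>" for z using Z[of z] by (cases "z \<in> \<Omega>") auto
    qed (use bounded in auto)
    have if': "integrable lborel (\<lambda>z. indicator \<Omega> z * f z)"
    proof (rule integrable_lborel_bounded_support[where B = M and S = \<Omega>])
      show "norm (indicator \<Omega> z * f z) \<le> M" for z using M[of z] M0 by (cases "z \<in> \<Omega>") auto
    qed (use bounded in auto)
    have if\<zeta>: "integrable lborel (\<lambda>z. indicator \<Omega> z * f z * \<zeta> z)"
    proof (rule integrable_lborel_bounded_support[where B = "M * \<bar>Z\<bar>" and S = \<Omega>])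
      show "norm (indicator \<Omega> z * f z * \<zeta> z) \<le> M * \<bar>Z\<bar>" for z
        using M[of z] M0 Z[of z] by (cases "z \<in> \<Omega>") (auto simp: abs_mult intro!: mult_mono)
    qed (use bounded in auto)
    let ?Z = "\<integral>z. indicator \<Omega> z * \<zeta> z \<partial>lborel"
    have "(\<integral>z. indicator \<Omega> y * f y * (indicator \<Omega> z * (\<zeta> y - \<zeta> z)) \<partial>lborel)
        = vol * (indicator \<Omega> y * f y * \<zeta> y) - (indicator \<Omega> y * f y) * ?Z" for y
    proof -
      have "(\<integral>z. indicator \<Omega> z * (\<zeta> y - \<zeta> z) \<partial>lborel) = (\<integral>z. \<zeta> y * indicator \<Omega> z - indicator \<Omega> z * \<zeta> z \<partial>lborel)"
        by (intro Bochner_Integration.integral_cong) (auto simp: algebra_simps)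
      also have "\<dots> = \<zeta> y * vol - ?Z"
        using I\<Omega> i\<zeta> by (subst Bochner_Integration.integral_diff) (auto simp: vol_def)
      finally show ?thesis
        by (simp only: integral_mult_right_zero) (simp add: algebra_simps)
    qed
    then have "(\<integral>y. (\<integral>z. indicator \<Omega> y * f y * (indicator \<Omega> z * (\<zeta> y - \<zeta> z)) \<partial>lborel) \<partial>lborel)
        = (\<integral>y. vol * (indicator \<Omega> y * f y * \<zeta> y) - (indicator \<Omega> y * f y) * ?Z \<partial>lborel)"
      by (simp only:)
    also have "\<dots> = (\<integral>y. vol * (indicator \<Omega> y * f y * \<zeta> y) \<partial>lborel) - (\<integral>y. (indicator \<Omega> y * f y) * ?Z \<partial>lborel)"
      using if' if\<zeta> by (intro Bochner_Integration.integral_diff integrable_mult_right integrable_mult_left)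
    \<comment> \<open>The mean condition removes the contribution of the end points
      \<open>z\<close>.\<close>
    also have "\<dots> = vol * (\<integral>x. indicator \<Omega> x * f x * \<zeta> x \<partial>lborel)"
      using mean by (simp only: integral_mult_right_zero integral_mult_left_zero mult_zero_left diff_zero)
    finally show ?thesis .
  qed
  finally show ?thesis using vol_pos by simp
qed

section \<open>Curves of small action\<close>

abbreviation "\<gamma> \<equiv> gamma_dom \<Omega>"

lemma sets_gamma: "sets \<gamma> = sets borel"
  by (simp add: gamma_dom_def)

lemma measurable_gamma: "f \<in> borel_measurable \<gamma> \<longleftrightarrow> f \<in> borel_measurable borel"
  by (simp add: gamma_dom_def)

lemma gamma_eq: "\<gamma> = density lborel (\<lambda>x. ennreal (indicator \<Omega> x))"
  by (simp add: gamma_dom_def ennreal_indicator)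

lemma integral_gamma:
  fixes f :: "'a \<Rightarrow> 'b::euclidean_space"
  assumes "f \<in> borel_measurable borel"
  shows "(\<integral>x. f x \<partial>\<gamma>) = (\<integral>x. indicator \<Omega> x *\<^sub>R f x \<partial>lborel)"
  unfolding gamma_eq using assms by (subst integral_density) auto

lemma emeasure_gamma: "emeasure \<gamma> UNIV = ennreal vol"
proof -
  have "emeasure \<gamma> UNIV = emeasure lborel \<Omega>"
    unfolding gamma_dom_def by (subst emeasure_density) auto
  then show ?thesis
    using emeasure_finite by (simp add: vol_def emeasure_eq_ennreal_measure)
qed

lemma space_gamma: "space \<gamma> = UNIV"
  by (simp add: gamma_dom_def)

lemma finite_measure_gamma: "finite_measure \<gamma>"
  using emeasure_gamma by (intro finite_measureI) (simp add: space_gamma)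

lemma gamma_in_M_loc_pos: "\<gamma> \<in> M_loc_pos"
proof -
  have "emeasure \<gamma> K < top" for K
    using emeasure_space[of \<gamma> K] emeasure_gamma
    by (metis ennreal_less_top order_le_less_trans space_gamma)
  then show ?thesis by (simp add: M_loc_pos_def sets_gamma)
qed

lemma integrable_gamma_bounded:
  fixes f :: "'a \<Rightarrow> 'b::euclidean_space"
  assumes "f \<in> borel_measurable borel" and "\<And>x. norm (f x) \<le> B"
  shows "integrable \<gamma> f"
  using finite_measure_gamma assms
  by (intro finite_measure.integrable_const_bound[where B = B]) (auto simp: measurable_gamma)

lemma locally_integrable_gamma_bounded:
  fixes f :: "'a \<Rightarrow> 'b::euclidean_space"
  assumes "f \<in> borel_measurable borel" and "\<And>x. norm (f x) \<le> B"
  shows "locally_integrable \<gamma> f"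
  unfolding locally_integrable_def set_integrable_def
  using assms integrable_gamma_bounded[OF assms]
  by (auto intro!: integrable_mult_indicator simp: sets_gamma borel_compact)

text \<open>Clamping the density to the interval from \<open>a\<close> to \<open>b\<close> changes
  it on a \<gamma>-null set only, but provides a representative that obeys the bounds at every
  point, also outside \<Omega>. Passing from the closure to \<Omega> in the mass is free because
  \<gamma> gives no weight to the complement of \<Omega>.\<close>

lemma M_abc_density:
  assumes \<mu>: "\<mu> \<in> M_abc a b c \<Omega>" and "a \<le> b"
  obtains \<rho> where "\<rho> \<in> borel_measurable borel" "\<And>x. a \<le> \<rho> x" "\<And>x. \<rho> x \<le> b"
    "\<mu> = dens_measure \<rho> \<gamma>" "(\<integral>x. indicator \<Omega> x * \<rho> x \<partial>lborel) = c"
proof -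
  obtain r where r: "locally_integrable \<gamma> r" "\<mu> = dens_measure r \<gamma>"
    "AE x in \<gamma>. a \<le> r x \<and> r x \<le> b" and c: "\<mu> (closure \<Omega>) = c"
    using \<mu> by (auto simp: M_abc_def)
  define \<rho> where "\<rho> x = max a (min b (r x))" for x
  have rm[measurable]: "r \<in> borel_measurable borel" using r by (simp add: locally_integrable_def)
  have \<rho>m[measurable]: "\<rho> \<in> borel_measurable borel" unfolding \<rho>_def by measurable
  have "(LINT x:A|\<gamma>. r x) = (LINT x:A|\<gamma>. \<rho> x)" if "A \<in> sets borel" for A
    unfolding set_lebesgue_integral_def
  proof (rule integral_cong_AE)
    show "AE x in \<gamma>. indicat_real A x *\<^sub>R r x = indicat_real A x *\<^sub>R \<rho> x"
      using r(3) by eventually_elim (auto simp: \<rho>_def)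
  qed (use that in \<open>auto simp: measurable_gamma\<close>)
  then have \<mu>_eq: "\<mu> = dens_measure \<rho> \<gamma>"
    unfolding r(2) by (auto simp: dens_measure_def bounded_borel_iff fun_eq_iff)
  have cl: "closure \<Omega> \<in> bounded_borel" using bounded by (auto simp: bounded_borel_iff)
  have "c = (LINT x|\<gamma>. indicator (closure \<Omega>) x *\<^sub>R \<rho> x)"
    using c cl by (simp add: \<mu>_eq dens_measure_def set_lebesgue_integral_def)
  also have "\<dots> = (\<integral>x. indicator \<Omega> x *\<^sub>R (indicator (closure \<Omega>) x *\<^sub>R \<rho> x) \<partial>lborel)"
    by (rule integral_gamma) auto
  also have "\<dots> = (\<integral>x. indicator \<Omega> x * \<rho> x \<partial>lborel)"
    using closure_subset[of \<Omega>] by (intro Bochner_Integration.integral_cong) (auto simp: indicator_def)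
  finally show ?thesis
    using \<open>a \<le> b\<close> \<mu>_eq by (intro that[of \<rho>]) (auto simp: \<rho>_def)
qed

lemma total_variation_gamma_le:
  fixes f :: "'a \<Rightarrow> 'b::euclidean_space"
  assumes "f \<in> borel_measurable borel" and "\<And>x. norm (f x) \<le> N" and "B \<in> sets borel"
  shows "total_variation (dens_measure f \<gamma>) B \<le> ennreal (N * vol)"
proof -
  have "N \<ge> 0" using assms(2) norm_ge_zero order_trans by blast
  have "total_variation (dens_measure f \<gamma>) B \<le> (\<integral>\<^sup>+x\<in>B. norm (f x) \<partial>\<gamma>)"
    using assms by (intro total_variation_dens_measure_le sets_gamma integrable_gamma_bounded)
  also have "\<dots> \<le> (\<integral>\<^sup>+x. ennreal N \<partial>\<gamma>)"
    using assms(2) by (intro nn_integral_mono) (auto simp: indicator_def intro: ennreal_leI)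
  also have "\<dots> = ennreal (N * vol)"
    using \<open>N \<ge> 0\<close> vol_pos by (simp add: space_gamma emeasure_gamma ennreal_mult)
  finally show ?thesis .
qed

lemma sint_gamma:
  assumes [measurable]: "r \<in> borel_measurable borel" "k \<in> borel_measurable borel"
    and r: "\<And>x. \<bar>r x\<bar> \<le> N" and k: "\<And>x. \<bar>k x\<bar> \<le> B"
  shows "sint (dens_measure r \<gamma>) k = (\<integral>x. r x * k x \<partial>\<gamma>)" and "integrable \<gamma> (\<lambda>x. r x * k x)"
proof -
  have N: "N \<ge> 0" using r[of undefined] by linarith
  show *: "integrable \<gamma> (\<lambda>x. r x * k x)"
    using r k N by (intro integrable_gamma_bounded[where B = "N * B"]) (auto simp: abs_mult intro!: mult_mono)
  have "integrable \<gamma> r" using r by (intro integrable_gamma_bounded[where B = N]) auto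
  then show "sint (dens_measure r \<gamma>) k = (\<integral>x. r x * k x \<partial>\<gamma>)"
    by (rule sint_dens_measure[OF sets_gamma _ _ *]) auto
qed

text \<open>A curve with two moving modes \<open>f\<^sub>0, f\<^sub>1\<close>: since the flux depends linearly on the mode, the
  momentum is obtained by differentiating the coefficients.\<close>

lemma two_mode_curve_in_CE:
  fixes A B A' B' :: "real \<Rightarrow> real"
  assumes f0[measurable]: "f0 \<in> borel_measurable borel" and f1[measurable]: "f1 \<in> borel_measurable borel"
    and M: "\<And>x. \<bar>f0 x\<bar> \<le> M" "\<And>x. \<bar>f1 x\<bar> \<le> M"
    and mean: "(\<integral>x. indicator \<Omega> x * f0 x \<partial>lborel) = 0" "(\<integral>x. indicator \<Omega> x * f1 x \<partial>lborel) = 0"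
    and A: "\<And>t. (A has_real_derivative A' t) (at t)" and B: "\<And>t. (B has_real_derivative B' t) (at t)"
    and A': "continuous_on UNIV A'" and B': "continuous_on UNIV B'"
  shows "(\<lambda>t. dens_measure (\<lambda>x. m + A t * f0 x + B t * f1 x) \<gamma>,
          \<lambda>t. dens_measure (\<lambda>x. A' t *\<^sub>R flux f0 x + B' t *\<^sub>R flux f1 x) \<gamma>) \<in> CE 1"
proof -
  define r where "r t x = m + A t * f0 x + B t * f1 x" for t x
  define w where "w t x = A' t *\<^sub>R flux f0 x + B' t *\<^sub>R flux f1 x" for t x
  define L where "L = flux_bound M / vol"
  have M0: "M \<ge> 0" using M(1)[of undefined] by linarith
  have L: "norm (flux f0 x) \<le> L" "norm (flux f1 x) \<le> L" for x
    unfolding L_def using norm_flux_le f0 f1 M by blast+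
  have L0: "L \<ge> 0" using L(1) norm_ge_zero order_trans by blast
  have cA: "continuous_on UNIV A" and cB: "continuous_on UNIV B"
    using A B by (meson DERIV_isCont continuous_at_imp_continuous_on)+
  have [measurable]: "A \<in> borel_measurable borel" "B \<in> borel_measurable borel"
    "A' \<in> borel_measurable borel" "B' \<in> borel_measurable borel"
    using cA cB A' B' by (auto intro: borel_measurable_continuous_onI)
  have [measurable]: "flux f0 \<in> borel_measurable borel" "flux f1 \<in> borel_measurable borel"
    by (auto intro: measurable_flux)
  have [measurable]: "r t \<in> borel_measurable borel" "w t \<in> borel_measurable borel" for t
    unfolding r_def w_def by measurable
  have rb: "\<bar>r t x\<bar> \<le> \<bar>m\<bar> + \<bar>A t\<bar> * M + \<bar>B t\<bar> * M" for t x
  proof -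
    have "\<bar>A t * f0 x\<bar> \<le> \<bar>A t\<bar> * M" "\<bar>B t * f1 x\<bar> \<le> \<bar>B t\<bar> * M"
      unfolding abs_mult using M by (auto intro!: mult_left_mono)
    then show ?thesis unfolding r_def by linarith
  qed
  have wb: "norm (w t x) \<le> \<bar>A' t\<bar> * L + \<bar>B' t\<bar> * L" for t x
    unfolding w_def using L
    by (intro norm_triangle_le add_mono) (auto intro!: mult_left_mono)
  have bdd: "\<exists>N. \<forall>t\<in>{0..1}. \<bar>F t\<bar> \<le> N" if "continuous_on UNIV F" for F :: "real \<Rightarrow> real"
  proof -
    have "bounded (F ` {0..1})"
      using that by (intro compact_imp_bounded compact_continuous_image) (auto intro: continuous_on_subset)
    then show ?thesis by (auto simp: bounded_iff)
  qed
  obtain a0 where a0: "\<And>t. t \<in> {0..1} \<Longrightarrow> \<bar>A t\<bar> \<le> a0" using bdd[OF cA] by blast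
  obtain b0 where b0: "\<And>t. t \<in> {0..1} \<Longrightarrow> \<bar>B t\<bar> \<le> b0" using bdd[OF cB] by blast
  obtain a1 where a1: "\<And>t. t \<in> {0..1} \<Longrightarrow> \<bar>A' t\<bar> \<le> a1" using bdd[OF A'] by blast
  obtain b1 where b1: "\<And>t. t \<in> {0..1} \<Longrightarrow> \<bar>B' t\<bar> \<le> b1" using bdd[OF B'] by blast
  define rN where "rN = \<bar>m\<bar> + a0 * M + b0 * M"
  define wN where "wN = a1 * L + b1 * L"
  have rN: "\<bar>r t x\<bar> \<le> rN" if "t \<in> {0..1}" for t x
  proof -
    have "\<bar>A t\<bar> * M \<le> a0 * M" "\<bar>B t\<bar> * M \<le> b0 * M"
      using a0 b0 that M0 by (auto intro!: mult_right_mono)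
    then show ?thesis using rb[of t x] by (simp add: rN_def)
  qed
  have wN: "norm (w t x) \<le> wN" if "t \<in> {0..1}" for t x
  proof -
    have "\<bar>A' t\<bar> * L \<le> a1 * L" "\<bar>B' t\<bar> * L \<le> b1 * L"
      using a1 b1 that L0 by (auto intro!: mult_right_mono)
    then show ?thesis using wb[of t x] by (simp add: wN_def)
  qed
  have int_r: "integrable \<gamma> (r t)" for t
    using rb by (intro integrable_gamma_bounded) auto
  have int_w: "integrable \<gamma> (w t)" for t
    using wb by (intro integrable_gamma_bounded) auto
  have int_U: "integrable \<gamma> (flux f0)" "integrable \<gamma> (flux f1)"
    using L by (auto intro!: integrable_gamma_bounded[where B = L])

  have "weak_star_cont_on {0..1} (\<lambda>t. dens_measure (r t) \<gamma>)"
    unfolding weak_star_cont_on_def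
  proof
    fix k :: "'a \<Rightarrow> real" assume k: "k \<in> C_c"
    obtain K where K: "\<And>x. \<bar>k x\<bar> \<le> K" using C_c_bounded[OF k] by blast
    have [measurable]: "k \<in> borel_measurable borel"
      using k by (auto simp: C_c_def intro: borel_measurable_continuous_onI)
    have i: "integrable \<gamma> k" "integrable \<gamma> (\<lambda>x. f0 x * k x)" "integrable \<gamma> (\<lambda>x. f1 x * k x)"
      using K sint_gamma(2)[OF f0 _ M(1) K] sint_gamma(2)[OF f1 _ M(2) K]
      by (auto intro: integrable_gamma_bounded[where B = K])
    \<comment> \<open>The pairing with a fixed test function is affine in the coefficients
      \<open>A t\<close> and \<open>B t\<close>, so weak* continuity reduces to their
      continuity.\<close>
    have "sint (dens_measure (r t) \<gamma>) k
        = m * (\<integral>x. k x \<partial>\<gamma>) + A t * (\<integral>x. f0 x * k x \<partial>\<gamma>) + B t * (\<integral>x. f1 x * k x \<partial>\<gamma>)" for t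
    proof -
      have "sint (dens_measure (r t) \<gamma>) k = (\<integral>x. r t x * k x \<partial>\<gamma>)"
        by (rule sint_gamma(1)[OF _ _ rb K]) auto
      also have "\<dots> = (\<integral>x. m * k x + A t * (f0 x * k x) + B t * (f1 x * k x) \<partial>\<gamma>)"
        by (intro Bochner_Integration.integral_cong) (auto simp: r_def algebra_simps)
      finally show ?thesis using i by simp
    qed
    then show "continuous_on {0..1} (\<lambda>t. sint (dens_measure (r t) \<gamma>) k)"
      using cA cB by (auto intro!: continuous_intros intro: continuous_on_subset)
  qed
  moreover have "borel_family {0..1} (\<lambda>t. dens_measure (w t) \<gamma>)"
    unfolding borel_family_def
  proof
    fix C :: "'a set" assume C: "C \<in> bounded_borel"
    then have "C \<in> sets borel" by (simp add: bounded_borel_iff)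
    then have i: "integrable \<gamma> (\<lambda>x. indicat_real C x *\<^sub>R flux f0 x)" "integrable \<gamma> (\<lambda>x. indicat_real C x *\<^sub>R flux f1 x)"
      using int_U by (auto intro!: integrable_mult_indicator simp: sets_gamma)
    have "dens_measure (w t) \<gamma> C = A' t *\<^sub>R (LINT x:C|\<gamma>. flux f0 x) + B' t *\<^sub>R (LINT x:C|\<gamma>. flux f1 x)" for t
    proof -
      have "dens_measure (w t) \<gamma> C = (\<integral>x. A' t *\<^sub>R (indicat_real C x *\<^sub>R flux f0 x) + B' t *\<^sub>R (indicat_real C x *\<^sub>R flux f1 x) \<partial>\<gamma>)"
        using C unfolding dens_measure_def set_lebesgue_integral_def
        by (auto simp: w_def algebra_simps intro!: Bochner_Integration.integral_cong)
      also have "\<dots> = A' t *\<^sub>R (LINT x:C|\<gamma>. flux f0 x) + B' t *\<^sub>R (LINT x:C|\<gamma>. flux f1 x)"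
        unfolding set_lebesgue_integral_def
        using i by (subst Bochner_Integration.integral_add) (simp_all del: scaleR_scaleR)
      finally show ?thesis .
    qed
    then show "(\<lambda>t. dens_measure (w t) \<gamma> C) \<in> borel_measurable (restrict_space borel {0..1})"
      by (simp only:) (intro measurable_restrict_space1; measurable)
  qed
  moreover have "(\<integral>\<^sup>+t\<in>{0..1}. total_variation (dens_measure (r t) \<gamma>) (ball 0 R) \<partial>lborel) < \<infinity>" for R
  proof -
    have "(\<integral>\<^sup>+t\<in>{0..1}. total_variation (dens_measure (r t) \<gamma>) (ball 0 R) \<partial>lborel) \<le> ennreal (rN * vol)"
      using rN by (intro nn_integral_unit_interval_le total_variation_gamma_le) auto
    then show ?thesis using ennreal_less_top order_le_less_trans by fastforce
  qed
  moreover have "(\<integral>\<^sup>+t\<in>{0..1}. total_variation (dens_measure (w t) \<gamma>) (ball 0 R) \<partial>lborel) < \<infinity>" for R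
  proof -
    have "(\<integral>\<^sup>+t\<in>{0..1}. total_variation (dens_measure (w t) \<gamma>) (ball 0 R) \<partial>lborel) \<le> ennreal (wN * vol)"
      using wN by (intro nn_integral_unit_interval_le total_variation_gamma_le) auto
    then show ?thesis using ennreal_less_top order_le_less_trans by fastforce
  qed
  moreover have "(LINT t:{0..1}|lborel. sint (dens_measure (r t) \<gamma>) (\<lambda>x. time_deriv \<zeta> (x, t))) +
      (LINT t:{0..1}|lborel. vint (dens_measure (w t) \<gamma>) (\<lambda>x. space_grad \<zeta> (x, t))) = 0"
    if \<zeta>: "\<zeta> \<in> C1_c (UNIV \<times> {0<..<1})" for \<zeta>
  proof -
    obtain Z where Z: "\<And>z. \<bar>\<zeta> z\<bar> \<le> Z" using C1_c_bounded[OF \<zeta>] by blast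
    obtain D where D: "\<And>z. \<bar>time_deriv \<zeta> z\<bar> \<le> D"
      using C1_c_derivative_bounded[OF \<zeta>] unfolding time_deriv_def by blast
    obtain G where G: "\<And>z. norm (space_grad \<zeta> z) \<le> G" using space_grad_bounded[OF \<zeta>] by blast
    have cD: "continuous_on UNIV (time_deriv \<zeta>)" and c\<zeta>: "continuous_on UNIV \<zeta>"
      using C1_c_D[OF \<zeta>] by (simp_all add: time_deriv_def[abs_def])
    have cG: "continuous_on UNIV (space_grad \<zeta>)" by (rule continuous_space_grad[OF \<zeta>])
    have [measurable]: "time_deriv \<zeta> \<in> borel_measurable (borel \<Otimes>\<^sub>M borel)"
      "\<zeta> \<in> borel_measurable (borel \<Otimes>\<^sub>M borel)" "space_grad \<zeta> \<in> borel_measurable (borel \<Otimes>\<^sub>M borel)"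
      unfolding borel_prod using cD c\<zeta> cG by (auto intro: borel_measurable_continuous_onI)
    have rN0: "rN \<ge> 0" using rN[of 0 undefined] by auto
    have Z0: "Z \<ge> 0" using Z[of undefined] by linarith
    let ?I = "indicator {0..1::real} :: real \<Rightarrow> real"
    \<comment> \<open>The time derivative of \<open>r\<close>. Through the weak divergence formula,
      pairing the momentum with the gradient of \<zeta> becomes pairing \<open>r'\<close> with
      \<zeta>, so \<open>F1\<close> and \<open>F2\<close> below are the two halves of the product
      rule for \<open>r\<close> times \<zeta>.\<close>
    define r' where "r' t x = A' t * f0 x + B' t * f1 x" for t x
    have r'N: "\<bar>r' t x\<bar> \<le> a1 * M + b1 * M" if "t \<in> {0..1}" for t x
    proof -
      have "\<bar>A' t * f0 x\<bar> \<le> a1 * M" "\<bar>B' t * f1 x\<bar> \<le> b1 * M"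
        unfolding abs_mult using M M0 a1[OF that] b1[OF that] by (auto intro!: mult_mono)
      then show ?thesis unfolding r'_def by linarith
    qed
    have r'N0: "a1 * M + b1 * M \<ge> 0" using r'N[of 0 undefined] by auto
    define F1 where "F1 t x = ?I t * (indicator \<Omega> x * (r t x * time_deriv \<zeta> (x, t)))" for t x
    define F2 where "F2 t x = ?I t * (indicator \<Omega> x * (r' t x * \<zeta> (x, t)))" for t x
    have [measurable]: "(\<lambda>(t, x). r t x) \<in> borel_measurable (borel \<Otimes>\<^sub>M borel)"
      "(\<lambda>(t, x). r' t x) \<in> borel_measurable (borel \<Otimes>\<^sub>M borel)"
      unfolding r_def r'_def by measurable
    have m1: "(\<lambda>(t, x). F1 t x) \<in> borel_measurable borel"
      unfolding F1_def borel_prod[symmetric] by measurable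
    have m2: "(\<lambda>(t, x). F2 t x) \<in> borel_measurable borel"
      unfolding F2_def borel_prod[symmetric] by measurable
    have b1: "\<bar>F1 t x\<bar> \<le> rN * D" for t x
    proof -
      have "\<bar>r t x * time_deriv \<zeta> (x, t)\<bar> \<le> rN * D" if "t \<in> {0..1}"
        unfolding abs_mult using rN[OF that] D rN0 by (intro mult_mono) auto
      moreover have "0 \<le> rN * D" using rN0 D[of undefined] by (intro mult_nonneg_nonneg) linarith+
      ultimately show ?thesis by (auto simp: F1_def indicator_def)
    qed
    have b2: "\<bar>F2 t x\<bar> \<le> (a1 * M + b1 * M) * Z" for t x
    proof -
      have "\<bar>r' t x * \<zeta> (x, t)\<bar> \<le> (a1 * M + b1 * M) * Z" if "t \<in> {0..1}"
        unfolding abs_mult using r'N[OF that] Z r'N0 by (intro mult_mono) auto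
      moreover have "0 \<le> (a1 * M + b1 * M) * Z" using r'N0 Z0 by (intro mult_nonneg_nonneg)
      ultimately show ?thesis by (auto simp: F2_def indicator_def)
    qed
    have z1: "F1 t x = 0" and z2: "F2 t x = 0" if "t \<notin> {0..1} \<or> x \<notin> \<Omega>" for t x
      using that by (auto simp: F1_def F2_def)
    note F1 = lborel_iterated_integral_bounded_support[OF m1 b1 bounded_closed_interval bounded z1]
    note F2 = lborel_iterated_integral_bounded_support[OF m2 b2 bounded_closed_interval bounded z2]
    have e1: "(LINT t:{0..1}|lborel. sint (dens_measure (r t) \<gamma>) (\<lambda>x. time_deriv \<zeta> (x, t)))
        = (\<integral>t. (\<integral>x. F1 t x \<partial>lborel) \<partial>lborel)"
      unfolding set_lebesgue_integral_def
    proof (intro Bochner_Integration.integral_cong refl)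
      fix t
      have "sint (dens_measure (r t) \<gamma>) (\<lambda>x. time_deriv \<zeta> (x, t)) = (\<integral>x. r t x * time_deriv \<zeta> (x, t) \<partial>\<gamma>)"
        by (rule sint_gamma(1)[OF _ _ rb D]) auto
      also have "\<dots> = (\<integral>x. indicator \<Omega> x *\<^sub>R (r t x * time_deriv \<zeta> (x, t)) \<partial>lborel)"
        by (rule integral_gamma) measurable
      finally show "?I t *\<^sub>R sint (dens_measure (r t) \<gamma>) (\<lambda>x. time_deriv \<zeta> (x, t)) = (\<integral>x. F1 t x \<partial>lborel)"
        by (simp add: F1_def)
    qed
    have e2: "(LINT t:{0..1}|lborel. vint (dens_measure (w t) \<gamma>) (\<lambda>x. space_grad \<zeta> (x, t)))
        = (\<integral>t. (\<integral>x. F2 t x \<partial>lborel) \<partial>lborel)"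
      unfolding set_lebesgue_integral_def
    proof (intro Bochner_Integration.integral_cong refl)
      fix t
      let ?g = "\<lambda>x. space_grad \<zeta> (x, t)"
      have cg: "continuous_on UNIV ?g"
        by (intro continuous_on_compose2[OF cG] continuous_intros) auto
      have [measurable]: "?g \<in> borel_measurable borel" by measurable
      have flux_g: "(\<integral>x. flux f x \<bullet> ?g x \<partial>\<gamma>) = (\<integral>x. indicator \<Omega> x * f x * \<zeta> (x, t) \<partial>lborel)"
        and int_g: "integrable \<gamma> (\<lambda>x. flux f x \<bullet> ?g x)"
        if [measurable]: "f \<in> borel_measurable borel" and f: "\<And>x. \<bar>f x\<bar> \<le> M"
          "(\<integral>x. indicator \<Omega> x * f x \<partial>lborel) = 0" for f
      proof -
        have [measurable]: "flux f \<in> borel_measurable borel" by (rule measurable_flux) auto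
        have "(\<integral>x. flux f x \<bullet> ?g x \<partial>\<gamma>) = (\<integral>x. indicator \<Omega> x *\<^sub>R (flux f x \<bullet> ?g x) \<partial>lborel)"
          by (rule integral_gamma) measurable
        also have "\<dots> = (\<integral>x. ?g x \<bullet> flux f x \<partial>lborel)"
          using flux_outside[of _ f]
          by (intro Bochner_Integration.integral_cong) (auto simp: indicator_def inner_commute)
        also have "\<dots> = (\<integral>x. indicator \<Omega> x * f x * \<zeta> (x, t) \<partial>lborel)"
          by (rule flux_weak_divergence[OF that has_derivative_space_grad[OF \<zeta>] cg G])
        finally show "(\<integral>x. flux f x \<bullet> ?g x \<partial>\<gamma>) = (\<integral>x. indicator \<Omega> x * f x * \<zeta> (x, t) \<partial>lborel)" .
        have "norm (flux f x \<bullet> ?g x) \<le> flux_bound M / vol * G" for x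
        proof -
          have "norm (flux f x) * norm (?g x) \<le> flux_bound M / vol * G"
            using norm_flux_le[OF that(1,2), of x] G L0 by (intro mult_mono) (auto simp: L_def)
          then show ?thesis using Cauchy_Schwarz_ineq2[of "flux f x" "?g x"] by simp
        qed
        then show "integrable \<gamma> (\<lambda>x. flux f x \<bullet> ?g x)"
          by (intro integrable_gamma_bounded) measurable
      qed
      note g0 = flux_g[OF f0 M(1) mean(1)] int_g[OF f0 M(1) mean(1)]
      note g1 = flux_g[OF f1 M(2) mean(2)] int_g[OF f1 M(2) mean(2)]
      have i: "integrable lborel (\<lambda>x. indicator \<Omega> x * f x * \<zeta> (x, t))"
        if [measurable]: "f \<in> borel_measurable borel" and f: "\<And>x. \<bar>f x\<bar> \<le> M" for f
      proof (rule integrable_lborel_bounded_support[where B = "M * Z" and S = \<Omega>])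
        show "norm (indicator \<Omega> x * f x * \<zeta> (x, t)) \<le> M * Z" for x
          using f[of x] Z[of "(x, t)"] M0 Z0 by (cases "x \<in> \<Omega>") (auto simp: abs_mult intro!: mult_mono)
        show "(\<lambda>x. indicator \<Omega> x * f x * \<zeta> (x, t)) \<in> borel_measurable borel" by measurable
      qed (use bounded in auto)
      have "vint (dens_measure (w t) \<gamma>) ?g = (\<integral>x. w t x \<bullet> ?g x \<partial>\<gamma>)"
        by (rule vint_dens_measure[OF sets_gamma int_w _ G]) measurable
      also have "\<dots> = (\<integral>x. A' t * (flux f0 x \<bullet> ?g x) + B' t * (flux f1 x \<bullet> ?g x) \<partial>\<gamma>)"
        by (simp add: w_def inner_add_left)
      also have "\<dots> = A' t * (\<integral>x. indicator \<Omega> x * f0 x * \<zeta> (x, t) \<partial>lborel)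
          + B' t * (\<integral>x. indicator \<Omega> x * f1 x * \<zeta> (x, t) \<partial>lborel)"
        using g0 g1 by simp
      also have "\<dots> = (\<integral>x. A' t * (indicator \<Omega> x * f0 x * \<zeta> (x, t)) + B' t * (indicator \<Omega> x * f1 x * \<zeta> (x, t)) \<partial>lborel)"
        using i[OF f0 M(1)] i[OF f1 M(2)] by simp
      also have "\<dots> = (\<integral>x. indicator \<Omega> x * (r' t x * \<zeta> (x, t)) \<partial>lborel)"
        by (intro Bochner_Integration.integral_cong) (auto simp: r'_def algebra_simps)
      finally show "?I t *\<^sub>R vint (dens_measure (w t) \<gamma>) ?g = (\<integral>x. F2 t x \<partial>lborel)"
        by (simp add: F2_def)
    qed
    \<comment> \<open>At each fixed \<open>x\<close> the sum is a total time derivative, and \<zeta>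
      vanishes at the times 0 and 1 because its support lies over the open interval.\<close>
    have "(\<integral>t. F1 t x + F2 t x \<partial>lborel) = 0" for x
    proof -
      have dr: "((\<lambda>t. r t x) has_real_derivative r' t x) (at t)" for t
        unfolding r_def r'_def by (auto intro!: derivative_eq_intros A B)
      have "((\<lambda>t. r t x * \<zeta> (x, t)) has_vector_derivative r t x * time_deriv \<zeta> (x, t) + r' t x * \<zeta> (x, t))
          (at t within {0..1})" for t
        using DERIV_mult[OF dr has_derivative_time_deriv[OF \<zeta>, of x], of t]
        by (auto simp: has_real_derivative_iff_has_vector_derivative[symmetric] algebra_simps
            intro: has_field_derivative_at_within)
      moreover have "continuous_on {0..1} (\<lambda>t. r t x * time_deriv \<zeta> (x, t) + r' t x * \<zeta> (x, t))"
        unfolding r_def r'_def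
        by (intro continuous_intros continuous_on_compose2[OF cD] continuous_on_compose2[OF c\<zeta>]
            continuous_on_subset[OF cA] continuous_on_subset[OF cB] continuous_on_subset[OF A']
            continuous_on_subset[OF B']) auto
      ultimately have "(\<integral>t. ?I t *\<^sub>R (r t x * time_deriv \<zeta> (x, t) + r' t x * \<zeta> (x, t)) \<partial>lborel)
          = r 1 x * \<zeta> (x, 1) - r 0 x * \<zeta> (x, 0)"
        by (intro integral_FTC_atLeastAtMost) auto
      also have "\<dots> = 0" using C1_c_D(5)[OF \<zeta>, of "(x, 0)"] C1_c_D(5)[OF \<zeta>, of "(x, 1)"] by simp
      finally have "(\<integral>t. ?I t *\<^sub>R (r t x * time_deriv \<zeta> (x, t) + r' t x * \<zeta> (x, t)) \<partial>lborel) = 0" .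
      moreover have "F1 t x + F2 t x
          = indicator \<Omega> x * (?I t *\<^sub>R (r t x * time_deriv \<zeta> (x, t) + r' t x * \<zeta> (x, t)))" for t
        by (simp add: F1_def F2_def algebra_simps)
      ultimately show ?thesis by simp
    qed
    then have "0 = (\<integral>x. (\<integral>t. F1 t x + F2 t x \<partial>lborel) \<partial>lborel)" by simp
    \<comment> \<open>The cancellation takes place with time integrated first, whereas the weak
      formulation integrates space first; both orders are compared with the integral over the
      product.\<close>
    also have "\<dots> = (\<integral>p. (case p of (t, x) \<Rightarrow> F1 t x + F2 t x) \<partial>lborel)"
    proof (rule lborel_iterated_integral_bounded_support(3)
        [where B = "rN * D + (a1 * M + b1 * M) * Z" and S = "{0..1}" and T = \<Omega>])
      show "(\<lambda>(t, x). F1 t x + F2 t x) \<in> borel_measurable borel"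
        using borel_measurable_add[OF m1 m2] by (simp add: split_beta')
      show "\<bar>F1 t x + F2 t x\<bar> \<le> rN * D + (a1 * M + b1 * M) * Z" for t x
        using b1[of t x] b2[of t x] by linarith
    qed (use bounded z1 z2 in auto)
    also have "\<dots> = (\<integral>p. (case p of (t, x) \<Rightarrow> F1 t x) \<partial>lborel) + (\<integral>p. (case p of (t, x) \<Rightarrow> F2 t x) \<partial>lborel)"
      using Bochner_Integration.integral_add[OF F1(1) F2(1)] by (simp add: split_beta')
    finally show ?thesis unfolding e1 e2 using F1(2) F2(2) by simp
  qed
  moreover have "dens_measure (r t) \<gamma> \<in> M_loc" "dens_measure (w t) \<gamma> \<in> M_loc" for t
    by (rule dens_measure_in_M_loc[OF sets_gamma int_r] dens_measure_in_M_loc[OF sets_gamma int_w])+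
  ultimately show ?thesis
    unfolding CE_def r_def w_def by auto
qed

text \<open>The interpolation of the endpoints is pulled towards the constant density \<open>m\<close> by
  \<open>s = \<epsilon> t\<^sup>2 (1 - t)\<^sup>2\<close> and run at speed \<open>\<theta>' = 6 t (1 - t)\<close>: then \<open>s'\<^sup>2 / s \<le> 4 \<epsilon>\<close> and
  \<open>\<theta>'\<^sup>2 / s = 36 / \<epsilon>\<close>, so the degeneracy \<open>1 / s\<close> of the action costs nothing at the endpoints.\<close>

lemma W_dist_le:
  fixes \<phi> :: "real \<times> 'a \<Rightarrow> ennreal"
  assumes \<phi>: "edom \<phi> \<noteq> {}" and C0: "C \<ge> 0"
    and C: "\<And>q s w. a \<le> q \<Longrightarrow> q \<le> b \<Longrightarrow> 0 < s \<Longrightarrow> s \<le> 1 \<Longrightarrow>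
      \<phi> ((1 - s) * q + s * m, w) \<le> ennreal (C * (norm w)\<^sup>2 / s)"
    and \<rho>0[measurable]: "\<rho>0 \<in> borel_measurable borel" and \<rho>1[measurable]: "\<rho>1 \<in> borel_measurable borel"
    and ab: "\<And>x. a \<le> \<rho>0 x" "\<And>x. \<rho>0 x \<le> b" "\<And>x. a \<le> \<rho>1 x" "\<And>x. \<rho>1 x \<le> b" and m: "a \<le> m" "m \<le> b"
    and mean: "(\<integral>x. indicator \<Omega> x * (\<rho>0 x - m) \<partial>lborel) = 0" "(\<integral>x. indicator \<Omega> x * (\<rho>1 x - m) \<partial>lborel) = 0"
    and \<epsilon>: "0 < \<epsilon>" "\<epsilon> \<le> 1"
  defines "L \<equiv> flux_bound (b - a) / vol"
  defines "U0 \<equiv> flux (\<lambda>x. \<rho>0 x - m)" and "U1 \<equiv> flux (\<lambda>x. \<rho>1 x - m)"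
  shows "W_dist 2 \<phi> \<gamma> (dens_measure \<rho>0 \<gamma>) (dens_measure \<rho>1 \<gamma>)
    \<le> ennreal (sqrt (C * (8 * \<epsilon> * L\<^sup>2 * vol + 72 / \<epsilon> * (\<integral>x. (norm (U1 x - U0 x))\<^sup>2 \<partial>\<gamma>))))"
proof -
  define f0 where "f0 x = \<rho>0 x - m" for x
  define f1 where "f1 x = \<rho>1 x - m" for x
  have fm[measurable]: "f0 \<in> borel_measurable borel" "f1 \<in> borel_measurable borel"
    unfolding f0_def f1_def by measurable
  have M: "\<bar>f0 x\<bar> \<le> b - a" "\<bar>f1 x\<bar> \<le> b - a" for x
    using ab[of x] m by (auto simp: f0_def f1_def abs_le_iff)
  have U: "U0 = flux f0" "U1 = flux f1" by (simp_all add: U0_def U1_def f0_def[abs_def] f1_def[abs_def])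
  have Um[measurable]: "U0 \<in> borel_measurable borel" "U1 \<in> borel_measurable borel"
    unfolding U by (auto intro: measurable_flux)
  have L: "norm (U0 x) \<le> L" "norm (U1 x) \<le> L" for x
    unfolding L_def U using norm_flux_le fm M by blast+
  have L0: "L \<ge> 0" using L(1) norm_ge_zero order_trans by blast
  define s where "s t = \<epsilon> * t\<^sup>2 * (1 - t)\<^sup>2" for t :: real
  \<comment> \<open>The primitive of \<open>6 * t * (1 - t)\<close> starting from 0; the factor 6
    makes it end at 1.\<close>
  define \<theta> where "\<theta> t = 3 * t\<^sup>2 - 2 * t ^ 3" for t :: real
  define s' where "s' t = 2 * \<epsilon> * t * (1 - t) * (1 - 2 * t)" for t :: real
  define \<theta>' where "\<theta>' t = 6 * t * (1 - t)" for t :: real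
  have ds: "(s has_real_derivative s' t) (at t)" for t
    unfolding s_def s'_def
    by (auto intro!: derivative_eq_intros simp: power2_eq_square) (simp add: algebra_simps)
  have d\<theta>: "(\<theta> has_real_derivative \<theta>' t) (at t)" for t
    unfolding \<theta>_def \<theta>'_def by (auto intro!: derivative_eq_intros simp: power2_eq_square algebra_simps)
  \<comment> \<open>Coefficients of the centred densities \<open>f0\<close> and \<open>f1\<close>
    when \<open>(1 - s) ((1 - \<theta>) \<rho>0 + \<theta> \<rho>1) + s m\<close> is expanded around
    \<open>m\<close>.\<close>
  define A where "A t = (1 - s t) * (1 - \<theta> t)" for t
  define B where "B t = (1 - s t) * \<theta> t" for t
  define A' where "A' t = - s' t * (1 - \<theta> t) - (1 - s t) * \<theta>' t" for t
  define B' where "B' t = - s' t * \<theta> t + (1 - s t) * \<theta>' t" for t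
  have dA: "(A has_real_derivative A' t) (at t)" and dB: "(B has_real_derivative B' t) (at t)" for t
    unfolding A_def B_def A'_def B'_def
    by (auto intro!: derivative_eq_intros ds d\<theta> simp: algebra_simps)
  have cA: "continuous_on UNIV A'" "continuous_on UNIV B'"
    unfolding A'_def B'_def s'_def \<theta>'_def s_def \<theta>_def by (intro continuous_intros)+
  define r where "r t x = m + A t * f0 x + B t * f1 x" for t x
  define w where "w t x = A' t *\<^sub>R U0 x + B' t *\<^sub>R U1 x" for t x
  define \<mu> where "\<mu> t = dens_measure (r t) \<gamma>" for t
  define \<nu> where "\<nu> t = dens_measure (w t) \<gamma>" for t
  have CE: "(\<mu>, \<nu>) \<in> CE 1"
    using two_mode_curve_in_CE[OF fm M mean[folded f0_def f1_def] dA dB cA, of m]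
    unfolding \<mu>_def[abs_def] \<nu>_def[abs_def] r_def[abs_def] w_def[abs_def] U .
  have rm[measurable]: "r t \<in> borel_measurable borel" and wm[measurable]: "w t \<in> borel_measurable borel" for t
    unfolding r_def w_def by measurable
  have rb: "norm (r t x) \<le> \<bar>m\<bar> + \<bar>A t\<bar> * (b - a) + \<bar>B t\<bar> * (b - a)" for t x
  proof -
    have "\<bar>A t * f0 x\<bar> \<le> \<bar>A t\<bar> * (b - a)" "\<bar>B t * f1 x\<bar> \<le> \<bar>B t\<bar> * (b - a)"
      unfolding abs_mult using M by (auto intro!: mult_left_mono)
    then show ?thesis unfolding r_def real_norm_def by linarith
  qed
  have wb: "norm (w t x) \<le> \<bar>A' t\<bar> * L + \<bar>B' t\<bar> * L" for t x
    unfolding w_def using L by (intro norm_triangle_le add_mono) (auto intro!: mult_left_mono)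
  define n where "n x = norm (U1 x - U0 x)" for x
  have [measurable]: "n \<in> borel_measurable borel" unfolding n_def by measurable
  have nb: "n x \<le> 2 * L" for x
    using norm_triangle_ineq4[of "U1 x" "U0 x"] L[of x] by (simp add: n_def)
  have int_n: "integrable \<gamma> (\<lambda>x. (n x)\<^sup>2)"
  proof (rule integrable_gamma_bounded[where B = "(2 * L)\<^sup>2"])
    show "norm ((n x)\<^sup>2) \<le> (2 * L)\<^sup>2" for x
      using power_mono[OF nb, of x 2] by (simp add: n_def)
  qed measurable
  define X where "X = C * (8 * \<epsilon> * L\<^sup>2 * vol + 72 / \<epsilon> * (\<integral>x. (n x)\<^sup>2 \<partial>\<gamma>))"
  have X0: "X \<ge> 0"
    unfolding X_def using C0 \<epsilon> vol_pos by (intro mult_nonneg_nonneg add_nonneg_nonneg Bochner_Integration.integral_nonneg) auto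
  have pointwise: "\<phi> (r t x, w t x) \<le> ennreal (C * (8 * \<epsilon> * L\<^sup>2 + 72 / \<epsilon> * (n x)\<^sup>2))"
    if t: "0 < t" "t < 1" for t x
  proof -
    have th: "0 \<le> \<theta> t" "\<theta> t \<le> 1"
    proof -
      have "\<theta> t = t\<^sup>2 * (3 - 2 * t)" by (simp add: \<theta>_def power2_eq_square power3_eq_cube algebra_simps)
      then show "0 \<le> \<theta> t" using t by simp
      have "1 - \<theta> t = (1 - t)\<^sup>2 * (1 + 2 * t)" by (simp add: \<theta>_def power2_eq_square power3_eq_cube algebra_simps)
      then have "0 \<le> 1 - \<theta> t" using t by simp
      then show "\<theta> t \<le> 1" by simp
    qed
    have t2: "0 < t\<^sup>2 * (1 - t)\<^sup>2" using t by simp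
    have s0: "0 < s t" using t2 \<epsilon> by (simp add: s_def mult.assoc)
    have s1: "s t \<le> 1"
    proof -
      have "t\<^sup>2 \<le> 1" "(1 - t)\<^sup>2 \<le> 1" using t by (auto intro!: power_le_one)
      then have "t\<^sup>2 * (1 - t)\<^sup>2 \<le> 1 * 1" by (intro mult_mono) auto
      then have "\<epsilon> * (t\<^sup>2 * (1 - t)\<^sup>2) \<le> 1 * 1" using \<epsilon> t2 by (intro mult_mono) auto
      then show ?thesis by (simp add: s_def mult.assoc)
    qed
    define q where "q = (1 - \<theta> t) * \<rho>0 x + \<theta> t * \<rho>1 x"
    have q: "a \<le> q" "q \<le> b"
    proof -
      have "(1 - \<theta> t) * a + \<theta> t * a \<le> q" "q \<le> (1 - \<theta> t) * b + \<theta> t * b"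
        unfolding q_def using th ab[of x] by (auto intro!: add_mono mult_left_mono)
      then show "a \<le> q" "q \<le> b" by (auto simp: algebra_simps)
    qed
    have r_eq: "r t x = (1 - s t) * q + s t * m"
      by (simp add: r_def A_def B_def q_def f0_def f1_def algebra_simps)
    \<comment> \<open>Grouping by derivatives: the part moving along the interpolation sees only the
      difference of the fields, which will be small, while the rest carries the factor
      \<open>s'\<close>, which is of order \<epsilon>.\<close>
    have w_eq: "w t x = (1 - s t) *\<^sub>R (\<theta>' t *\<^sub>R (U1 x - U0 x)) - s' t *\<^sub>R ((1 - \<theta> t) *\<^sub>R U0 x + \<theta> t *\<^sub>R U1 x)"
      by (simp add: w_def A'_def B'_def algebra_simps)
    have "norm (w t x) \<le> \<bar>\<theta>' t\<bar> * n x + \<bar>s' t\<bar> * L"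
    proof -
      have "norm ((1 - \<theta> t) *\<^sub>R U0 x + \<theta> t *\<^sub>R U1 x) \<le> (1 - \<theta> t) * L + \<theta> t * L"
        using th L[of x] by (intro norm_triangle_le add_mono) (auto intro!: mult_left_mono)
      then have "norm (s' t *\<^sub>R ((1 - \<theta> t) *\<^sub>R U0 x + \<theta> t *\<^sub>R U1 x)) \<le> \<bar>s' t\<bar> * L"
        unfolding norm_scaleR by (intro mult_left_mono) (simp_all add: left_diff_distrib)
      moreover have "norm ((1 - s t) *\<^sub>R (\<theta>' t *\<^sub>R (U1 x - U0 x))) \<le> 1 * (\<bar>\<theta>' t\<bar> * n x)"
        unfolding norm_scaleR n_def using s0 s1 by (intro mult_right_mono) auto
      ultimately show ?thesis unfolding w_eq
        by (intro order_trans[OF norm_triangle_ineq4]) auto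
    qed
    then have "(norm (w t x))\<^sup>2 \<le> (\<bar>\<theta>' t\<bar> * n x + \<bar>s' t\<bar> * L)\<^sup>2"
      by (intro power_mono) auto
    \<comment> \<open>The square of a sum is at most twice the sum of the squares. This doubles the
      constants 36 and 4 coming from the time weights to 72 and 8.\<close>
    also have "\<dots> \<le> 2 * (\<bar>\<theta>' t\<bar> * n x)\<^sup>2 + 2 * (\<bar>s' t\<bar> * L)\<^sup>2"
      using zero_le_power2[of "\<bar>\<theta>' t\<bar> * n x - \<bar>s' t\<bar> * L"] by (simp add: power2_eq_square algebra_simps)
    also have "\<dots> = 2 * (\<theta>' t)\<^sup>2 * (n x)\<^sup>2 + 2 * (s' t)\<^sup>2 * L\<^sup>2"
      by (simp add: power_mult_distrib)
    \<comment> \<open>The design of the time weights: \<open>\<theta>'\<close> squared is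
      \<open>36 / \<epsilon>\<close> times \<open>s\<close>, and \<open>s'\<close> squared is
      \<open>4 * \<epsilon> * (1 - 2 * t)\<^sup>2\<close> times \<open>s\<close>, so the factor
      \<open>s\<close> comes out exactly.\<close>
    also have "\<dots> = s t * (72 / \<epsilon> * (n x)\<^sup>2 + 8 * \<epsilon> * (1 - 2 * t)\<^sup>2 * L\<^sup>2)"
      using \<epsilon> by (simp add: s_def s'_def \<theta>'_def power2_eq_square field_simps)
    also have "\<dots> \<le> s t * (72 / \<epsilon> * (n x)\<^sup>2 + 8 * \<epsilon> * L\<^sup>2)"
    proof -
      have "(1 - 2 * t)\<^sup>2 \<le> 1" using t by (auto intro!: abs_square_le_1[THEN iffD2])
      then have "8 * \<epsilon> * (1 - 2 * t)\<^sup>2 * L\<^sup>2 \<le> 8 * \<epsilon> * 1 * L\<^sup>2"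
        using \<epsilon> by (intro mult_right_mono mult_left_mono) auto
      then show ?thesis using s0 by (intro mult_left_mono) auto
    qed
    finally have "(norm (w t x))\<^sup>2 / s t \<le> 8 * \<epsilon> * L\<^sup>2 + 72 / \<epsilon> * (n x)\<^sup>2"
      using s0 by (simp add: divide_le_eq mult.commute add.commute)
    then have "C * ((norm (w t x))\<^sup>2 / s t) \<le> C * (8 * \<epsilon> * L\<^sup>2 + 72 / \<epsilon> * (n x)\<^sup>2)"
      using C0 by (intro mult_left_mono)
    then have "ennreal (C * (norm (w t x))\<^sup>2 / s t) \<le> ennreal (C * (8 * \<epsilon> * L\<^sup>2 + 72 / \<epsilon> * (n x)\<^sup>2))"
      by (intro ennreal_leI) simp
    with C[OF q s0 s1, of "w t x"] show ?thesis
      unfolding r_eq by (rule order_trans)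
  qed
  have action_le: "action \<phi> \<gamma> (\<mu> t) (\<nu> t) \<le> ennreal X" if t: "0 < t" "t < 1" for t
  proof -
    have "action \<phi> \<gamma> (\<mu> t) (\<nu> t) = (\<integral>\<^sup>+x. \<phi> (r t x, w t x) \<partial>\<gamma>)"
      unfolding \<mu>_def \<nu>_def using \<phi>
      by (intro action_dens_measure gamma_in_M_loc_pos locally_integrable_gamma_bounded[OF rm rb]
          locally_integrable_gamma_bounded[OF wm wb])
    also have "\<dots> \<le> (\<integral>\<^sup>+x. ennreal (C * (8 * \<epsilon> * L\<^sup>2 + 72 / \<epsilon> * (n x)\<^sup>2)) \<partial>\<gamma>)"
      by (intro nn_integral_mono pointwise t)
    also have "\<dots> = ennreal (\<integral>x. C * (8 * \<epsilon> * L\<^sup>2 + 72 / \<epsilon> * (n x)\<^sup>2) \<partial>\<gamma>)"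
    proof (rule nn_integral_eq_integral)
      show "integrable \<gamma> (\<lambda>x. C * (8 * \<epsilon> * L\<^sup>2 + 72 / \<epsilon> * (n x)\<^sup>2))"
        using int_n finite_measure.integrable_const[OF finite_measure_gamma]
        by (intro integrable_mult_right Bochner_Integration.integrable_add) auto
    qed (use C0 \<epsilon> in auto)
    also have "(\<integral>x. C * (8 * \<epsilon> * L\<^sup>2 + 72 / \<epsilon> * (n x)\<^sup>2) \<partial>\<gamma>) = X"
    proof -
      have "measure \<gamma> UNIV = vol" using emeasure_gamma vol_pos by (simp add: measure_def)
      then have "(\<integral>x. 8 * \<epsilon> * L\<^sup>2 + 72 / \<epsilon> * (n x)\<^sup>2 \<partial>\<gamma>) = 8 * \<epsilon> * L\<^sup>2 * vol + 72 / \<epsilon> * (\<integral>x. (n x)\<^sup>2 \<partial>\<gamma>)"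
        using int_n finite_measure.integrable_const[OF finite_measure_gamma, of "8 * \<epsilon> * L\<^sup>2"]
        by (subst Bochner_Integration.integral_add) (auto simp: space_gamma)
      then show ?thesis by (simp only: X_def integral_mult_right_zero)
    qed
    finally show ?thesis .
  qed
  have I: "(\<integral>\<^sup>+t\<in>{0..1}. action \<phi> \<gamma> (\<mu> t) (\<nu> t) \<partial>lborel) \<le> ennreal X"
    by (rule nn_integral_unit_interval_le[OF action_le])
  \<comment> \<open>At the two end times \<open>s\<close> vanishes and \<theta> is 0 and 1, so the
    pull towards \<open>m\<close> is switched off and the prescribed measures are attained
    exactly.\<close>
  have "\<mu> 0 = dens_measure \<rho>0 \<gamma>" "\<mu> 1 = dens_measure \<rho>1 \<gamma>"
    by (simp_all add: \<mu>_def r_def[abs_def] A_def B_def s_def \<theta>_def f0_def f1_def)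
  moreover have "vsupp (\<mu> t) \<subseteq> msupp \<gamma>" "vsupp (\<nu> t) \<subseteq> msupp \<gamma>" for t
    unfolding \<mu>_def \<nu>_def
    by (intro vsupp_dens_measure_subset sets_gamma integrable_gamma_bounded[OF rm rb]
        integrable_gamma_bounded[OF wm wb])+
  ultimately have adm: "(\<mu>, \<nu>) \<in> CE_adm \<phi> \<gamma> (dens_measure \<rho>0 \<gamma>) (dens_measure \<rho>1 \<gamma>)"
    using CE I by (auto simp: CE_adm_def intro: order_le_less_trans)
  have "W_dist 2 \<phi> \<gamma> (dens_measure \<rho>0 \<gamma>) (dens_measure \<rho>1 \<gamma>)
      \<le> ennreal (enn2real (\<integral>\<^sup>+t\<in>{0..1}. action \<phi> \<gamma> (\<mu> t) (\<nu> t) \<partial>lborel) powr (1 / 2))"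
    unfolding W_dist_def by (rule INF_lower2[OF adm]) simp
  also have "\<dots> \<le> ennreal (sqrt X)"
  proof (rule ennreal_leI)
    have "enn2real (\<integral>\<^sup>+t\<in>{0..1}. action \<phi> \<gamma> (\<mu> t) (\<nu> t) \<partial>lborel) \<le> X"
      using enn2real_mono[OF I] X0 by simp
    then have "enn2real (\<integral>\<^sup>+t\<in>{0..1}. action \<phi> \<gamma> (\<mu> t) (\<nu> t) \<partial>lborel) powr (1 / 2) \<le> X powr (1 / 2)"
      by (intro powr_mono2) auto
    then show "enn2real (\<integral>\<^sup>+t\<in>{0..1}. action \<phi> \<gamma> (\<mu> t) (\<nu> t) \<partial>lborel) powr (1 / 2) \<le> sqrt X"
      using X0 by (simp add: powr_half_sqrt)
  qed
  finally show ?thesis unfolding X_def n_def .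
qed

end

section \<open>Balancing the pull towards the mean against the distance of the fields\<close>

theorem theorem4p4:
  fixes a b c :: real
    and \<phi> :: "real \<times> 'a::euclidean_space \<Rightarrow> ennreal"
    and \<Omega> :: "'a set"
    and \<mu>s :: "nat \<Rightarrow> 'a set \<Rightarrow> real"
    and \<mu> :: "'a set \<Rightarrow> real"
  assumes "a < b"
    and "\<phi> \<in> admissible_on 2 a b"
    and "bounded \<Omega>" and "convex \<Omega>" and "smooth_domain \<Omega>"
    and "c \<in> {a * measure lborel \<Omega> <..< b * measure lborel \<Omega>}"
    and "\<And>n. \<mu>s n \<in> M_abc a b c \<Omega>"
    and "\<mu> \<in> M_abc a b c \<Omega>"
    and "weak_star_conv \<mu>s \<mu>"
  shows "(\<lambda>n. W_dist 2 \<phi> (gamma_dom \<Omega>) (\<mu>s n) \<mu>) \<longlonglongrightarrow> 0"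
proof -
  interpret bounded_convex_domain \<Omega>
    using assms(3-5) by unfold_locales (auto simp: smooth_domain_def)
  \<comment> \<open>The constant density of mass \<open>c\<close>. The hypothesis on
    \<open>c\<close> places it strictly between \<open>a\<close> and \<open>b\<close>, so the
    quadratic bound on its slice is available.\<close>
  define m where "m = c / vol"
  have m: "a < m" "m < b" using assms(6) vol_pos by (auto simp: m_def vol_def field_simps)
  obtain C where C: "C \<ge> 0"
    "\<And>q s w. a \<le> q \<Longrightarrow> q \<le> b \<Longrightarrow> 0 < s \<Longrightarrow> s \<le> 1 \<Longrightarrow>
      \<phi> ((1 - s) * q + s * m, w) \<le> ennreal (C * (norm w)\<^sup>2 / s)"
    using admissible_on_interpolation_bound[OF assms(2) m] by blast
  have "\<exists>r. r \<in> borel_measurable borel \<and> (\<forall>x. a \<le> r x \<and> r x \<le> b) \<and>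
      \<mu>s n = dens_measure r \<gamma> \<and> (\<integral>x. indicator \<Omega> x * r x \<partial>lborel) = c" for n
    using M_abc_density[OF assms(7)[of n]] assms(1) by (metis less_imp_le)
  then obtain \<rho>s where \<rho>s: "\<And>n. \<rho>s n \<in> borel_measurable borel" "\<And>n x. a \<le> \<rho>s n x" "\<And>n x. \<rho>s n x \<le> b"
    "\<And>n. \<mu>s n = dens_measure (\<rho>s n) \<gamma>" "\<And>n. (\<integral>x. indicator \<Omega> x * \<rho>s n x \<partial>lborel) = c" by metis
  obtain \<rho> where \<rho>: "\<rho> \<in> borel_measurable borel" "\<And>x. a \<le> \<rho> x" "\<And>x. \<rho> x \<le> b"
    "\<mu> = dens_measure \<rho> \<gamma>" "(\<integral>x. indicator \<Omega> x * \<rho> x \<partial>lborel) = c"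
    using M_abc_density[OF assms(8)] assms(1) by (metis less_imp_le)
  have rb: "\<bar>r x\<bar> \<le> \<bar>a\<bar> + \<bar>b\<bar>" if "\<And>x. a \<le> r x" "\<And>x. r x \<le> b" for r and x :: 'a
    using that(1)[of x] that(2)[of x] by linarith
  have I\<Omega>: "integrable lborel (indicat_real \<Omega>)" using emeasure_finite by simp
  have mean0: "(\<integral>x. indicator \<Omega> x * (r x - m) \<partial>lborel) = 0"
    if [measurable]: "r \<in> borel_measurable borel" and r: "\<And>x. a \<le> r x" "\<And>x. r x \<le> b"
      "(\<integral>x. indicator \<Omega> x * r x \<partial>lborel) = c" for r
  proof -
    have "integrable lborel (\<lambda>x. indicator \<Omega> x * r x)"
      using rb[OF r(1,2)] bounded
      by (intro integrable_lborel_bounded_support[where B = "\<bar>a\<bar> + \<bar>b\<bar>" and S = \<Omega>]) (auto simp: indicator_def)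
    then have "(\<integral>x. indicator \<Omega> x * r x - m * indicator \<Omega> x \<partial>lborel) = c - m * vol"
      using I\<Omega> r(3) by (subst Bochner_Integration.integral_diff) (auto simp: vol_def)
    then show ?thesis using vol_pos by (simp add: m_def algebra_simps)
  qed
  define L where "L = flux_bound (b - a) / vol"
  define U where "U n = flux (\<lambda>x. \<rho>s n x - m)" for n
  define V where "V = flux (\<lambda>x. \<rho> x - m)"
  have fb: "\<bar>r x - m\<bar> \<le> b - a" if "\<And>x. a \<le> r x" "\<And>x. r x \<le> b" for r and x :: 'a
    using that(1)[of x] that(2)[of x] m by linarith
  have UV: "(\<lambda>n. U n x) \<longlonglongrightarrow> V x" for x
    unfolding U_def V_def
  proof (rule flux_tendsto[where M = "b - a"])
    fix k :: "'a \<Rightarrow> real" assume k: "k \<in> C_c"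
    obtain K where K: "\<And>x. \<bar>k x\<bar> \<le> K" using C_c_bounded[OF k] by blast
    have [measurable]: "k \<in> borel_measurable borel"
      using k by (auto simp: C_c_def intro: borel_measurable_continuous_onI)
    \<comment> \<open>Centring by \<open>m\<close> subtracts one and the same constant from every
      pairing, so weak* convergence passes to the centred densities whose fields are taken.\<close>
    have eq: "(\<integral>x. indicator \<Omega> x * (r x - m) * k x \<partial>lborel) = sint (dens_measure r \<gamma>) k - m * (\<integral>x. k x \<partial>\<gamma>)"
      if [measurable]: "r \<in> borel_measurable borel" and r: "\<And>x. a \<le> r x" "\<And>x. r x \<le> b" for r
    proof -
      have "(\<integral>x. indicator \<Omega> x * (r x - m) * k x \<partial>lborel) = (\<integral>x. (r x - m) * k x \<partial>\<gamma>)"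
        by (subst integral_gamma) (auto simp: mult.assoc)
      also have "\<dots> = (\<integral>x. r x * k x - m * k x \<partial>\<gamma>)" by (simp add: algebra_simps)
      also have "\<dots> = (\<integral>x. r x * k x \<partial>\<gamma>) - (\<integral>x. m * k x \<partial>\<gamma>)"
        using K by (intro Bochner_Integration.integral_diff sint_gamma(2)[OF _ _ rb[OF r] K] integrable_mult_right
            integrable_gamma_bounded[where B = K]) auto
      also have "(\<integral>x. r x * k x \<partial>\<gamma>) = sint (dens_measure r \<gamma>) k"
        by (rule sint_gamma(1)[OF _ _ rb[OF r] K, symmetric]) auto
      finally show ?thesis by simp
    qed
    have "(\<lambda>n. sint (\<mu>s n) k - m * (\<integral>x. k x \<partial>\<gamma>)) \<longlonglongrightarrow> sint \<mu> k - m * (\<integral>x. k x \<partial>\<gamma>)"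
      using assms(9) k by (intro tendsto_intros) (auto simp: weak_star_conv_def)
    then show "(\<lambda>n. \<integral>x. indicator \<Omega> x * (\<rho>s n x - m) * k x \<partial>lborel)
        \<longlonglongrightarrow> (\<integral>x. indicator \<Omega> x * (\<rho> x - m) * k x \<partial>lborel)"
      unfolding eq[OF \<rho>s(1-3)] eq[OF \<rho>(1-3)] \<rho>s(4) \<rho>(4) .
  qed (use \<rho>s \<rho> in \<open>auto intro!: fb\<close>)
  define e where "e n = (\<integral>x. (norm (V x - U n x))\<^sup>2 \<partial>\<gamma>)" for n
  have Um[measurable]: "U n \<in> borel_measurable borel" "V \<in> borel_measurable borel" for n
    unfolding U_def V_def using \<rho>s(1) \<rho>(1) by (auto intro!: measurable_flux)
  have UL: "norm (U n x) \<le> L" "norm (V x) \<le> L" for n x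
    unfolding U_def V_def L_def using \<rho>s \<rho> by (auto intro!: norm_flux_le fb)
  \<comment> \<open>Pointwise convergence of the fields, their uniform bound \<open>L\<close> and
    the finiteness of \<gamma> allow a constant as dominating function.\<close>
  have "e \<longlonglongrightarrow> (\<integral>x. 0 \<partial>\<gamma>)"
    unfolding e_def
  proof (rule integral_dominated_convergence[where w = "\<lambda>_. (2 * L)\<^sup>2"])
    show "integrable \<gamma> (\<lambda>_. (2 * L)\<^sup>2)" by (rule finite_measure.integrable_const[OF finite_measure_gamma])
    show "(\<lambda>x. (norm (V x - U n x))\<^sup>2) \<in> borel_measurable \<gamma>" for n
      unfolding measurable_gamma by measurable
    have "(\<lambda>n. (norm (V x - U n x))\<^sup>2) \<longlonglongrightarrow> (norm (V x - V x))\<^sup>2" for x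
      by (intro tendsto_intros UV)
    then show "AE x in \<gamma>. (\<lambda>n. (norm (V x - U n x))\<^sup>2) \<longlonglongrightarrow> 0" by simp
    have "norm (V x - U n x) \<le> 2 * L" for n x
      using norm_triangle_ineq4[of "V x" "U n x"] UL(2)[of x] UL(1)[of n x] by linarith
    from power_mono[OF this, of _ _ 2]
    show "AE x in \<gamma>. norm ((norm (V x - U n x))\<^sup>2) \<le> (2 * L)\<^sup>2" for n
      by simp
  qed auto
  then have e: "e \<longlonglongrightarrow> 0" by simp
  have e0: "e n \<ge> 0" for n unfolding e_def by (intro Bochner_Integration.integral_nonneg) auto
  \<comment> \<open>The square root of \<open>e n\<close> is the balancing choice. The added
    \<open>1 / (n + 1)\<close> keeps the parameter positive when the fields coincide, and the
    minimum keeps the weight of the pull at most 1.\<close>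
  define \<epsilon> where "\<epsilon> n = min 1 (sqrt (e n) + 1 / real (Suc n))" for n
  have \<epsilon>: "0 < \<epsilon> n" "\<epsilon> n \<le> 1" for n
    using e0[of n] by (auto simp: \<epsilon>_def intro!: add_nonneg_pos)
  \<comment> \<open>Either the minimum is 1 and the quotient is \<open>e n\<close>, or the parameter
    is at least \<open>sqrt (e n)\<close> and the quotient is at most \<open>sqrt (e n)\<close>; the
    sum covers both cases.\<close>
  have e\<epsilon>: "e n / \<epsilon> n \<le> e n + sqrt (e n)" for n
  proof (cases "\<epsilon> n = 1")
    case False
    then have "sqrt (e n) \<le> \<epsilon> n" by (auto simp: \<epsilon>_def min_def split: if_splits)
    then have "sqrt (e n) * sqrt (e n) \<le> sqrt (e n) * \<epsilon> n" using e0 by (intro mult_left_mono) auto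
    then have "e n / \<epsilon> n \<le> sqrt (e n)" using \<epsilon> e0 by (simp add: divide_le_eq)
    then show ?thesis using e0[of n] by linarith
  qed (use e0 in auto)
  \<comment> \<open>The minimum and the quotient are replaced by upper bounds that are continuous in
    \<open>e n\<close> and \<open>1 / (n + 1)\<close>, so the limit can be read off.\<close>
  have W: "W_dist 2 \<phi> \<gamma> (\<mu>s n) \<mu>
    \<le> ennreal (sqrt (C * (8 * (sqrt (e n) + 1 / real (Suc n)) * L\<^sup>2 * vol + 72 * (e n + sqrt (e n)))))" for n
  proof -
    have "W_dist 2 \<phi> \<gamma> (\<mu>s n) \<mu> \<le> ennreal (sqrt (C * (8 * \<epsilon> n * L\<^sup>2 * vol + 72 / \<epsilon> n * e n)))"
      unfolding \<rho>s(4) \<rho>(4) L_def e_def U_def V_def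
      using m \<rho>s \<rho>
      by (intro W_dist_le[OF admissible_on_D(3)[OF assms(2)] C] mean0 \<epsilon>) auto
    also have "\<dots> \<le> ennreal (sqrt (C * (8 * (sqrt (e n) + 1 / real (Suc n)) * L\<^sup>2 * vol + 72 * (e n + sqrt (e n)))))"
    proof (intro ennreal_leI real_sqrt_le_mono mult_left_mono[OF _ C(1)] add_mono)
      show "8 * \<epsilon> n * L\<^sup>2 * vol \<le> 8 * (sqrt (e n) + 1 / real (Suc n)) * L\<^sup>2 * vol"
        using vol_pos by (intro mult_right_mono mult_left_mono) (auto simp: \<epsilon>_def)
      show "72 / \<epsilon> n * e n \<le> 72 * (e n + sqrt (e n))" using e\<epsilon>[of n] by simp
    qed
    finally show ?thesis .
  qed
  have "(\<lambda>n. ennreal (sqrt (C * (8 * (sqrt (e n) + 1 / real (Suc n)) * L\<^sup>2 * vol + 72 * (e n + sqrt (e n))))))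
      \<longlonglongrightarrow> ennreal (sqrt (C * (8 * (sqrt 0 + 0) * L\<^sup>2 * vol + 72 * (0 + sqrt 0))))"
    by (intro tendsto_ennrealI tendsto_intros e LIMSEQ_Suc[OF lim_1_over_n])
  then have lim: "(\<lambda>n. ennreal (sqrt (C * (8 * (sqrt (e n) + 1 / real (Suc n)) * L\<^sup>2 * vol
      + 72 * (e n + sqrt (e n)))))) \<longlonglongrightarrow> 0" by simp
  show ?thesis
    by (rule tendsto_sandwich[OF _ _ tendsto_const lim]) (intro always_eventually allI zero_le W)+
qed

end
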